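(* Let $n\ge 1$, let $k$ be a positive integer, and let $\mathfrak g=osp(1|2n)$ with Cartan subalgebra $\mathfrak h$ and simple roots $\alpha_1,\dots,\alpha_n$. Let $V(k,0)$ be the universal affine vertex operator superalgebra of level $k$ associated to $\mathfrak g$, and let $V(k,0)(0)=\{v\in V(k,0)\mid h(0)v=0\ \text{for all } h\in\mathfrak h\}$. Then the vertex operator algebra $V(k,0)(0)$ is generated by the vectors $\alpha_i(-1)\mathbf 1$ for $1\le i\le n$, the vectors $e_{-\alpha}(-2)e_{\alpha}(-1)\mathbf 1$ and $x_{-\frac12\alpha}(-2)x_{\frac12\alpha}(-1)\mathbf 1$ for $\alpha\in\Delta_{0(+)}^{L}$, and the vectors $e_{-\beta}(-2)e_{\beta}(-1)\mathbf 1$ for $\beta\in\Delta_{0(+)}^{S}$.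
   Context: All vector spaces are over $\mathbb C$. $\mathfrak g=osp(1|2n)$ is the finite-dimensional simple Lie superalgebra with Cartan subalgebra $\mathfrak h$ (of dimension $n$), root system $\Delta$, even roots $\Delta_0$ (the root system of $sp(2n)$), odd roots $\Delta_1$, and root spaces $\mathfrak g_\alpha$. $\Delta_0^L$ and $\Delta_0^S$ are the sets of long and short roots of $\Delta_0$ (for $n=1$, $\Delta_0=\Delta_0^L$ and $\Delta_0^S=\emptyset$); one has $\Delta_1=\{\frac12\alpha\mid\alpha\in\Delta_0^L\}$. Fix simple roots $\alpha_1,\dots,\alpha_n$; $\Delta_{0(+)}^L,\Delta_{0(+)}^S$ are the corresponding sets of positive long and positive short even roots. $\langle\cdot,\cdot\rangle$ is the invariant even supersymmetric nondegenerate bilinear form on $\mathfrak g$ with $\langle\alpha,\alpha\rangle=2$ for $\alpha\in\Delta_0^L$, where $\mathfrak h^*$ is identified with $\mathfrak h$ via the form; $t_\alpha\in\mathfrak h$ is the image of $\alpha\in\mathfrak h^*$, i.e. $\alpha(h)=\langle t_\alpha,h\rangle$. In particular $\alpha_i(-1)\mathbf 1$ means $t_{\alpha_i}(-1)\mathbf 1$. Root vectors. For $\alpha\in\Delta_{0(+)}^S$ fix $e_{\pm\alpha}\in\mathfrak g_{\pm\alpha}$ and put $h_\alpha=2t_\alpha$ so that $[e_\alpha,e_{-\alpha}]=h_\alpha$, $[h_\alpha,e_{\pm\alpha}]=\pm2e_{\pm\alpha}$. For $\alpha\in\Delta_{0(+)}^L$ fix $e_{\pm\alpha}\in\mathfrak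 g_{\pm\alpha}$, $x_{\pm\frac12\alpha}\in\mathfrak g_{\pm\frac12\alpha}$ and put $h_\alpha=t_\alpha$ so that $[e_\alpha,e_{-\alpha}]=h_\alpha$, $[h_\alpha,e_{\pm\alpha}]=\pm2e_{\pm\alpha}$, $[h_\alpha,x_{\pm\frac12\alpha}]=\pm x_{\pm\frac12\alpha}$, $[e_\alpha,x_{\frac12\alpha}]=0$, $[e_{-\alpha},x_{\frac12\alpha}]=-x_{-\frac12\alpha}$, $[e_\alpha,x_{-\frac12\alpha}]=-x_{\frac12\alpha}$, $[e_{-\alpha},x_{-\frac12\alpha}]=0$, $\{x_{\frac12\alpha},x_{\frac12\alpha}\}=2e_\alpha$, $\{x_{\frac12\alpha},x_{-\frac12\alpha}\}=h_\alpha$, $\{x_{-\frac12\alpha},x_{-\frac12\alpha}\}=-2e_{-\alpha}$. Affine vertex superalgebra. $\widehat{\mathfrak g}=\mathfrak g\otimes\mathbb C[t,t^{-1}]\oplus\mathbb CK$ is the affine Lie superalgebra, and $V(k,0)=\mathrm{Ind}_{\mathfrak g\otimes\mathbb C[t]\oplus\mathbb CK}^{\widehat{\mathfrak g}}\mathbb C$, where $\mathfrak g\otimes\mathbb C[t]$ acts as $0$ and $K$ as $k$ on $\mathbf 1=1$. Write $a(m)$ for the action of $a\otimes t^m$; then $[a(m),b(p)]=[a,b](m+p)+m\langle a,b\rangle\delta_{m+p,0}k$ (supercommutator). $V(k,0)$ is a vertex operator superalgebra generated by $a(-1)\mathbf 1$, $a\in\mathfrak g$, with $Y(a(-1)\mathbf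 1,z)=\sum_{m\in\mathbb Z}a(m)z^{-m-1}$, vacuum $\mathbf 1$, and the Sugawara Virasoro vector $\omega_{\mathrm{aff}}$ (dual Coxeter number $n+\frac12$). $V(k,0)(0)$ is a vertex operator subalgebra with the same Virasoro vector $\omega_{\mathrm{aff}}$. *)

theory Defs
  imports "HOL-Analysis.Analysis" "HOL-Library.Poly_Mapping" "HOL-Library.Groups_Big_Fun"
begin

section \<open>The Lie superalgebra osp(1|2n)\<close>

text \<open>
  Throughout, n is the cardinality of the finite index type \<^typ>\<open>'n\<close>, so n is an arbitrary
  positive integer.  Parities are Booleans, \<^const>\<open>True\<close> being odd.  The defining
  representation has the even basis vector \<^term>\<open>Inl ()\<close> and the odd basis vectors
  \<^term>\<open>Inr (Inl i)\<close>, \<^term>\<open>Inr (Inr i)\<close>.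
\<close>

type_synonym 'n super_index = "unit + 'n + 'n"
type_synonym 'n gl = "complex ^ 'n super_index ^ 'n super_index"

definition super_sign :: "bool \<Rightarrow> bool \<Rightarrow> complex" where
  "super_sign s t = (if s \<and> t then -1 else 1)"

definition mat_scale :: "complex \<Rightarrow> 'n::finite gl \<Rightarrow> 'n gl" where
  "mat_scale c X = (\<chi> i j. c * X $ i $ j)"

definition gl_part :: "bool \<Rightarrow> 'n::finite gl \<Rightarrow> 'n gl" where
  "gl_part s X = (\<chi> i j. if (isl i \<noteq> isl j) = s then X $ i $ j else 0)"

definition super_bracket :: "'n::finite gl \<Rightarrow> 'n gl \<Rightarrow> 'n gl" where
  "super_bracket X Y = (\<Sum>s\<in>UNIV. \<Sum>t\<in>UNIV.
     gl_part s X ** gl_part t Y - mat_scale (super_sign s t) (gl_part t Y ** gl_part s X))"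

text \<open>Gram matrix of the even supersymmetric form on the defining representation: symmetric on
  the even line and symplectic on the odd part.\<close>

fun osp_gram :: "'n super_index \<Rightarrow> 'n super_index \<Rightarrow> complex" where
  "osp_gram (Inl _) (Inl _) = 1"
| "osp_gram (Inr (Inl i)) (Inr (Inr j)) = (if i = j then 1 else 0)"
| "osp_gram (Inr (Inr i)) (Inr (Inl j)) = (if i = j then -1 else 0)"
| "osp_gram _ _ = 0"

text \<open>Homogeneous elements X of parity s with (X u, v) + (-1)^(s|u|) (u, X v) = 0, tested on basis
  vectors u, v.\<close>

definition osp_part :: "bool \<Rightarrow> 'n::finite gl set" where
  "osp_part s = {X. gl_part s X = X \<and>
     (\<forall>i j. (\<Sum>l\<in>UNIV. X $ l $ i * osp_gram l j)
          + super_sign s (\<not> isl i) * (\<Sum>l\<in>UNIV. osp_gram i l * X $ l $ j) = 0)}"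

definition osp :: "'n::finite gl set" where
  "osp = {X. \<forall>s. gl_part s X \<in> osp_part s}"

definition cartan :: "'n::finite gl set" where
  "cartan = {H \<in> osp. \<forall>i j. i \<noteq> j \<longrightarrow> H $ i $ j = 0}"

text \<open>Elements of \<^const>\<open>cartan\<close> have the form diag(0, h, -h), so a vector
  \<^term>\<open>\<mu> :: complex ^ 'n\<close> stands for the linear functional sending it to
  the sum of all \<^term>\<open>\<mu> $ i * h $ i\<close>; this identifies the dual of the Cartan subalgebra
  with \<^typ>\<open>complex ^ 'n\<close>.\<close>

definition weight_eval :: "complex ^ 'n::finite \<Rightarrow> 'n gl \<Rightarrow> complex" where
  "weight_eval \<mu> H = (\<Sum>i\<in>UNIV. \<mu> $ i * H $ Inr (Inl i) $ Inr (Inl i))"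

definition root_space :: "complex ^ 'n::finite \<Rightarrow> 'n gl set" where
  "root_space \<alpha> = {X \<in> osp. \<forall>H\<in>cartan. super_bracket H X = mat_scale (weight_eval \<alpha> H) X}"

definition roots_of_parity :: "bool \<Rightarrow> (complex ^ 'n::finite) set" where
  "roots_of_parity s = {\<alpha>. \<alpha> \<noteq> 0 \<and> (\<exists>X \<in> root_space \<alpha> \<inter> osp_part s. X \<noteq> 0)}"

abbreviation even_roots :: "(complex ^ 'n::finite) set" where
  "even_roots \<equiv> roots_of_parity False"

definition roots :: "(complex ^ 'n::finite) set" where
  "roots = roots_of_parity False \<union> roots_of_parity True"

definition nonneg_comb :: "('n::finite \<Rightarrow> complex ^ 'n) \<Rightarrow> (complex ^ 'n) set" where
  "nonneg_comb \<alpha> = {\<Sum>i\<in>UNIV. of_nat (c i) *s \<alpha> i | c :: 'n \<Rightarrow> nat. True}"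

definition simple_system :: "('n::finite \<Rightarrow> complex ^ 'n) \<Rightarrow> bool" where
  "simple_system \<alpha> \<longleftrightarrow>
     range \<alpha> \<subseteq> roots \<and>
     (\<forall>c. (\<Sum>i\<in>UNIV. c i *s \<alpha> i) = 0 \<longrightarrow> (\<forall>i. c i = 0)) \<and>
     (\<forall>\<beta>\<in>roots. \<beta> \<in> nonneg_comb \<alpha> \<or> - \<beta> \<in> nonneg_comb \<alpha>)"


section \<open>The normalized invariant form\<close>

definition invariant_form :: "('n::finite gl \<Rightarrow> 'n gl \<Rightarrow> complex) \<Rightarrow> bool" where
  "invariant_form B \<longleftrightarrow>
     (\<forall>X\<in>osp. \<forall>Y\<in>osp. \<forall>Z\<in>osp. B (X + Y) Z = B X Z + B Y Z \<and> B X (Y + Z) = B X Y + B X Z) \<and>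
     (\<forall>c. \<forall>X\<in>osp. \<forall>Y\<in>osp. B (mat_scale c X) Y = c * B X Y \<and> B X (mat_scale c Y) = c * B X Y) \<and>
     (\<forall>s t. s \<noteq> t \<longrightarrow> (\<forall>X\<in>osp_part s. \<forall>Y\<in>osp_part t. B X Y = 0)) \<and>
     (\<forall>s t. \<forall>X\<in>osp_part s. \<forall>Y\<in>osp_part t. B X Y = super_sign s t * B Y X) \<and>
     (\<forall>X\<in>osp. \<forall>Y\<in>osp. \<forall>Z\<in>osp. B (super_bracket X Y) Z = B X (super_bracket Y Z)) \<and>
     (\<forall>X\<in>osp. (\<forall>Y\<in>osp. B X Y = 0) \<longrightarrow> X = 0)"

definition t_vec :: "('n::finite gl \<Rightarrow> 'n gl \<Rightarrow> complex) \<Rightarrow> complex ^ 'n \<Rightarrow> 'n gl" where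
  "t_vec B \<mu> = (THE T. T \<in> cartan \<and> (\<forall>H\<in>cartan. weight_eval \<mu> H = B T H))"

definition dual_form ::
  "('n::finite gl \<Rightarrow> 'n gl \<Rightarrow> complex) \<Rightarrow> complex ^ 'n \<Rightarrow> complex ^ 'n \<Rightarrow> complex" where
  "dual_form B \<mu> \<nu> = B (t_vec B \<mu>) (t_vec B \<nu>)"

text \<open>The modulus makes the notion of a long root independent of the scaling of the form.  For
  n = 1 every even root is long.\<close>

definition long_roots :: "('n::finite gl \<Rightarrow> 'n gl \<Rightarrow> complex) \<Rightarrow> (complex ^ 'n) set" where
  "long_roots B = {\<alpha> \<in> even_roots. \<forall>\<beta>\<in>even_roots. cmod (dual_form B \<beta> \<beta>) \<le> cmod (dual_form B \<alpha> \<alpha>)}"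

definition short_roots :: "('n::finite gl \<Rightarrow> 'n gl \<Rightarrow> complex) \<Rightarrow> (complex ^ 'n) set" where
  "short_roots B = even_roots - long_roots B"

definition normalized_form :: "('n::finite gl \<Rightarrow> 'n gl \<Rightarrow> complex) \<Rightarrow> bool" where
  "normalized_form B \<longleftrightarrow> invariant_form B \<and> (\<forall>\<alpha>\<in>long_roots B. dual_form B \<alpha> \<alpha> = 2)"

definition pos_long_roots ::
  "('n::finite gl \<Rightarrow> 'n gl \<Rightarrow> complex) \<Rightarrow> ('n \<Rightarrow> complex ^ 'n) \<Rightarrow> (complex ^ 'n) set" where
  "pos_long_roots B \<alpha> = long_roots B \<inter> nonneg_comb \<alpha>"

definition pos_short_roots ::
  "('n::finite gl \<Rightarrow> 'n gl \<Rightarrow> complex) \<Rightarrow> ('n \<Rightarrow> complex ^ 'n) \<Rightarrow> (complex ^ 'n) set" where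
  "pos_short_roots B \<alpha> = short_roots B \<inter> nonneg_comb \<alpha>"

abbreviation half :: "complex ^ 'n \<Rightarrow> complex ^ 'n" where
  "half \<alpha> \<equiv> (1/2) *s \<alpha>"

definition root_vectors ::
  "('n::finite gl \<Rightarrow> 'n gl \<Rightarrow> complex) \<Rightarrow> ('n \<Rightarrow> complex ^ 'n) \<Rightarrow>
   (complex ^ 'n \<Rightarrow> 'n gl) \<Rightarrow> (complex ^ 'n \<Rightarrow> 'n gl) \<Rightarrow> bool" where
  "root_vectors B \<alpha> e x \<longleftrightarrow>
     (\<forall>\<beta>\<in>pos_short_roots B \<alpha>.
        let h = mat_scale 2 (t_vec B \<beta>) in
          e \<beta> \<in> root_space \<beta> \<and> e (- \<beta>) \<in> root_space (- \<beta>) \<and>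
          super_bracket (e \<beta>) (e (- \<beta>)) = h \<and>
          super_bracket h (e \<beta>) = mat_scale 2 (e \<beta>) \<and>
          super_bracket h (e (- \<beta>)) = mat_scale (-2) (e (- \<beta>))) \<and>
     (\<forall>\<beta>\<in>pos_long_roots B \<alpha>.
        let h = t_vec B \<beta>; \<gamma> = half \<beta> in
          e \<beta> \<in> root_space \<beta> \<and> e (- \<beta>) \<in> root_space (- \<beta>) \<and>
          x \<gamma> \<in> root_space \<gamma> \<and> x (- \<gamma>) \<in> root_space (- \<gamma>) \<and>
          super_bracket (e \<beta>) (e (- \<beta>)) = h \<and>
          super_bracket h (e \<beta>) = mat_scale 2 (e \<beta>) \<and>
          super_bracket h (e (- \<beta>)) = mat_scale (-2) (e (- \<beta>)) \<and>
          super_bracket h (x \<gamma>) = x \<gamma> \<and>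
          super_bracket h (x (- \<gamma>)) = - x (- \<gamma>) \<and>
          super_bracket (e \<beta>) (x \<gamma>) = 0 \<and>
          super_bracket (e (- \<beta>)) (x \<gamma>) = - x (- \<gamma>) \<and>
          super_bracket (e \<beta>) (x (- \<gamma>)) = - x \<gamma> \<and>
          super_bracket (e (- \<beta>)) (x (- \<gamma>)) = 0 \<and>
          super_bracket (x \<gamma>) (x \<gamma>) = mat_scale 2 (e \<beta>) \<and>
          super_bracket (x \<gamma>) (x (- \<gamma>)) = h \<and>
          super_bracket (x (- \<gamma>)) (x (- \<gamma>)) = mat_scale (-2) (e (- \<beta>)))"


section \<open>The affine Lie superalgebra\<close>

text \<open>A pair \<^term>\<open>(X, z)\<close> is the Laurent polynomial with coefficients
  \<^term>\<open>Poly_Mapping.lookup X m\<close> at t^m, plus \<open>z K\<close> with K the central element.\<close>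

type_synonym 'n aff = "(int \<Rightarrow>\<^sub>0 'n gl) \<times> complex"

definition aff_alg :: "'n::finite aff set" where
  "aff_alg = {(X, z). \<forall>m. Poly_Mapping.lookup X m \<in> osp}"

definition aff_part :: "bool \<Rightarrow> 'n::finite aff set" where
  "aff_part s = {(X, z). (\<forall>m. Poly_Mapping.lookup X m \<in> osp_part s) \<and> (s \<longrightarrow> z = 0)}"

definition aff_scale :: "complex \<Rightarrow> 'n::finite aff \<Rightarrow> 'n aff" where
  "aff_scale c = (\<lambda>(X, z). (Poly_Mapping.map (mat_scale c) X, c * z))"

definition aff_bracket ::
  "('n::finite gl \<Rightarrow> 'n gl \<Rightarrow> complex) \<Rightarrow> 'n aff \<Rightarrow> 'n aff \<Rightarrow> 'n aff" where
  "aff_bracket B = (\<lambda>(X, _) (Y, _).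
     (\<Sum>m\<in>Poly_Mapping.keys X. \<Sum>p\<in>Poly_Mapping.keys Y.
        Poly_Mapping.single (m + p) (super_bracket (Poly_Mapping.lookup X m) (Poly_Mapping.lookup Y p)),
      \<Sum>m\<in>Poly_Mapping.keys X. \<Sum>p\<in>Poly_Mapping.keys Y.
        if m + p = 0 then of_int m * B (Poly_Mapping.lookup X m) (Poly_Mapping.lookup Y p) else 0))"

definition aff_nonneg :: "'n::finite aff set" where
  "aff_nonneg = {(X, z) \<in> aff_alg. \<forall>m<0. Poly_Mapping.lookup X m = 0}"

definition level_character :: "complex \<Rightarrow> 'n::finite aff \<Rightarrow> complex" where
  "level_character k = (\<lambda>(X, z). k * z)"

definition loop :: "'n::finite gl \<Rightarrow> int \<Rightarrow> 'n aff" where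
  "loop a m = (Poly_Mapping.single m a, 0)"


section \<open>Modules induced from a character\<close>

text \<open>
  Finitely supported functions on words in a Lie superalgebra L (with homogeneous parts
  \<open>P\<close>, scaling \<open>sc\<close> and bracket \<open>br\<close>) form the free associative algebra on the set L.
  The subspace below is the kernel of the map from this free algebra onto the induced module
  \<open>U(L) \<otimes>\<^bsub>U(p)\<^esub> \<complex>\<close>, where p acts on the line by \<open>chr\<close>: the first three families
  span the two-sided ideal with quotient U(L), and the last one generates the left ideal
  of U(L) generated by all \<open>y - chr y\<close> with y in p.
\<close>

definition word_scale :: "complex \<Rightarrow> ('a list \<Rightarrow>\<^sub>0 complex) \<Rightarrow> 'a list \<Rightarrow>\<^sub>0 complex" where
  "word_scale c = Poly_Mapping.map ((*) c)"

abbreviation word :: "'a list \<Rightarrow> 'a list \<Rightarrow>\<^sub>0 complex" where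
  "word w \<equiv> Poly_Mapping.single w 1"

definition induced_relations ::
  "'a::ab_group_add set \<Rightarrow> (bool \<Rightarrow> 'a set) \<Rightarrow> (complex \<Rightarrow> 'a \<Rightarrow> 'a) \<Rightarrow> ('a \<Rightarrow> 'a \<Rightarrow> 'a) \<Rightarrow>
   'a set \<Rightarrow> ('a \<Rightarrow> complex) \<Rightarrow> ('a list \<Rightarrow>\<^sub>0 complex) set" where
  "induced_relations L P sc br p chr = module.span word_scale
     ({word (u @ [y + z] @ w) - word (u @ [y] @ w) - word (u @ [z] @ w) | u w y z.
         u \<in> lists L \<and> w \<in> lists L \<and> y \<in> L \<and> z \<in> L} \<union>
      {word (u @ [sc c y] @ w) - word_scale c (word (u @ [y] @ w)) | u w c y.
         u \<in> lists L \<and> w \<in> lists L \<and> y \<in> L} \<union>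
      {word (u @ [y, z] @ w) - word_scale (super_sign s t) (word (u @ [z, y] @ w))
         - word (u @ [br y z] @ w) | u w s t y z.
         u \<in> lists L \<and> w \<in> lists L \<and> y \<in> P s \<and> z \<in> P t} \<union>
      {word (u @ [y]) - word_scale (chr y) (word u) | u y. u \<in> lists L \<and> y \<in> p})"

text \<open>The vector space \<^typ>\<open>'v\<close> with the action \<^term>\<open>\<rho>\<close> of L and the vector \<open>vac\<close> is (a copy
  of) the module induced from the one-dimensional p-module with character \<open>chr\<close>, with
  \<open>vac\<close> corresponding to \<open>1 \<otimes> 1\<close>.\<close>

locale induced_module = vector_space smul
  for L :: "'a::ab_group_add set" and P :: "bool \<Rightarrow> 'a set" and sc :: "complex \<Rightarrow> 'a \<Rightarrow> 'a"
    and br :: "'a \<Rightarrow> 'a \<Rightarrow> 'a" and p :: "'a set" and chr :: "'a \<Rightarrow> complex"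
    and smul :: "complex \<Rightarrow> 'v::ab_group_add \<Rightarrow> 'v"
    and \<rho> :: "'a \<Rightarrow> 'v \<Rightarrow> 'v" and vac :: 'v +
  assumes act_linear: "y \<in> L \<Longrightarrow> Vector_Spaces.linear smul smul (\<rho> y)"
    and act_add: "y \<in> L \<Longrightarrow> z \<in> L \<Longrightarrow> \<rho> (y + z) v = \<rho> y v + \<rho> z v"
    and act_scale: "y \<in> L \<Longrightarrow> \<rho> (sc c y) v = smul c (\<rho> y v)"
    and act_bracket: "y \<in> P s \<Longrightarrow> z \<in> P t \<Longrightarrow>
      \<rho> (br y z) v = \<rho> y (\<rho> z v) - smul (super_sign s t) (\<rho> z (\<rho> y v))"
    and act_vac: "y \<in> p \<Longrightarrow> \<rho> y vac = smul (chr y) vac"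
    and cyclic: "span {foldr \<rho> w vac | w. w \<in> lists L} = UNIV"
    and free: "Poly_Mapping.keys f \<subseteq> lists L \<Longrightarrow>
      (\<Sum>w\<in>Poly_Mapping.keys f. smul (Poly_Mapping.lookup f w) (foldr \<rho> w vac)) = 0 \<Longrightarrow>
      f \<in> induced_relations L P sc br p chr"

definition universal_affine_module ::
  "('n::finite gl \<Rightarrow> 'n gl \<Rightarrow> complex) \<Rightarrow> complex \<Rightarrow> (complex \<Rightarrow> 'v::ab_group_add \<Rightarrow> 'v) \<Rightarrow>
   ('n aff \<Rightarrow> 'v \<Rightarrow> 'v) \<Rightarrow> 'v \<Rightarrow> bool" where
  "universal_affine_module B k smul \<rho> vac \<longleftrightarrow>
     induced_module aff_alg aff_part aff_scale (aff_bracket B)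
       aff_nonneg (level_character k) smul \<rho> vac"


section \<open>Vertex operator superalgebras\<close>

text \<open>\<^term>\<open>Y u m v\<close> is the product u_m v, i.e. the coefficient of z^(-m-1) in Y(u,z)v.  The axiom
  \<open>borcherds\<close> is the component form of the Jacobi identity; by \<open>truncation\<close> all its
  sums have finite support.\<close>

locale vertex_superalgebra = vector_space smul
  for smul :: "complex \<Rightarrow> 'v::ab_group_add \<Rightarrow> 'v"
    and V :: "bool \<Rightarrow> 'v set" and Y :: "'v \<Rightarrow> int \<Rightarrow> 'v \<Rightarrow> 'v" and vac :: 'v +
  assumes subspace_part: "subspace (V s)"
    and parts_disjoint: "V False \<inter> V True = {0}"
    and parts_span: "\<exists>a\<in>V False. \<exists>b\<in>V True. v = a + b"
    and linear_left: "Vector_Spaces.linear smul smul (\<lambda>u. Y u m v)"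
    and linear_right: "Vector_Spaces.linear smul smul (Y u m)"
    and parity: "u \<in> V s \<Longrightarrow> v \<in> V t \<Longrightarrow> Y u m v \<in> V (s \<noteq> t)"
    and truncation: "\<exists>N. \<forall>m\<ge>N. Y u m v = 0"
    and vac_even: "vac \<in> V False"
    and vac_left: "Y vac m v = (if m = -1 then v else 0)"
    and creation: "m \<ge> 0 \<Longrightarrow> Y u m vac = 0" "Y u (-1) vac = u"
    and borcherds: "u \<in> V s \<Longrightarrow> v \<in> V t \<Longrightarrow>
      Sum_any (\<lambda>i::nat. smul (of_int p gchoose i) (Y (Y u (r + int i) v) (p + q - int i) w)) =
      Sum_any (\<lambda>i::nat. smul ((-1) ^ i * (of_int r gchoose i))
        (Y u (p + r - int i) (Y v (q + int i) w)
         - smul (super_sign s t * (-1) powi r) (Y v (q + r - int i) (Y u (p + int i) w))))"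
begin

definition vertex_subalgebra :: "'v set \<Rightarrow> bool" where
  "vertex_subalgebra U \<longleftrightarrow>
     subspace U \<and> vac \<in> U \<and> (\<forall>u\<in>U. \<forall>v\<in>U. \<forall>m. Y u m v \<in> U)"

definition generated_subalgebra :: "'v set \<Rightarrow> 'v set" where
  "generated_subalgebra S = \<Inter>{U. vertex_subalgebra U \<and> S \<subseteq> U}"

end

locale vertex_operator_superalgebra = vertex_superalgebra smul V Y vac
  for smul :: "complex \<Rightarrow> 'v::ab_group_add \<Rightarrow> 'v"
    and V :: "bool \<Rightarrow> 'v set" and Y :: "'v \<Rightarrow> int \<Rightarrow> 'v \<Rightarrow> 'v" and vac :: 'v +
  fixes \<omega> :: 'v
  assumes omega_even: "\<omega> \<in> V False"
    and virasoro: "\<exists>c. \<forall>m p v. Y \<omega> (m + 1) (Y \<omega> (p + 1) v) - Y \<omega> (p + 1) (Y \<omega> (m + 1) v) =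
      smul (of_int (m - p)) (Y \<omega> (m + p + 1) v)
      + smul (if m + p = 0 then of_int (m ^ 3 - m) / 12 * c else 0) v"
    and derivative: "Y (Y \<omega> 0 u) m v = smul (- of_int m) (Y u (m - 1) v)"
    and grading_span: "span (\<Union>d::int. {v. Y \<omega> 1 v = smul (of_int d / 2) v}) = UNIV"
    and grading_finite: "\<exists>S. finite S \<and> {v. Y \<omega> 1 v = smul (of_int d / 2) v} \<subseteq> span S"
    and grading_bounded: "\<exists>D::int. \<forall>d<D. {v. Y \<omega> 1 v = smul (of_int d / 2) v} = {0}"


section \<open>The universal affine vertex operator superalgebra\<close>

text \<open>The Sugawara vector, with dual Coxeter number n + 1/2; it does not depend on the choice of
  the basis S of osp(1|2n) and the dual basis d.\<close>

definition sugawara_vector ::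
  "('n::finite gl \<Rightarrow> 'n gl \<Rightarrow> complex) \<Rightarrow> complex \<Rightarrow> (complex \<Rightarrow> 'v::ab_group_add \<Rightarrow> 'v) \<Rightarrow>
   ('n aff \<Rightarrow> 'v \<Rightarrow> 'v) \<Rightarrow> 'v \<Rightarrow> 'v \<Rightarrow> bool" where
  "sugawara_vector B k smul \<rho> vac \<omega> \<longleftrightarrow>
     (\<exists>S d. finite S \<and> \<not> module.dependent mat_scale S \<and> module.span mat_scale S = osp \<and>
        d ` S \<subseteq> osp \<and> (\<forall>a\<in>S. \<forall>b\<in>S. B a (d b) = (if a = b then 1 else 0)) \<and>
        \<omega> = smul (1 / (2 * (k + of_nat CARD('n) + 1/2)))
              (\<Sum>a\<in>S. \<rho> (loop (d a) (-1)) (\<rho> (loop a (-1)) vac)))"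

text \<open>The vertex operator superalgebra structure on the induced module, pinned down by the fields of
  the vectors a(-1)1.\<close>

definition universal_affine_vosa ::
  "('n::finite gl \<Rightarrow> 'n gl \<Rightarrow> complex) \<Rightarrow> complex \<Rightarrow> (complex \<Rightarrow> 'v::ab_group_add \<Rightarrow> 'v) \<Rightarrow>
   ('n aff \<Rightarrow> 'v \<Rightarrow> 'v) \<Rightarrow> (bool \<Rightarrow> 'v set) \<Rightarrow> ('v \<Rightarrow> int \<Rightarrow> 'v \<Rightarrow> 'v) \<Rightarrow> 'v \<Rightarrow> 'v \<Rightarrow> bool" where
  "universal_affine_vosa B k smul \<rho> V Y vac \<omega> \<longleftrightarrow>
     universal_affine_module B k smul \<rho> vac \<and>
     vertex_operator_superalgebra smul V Y vac \<omega> \<and>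
     (\<forall>s. \<forall>a\<in>osp_part s. \<rho> (loop a (-1)) vac \<in> V s) \<and>
     (\<forall>a\<in>osp. \<forall>m. Y (\<rho> (loop a (-1)) vac) m = \<rho> (loop a m)) \<and>
     sugawara_vector B k smul \<rho> vac \<omega>"

definition weight_zero_space :: "('n::finite aff \<Rightarrow> 'v::ab_group_add \<Rightarrow> 'v) \<Rightarrow> 'v set" where
  "weight_zero_space \<rho> = {v. \<forall>H\<in>cartan. \<rho> (loop H 0) v = 0}"

end

(*
  Let U be a vertex subalgebra containing the given vectors.  The argument works with the modes
  a(m) of elements of g and never needs a PBW basis, because V is spanned by words in the modes of
  root vectors applied to 1, and a vector of weight zero is a combination of words of weight zero.

  Opposite root vectors x, y: acting on x(-a)y(-b)1 with translations and with modes of y(-2)x(-1)1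
  shows, by induction on a + b and modulo U, that all these vectors are multiples of a single one,
  and that one is in U because a coefficient depending on the level is nonzero.  The fields of all
  y(-q)x(-1)1 then contain enough polynomial weights to show that each product x(i)y(j) preserves U.
  For odd x, y this uses the even root vectors [x,x], [y,y], which are treated first.

  A word of weight zero and length s is handled by induction on s.  If its first letter has root
  beta and it contains a letter of root gamma with beta + gamma a root, move that letter to the
  second place, and write it as a bracket of a root vector f of root -beta with one of root
  beta + gamma.  Splitting the mode number so that f(l) has l very large, f(l) kills everything to
  its right, and the word becomes a pair of opposite root vectors followed by a word of length s - 1.
*)
theory Submission
  imports Defs
begin

section \<open>Opposite pairs of currents in a vertex superalgebra\<close>

text \<open>The level enters through one coefficient. Mode 1 of y(-2)x(-1)1 raises the total mode
  number by one. Applied to x(-a)y(-1)1, which is already in U, it lands where translation leaves a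
  single unknown vector modulo U, and it gives C times that vector. For an sl(2) pair with constant
  \<kappa>, C = -(a + 2)(a \<kappa> + a + 1), which is nonzero for positive \<kappa>. For an
  osp(1|2) pair the brackets [x,x] and [y,y] add terms of both signs and a factor (-1)^a. There a
  level of at least 1 makes the level terms dominate. One computation serves both cases, because
  sl(2) is its specialization \<tau> = 0.

  In the induction on words the obstacle is that a letter and the letter cancelling part of its root
  are in general not opposite. Closure under opposite pairs then does not apply to them directly,
  and neither piece of the word has weight zero. Trading the roots \<beta>, \<gamma> for \<beta>,
  -\<beta> and \<beta> + \<gamma> separates off an opposite pair and leaves a shorter word of weight
  zero.\<close>

lemma gbinomial_zero_nonzeroD: "(0::'a::field_char_0) gchoose i \<noteq> 0 \<Longrightarrow> i = 0"
  by (cases i) auto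

context vertex_superalgebra
begin

section \<open>Linearity, commutator, iterate and translation formulas\<close>

lemma Y_add_left: "Y (u + u') m w = Y u m w + Y u' m w"
  using linear_left[of m w] by (simp add: Vector_Spaces.linear_iff)

lemma Y_smul_left: "Y (smul c u) m w = smul c (Y u m w)"
  using linear_left[of m w] by (simp add: Vector_Spaces.linear_iff)

lemma Y_add_right: "Y u m (w + w') = Y u m w + Y u m w'"
  using linear_right[of u m] by (simp add: Vector_Spaces.linear_iff)

lemma Y_smul_right: "Y u m (smul c w) = smul c (Y u m w)"
  using linear_right[of u m] by (simp add: Vector_Spaces.linear_iff)

lemma Y_zero_right [simp]: "Y u m 0 = 0"
  using Y_smul_right[of u m 0 0] by simp

lemma Y_zero_left [simp]: "Y 0 m w = 0"
  using Y_smul_left[of 0 0 m w] by simp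

lemma Y_minus_right: "Y u m (- w) = - Y u m w"
  by (metis Y_add_right Y_zero_right add.inverse_unique add.right_inverse)

lemma Y_diff_right: "Y u m (w - w') = Y u m w - Y u m w'"
  by (metis Y_add_right add_diff_cancel diff_add_cancel)

text \<open>The case \<open>r = 0\<close> of the Borcherds identity: \<open>0 gchoose i\<close>
  reduces its right side to the supercommutator.\<close>

lemma Y_comm:
  assumes "u \<in> V s" "v \<in> V t"
  shows "Y u p (Y v q w) - smul (super_sign s t) (Y v q (Y u p w))
    = Sum_any (\<lambda>i::nat. smul (of_int p gchoose i) (Y (Y u (int i) v) (p + q - int i) w))"
proof -
  have *: "Sum_any (\<lambda>i::nat. smul ((-1) ^ i * (of_int 0 gchoose i))
        (Y u (p + 0 - i) (Y v (q + int i) w)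
         - smul (super_sign s t * (-1) powi 0) (Y v (q + 0 - i) (Y u (p + int i) w))))
    = (\<Sum>i\<in>{0}. smul ((-1) ^ i * (of_int 0 gchoose i))
        (Y u (p + 0 - i) (Y v (q + int i) w)
         - smul (super_sign s t * (-1) powi 0) (Y v (q + 0 - i) (Y u (p + int i) w))))"
    by (rule Sum_any.expand_superset) (auto dest: gbinomial_zero_nonzeroD)
  show ?thesis
    using borcherds[OF assms, of p 0 q w] unfolding * by simp
qed

text \<open>The case \<open>p = 0\<close> of the Borcherds identity, which leaves one term on its
  left side.\<close>

lemma Y_iterate:
  assumes "u \<in> V s" "v \<in> V t"
  shows "Y (Y u r v) q w = Sum_any (\<lambda>i::nat. smul ((-1) ^ i * (of_int r gchoose i))
        (Y u (r - int i) (Y v (q + int i) w)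
         - smul (super_sign s t * (-1) powi r) (Y v (q + r - int i) (Y u (int i) w))))"
proof -
  have *: "Sum_any (\<lambda>i::nat. smul (of_int 0 gchoose i) (Y (Y u (r + int i) v) (0 + q - int i) w))
    = (\<Sum>i\<in>{0}. smul (of_int 0 gchoose i) (Y (Y u (r + int i) v) (0 + q - int i) w))"
    by (rule Sum_any.expand_superset) (auto dest: gbinomial_zero_nonzeroD)
  show ?thesis
    using borcherds[OF assms, of 0 r q w] unfolding * by simp
qed

text \<open>\<open>Y v (-2) vac\<close> is the translation T v, so this is the rule T(u_m v) = u_m
  (T v) - m u_(m-1) v. In the iterate formula the creation axiom kills all terms but
  \<open>i = 0\<close> and \<open>i = 1\<close>.\<close>

lemma Y_translate:
  assumes "u \<in> V s" "v \<in> V t"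
  shows "Y (Y u m v) (-2) vac = Y u m (Y v (-2) vac) - smul (of_int m) (Y u (m - 1) v)"
proof -
  have "Y (Y u m v) (-2) vac = (\<Sum>i\<in>{0,1}. smul ((-1) ^ i * (of_int m gchoose i))
        (Y u (m - int i) (Y v (-2 + int i) vac)
         - smul (super_sign s t * (-1) powi m) (Y v (-2 + m - int i) (Y u (int i) vac))))"
    unfolding Y_iterate[OF assms]
  proof (rule Sum_any.expand_superset)
    show "{i::nat. smul ((-1) ^ i * (of_int m gchoose i))
        (Y u (m - int i) (Y v (-2 + int i) vac)
         - smul (super_sign s t * (-1) powi m) (Y v (-2 + m - int i) (Y u (int i) vac))) \<noteq> 0} \<subseteq> {0,1}"
    proof
      fix i assume a: "i \<in> {i::nat. smul ((-1) ^ i * (of_int m gchoose i))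
        (Y u (m - int i) (Y v (-2 + int i) vac)
         - smul (super_sign s t * (-1) powi m) (Y v (-2 + m - int i) (Y u (int i) vac))) \<noteq> 0}"
      have "\<not> i \<ge> 2"
      proof
        assume "i \<ge> 2"
        then have "Y v (-2 + int i) vac = 0" by (intro creation) simp
        then show False using a by (simp add: creation)
      qed
      then show "i \<in> {0,1}" by auto
    qed
  qed simp
  then show ?thesis
    by (simp add: creation)
qed

lemma Y_vac_translate:
  assumes "u \<in> V s"
  shows "Y (Y u m vac) (-2) vac = - smul (of_int m) (Y u (m - 1) vac)"
  using Y_translate[OF assms vac_even, of m] by (simp add: vac_left)

end

text \<open>The vectors e and f are the brackets \<open>[x,x]\<close> and \<open>[y,y]\<close>; they vanish in the even case, where
  \<open>\<tau> = 0\<close>.  The constant \<open>\<kappa>\<close> is the level times the form of x and y.  The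
  expression in \<open>nondeg\<close> is the coefficient C of \<open>v0_in\<close>.\<close>

locale current_pair = vertex_superalgebra smul V Y vac
  for smul :: "complex \<Rightarrow> 'v::ab_group_add \<Rightarrow> 'v"
    and V :: "bool \<Rightarrow> 'v set" and Y :: "'v \<Rightarrow> int \<Rightarrow> 'v \<Rightarrow> 'v" and vac :: 'v +
  fixes U :: "'v set" and s :: bool and x y h e f :: 'v and \<kappa> \<mu> \<tau> \<sigma> :: complex
  assumes subalg: "vertex_subalgebra U"
    and sign: "\<sigma> = super_sign s s"
    and x_part: "x \<in> V s" and y_part: "y \<in> V s"
    and h_in: "h \<in> U"
    and xy: "Y x m (Y y p w) = smul \<sigma> (Y y p (Y x m w)) + Y h (m + p) w
               + (if m + p = 0 then smul (of_int m * \<kappa>) w else 0)"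
    and hx: "Y h m (Y x p w) = Y x p (Y h m w) + smul \<mu> (Y x (m + p) w)"
    and hy: "Y h m (Y y p w) = Y y p (Y h m w) - smul \<mu> (Y y (m + p) w)"
    and xx: "Y x m (Y x p w) = smul \<sigma> (Y x p (Y x m w)) + Y e (m + p) w"
    and yy: "Y y m (Y y p w) = smul \<sigma> (Y y p (Y y m w)) + Y f (m + p) w"
    and ex: "Y e m (Y x p w) = Y x p (Y e m w)"
    and fy: "Y f m (Y y p w) = Y y p (Y f m w)"
    and ey: "Y e m (Y y p w) = Y y p (Y e m w) - smul \<tau> (Y x (m + p) w)"
    and fx: "Y f m (Y x p w) = Y x p (Y f m w) + smul \<tau> (Y y (m + p) w)"
    and ef_in: "w \<in> U \<Longrightarrow> Y e m (Y f p w) \<in> U"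
    and fe_in: "w \<in> U \<Longrightarrow> Y f m (Y e p w) \<in> U"
    and \<tau>_zero: "\<tau> = 0 \<Longrightarrow> e = 0 \<and> f = 0"
    and \<mu>_nonzero: "\<mu> \<noteq> 0"
    and gen_in: "Y y (-2) x \<in> U"
    and nondeg: "a \<ge> 1 \<Longrightarrow> \<tau> * (of_nat a * (of_nat a - 1) / 2) - \<tau> * \<sigma> * of_nat a * (-1) ^ a
        - \<mu> * (of_nat a * (of_nat a + 1) / 2) - (of_nat a + 1) * (\<mu> + of_nat a * \<kappa>)
        - of_nat a * \<kappa> + \<tau> * ((-1) ^ a - \<sigma> * of_nat a) \<noteq> 0"
begin

lemma U_subspace: "subspace U" and U_vac: "vac \<in> U"
  and U_Y: "u \<in> U \<Longrightarrow> v \<in> U \<Longrightarrow> Y u m v \<in> U"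
  using subalg by (auto simp: vertex_subalgebra_def)

lemmas U_add = subspace_add[OF U_subspace]
  and U_diff = subspace_diff[OF U_subspace]
  and U_smul = subspace_scale[OF U_subspace]
  and U_neg = subspace_neg[OF U_subspace]
  and U_zero = subspace_0[OF U_subspace]
  and U_sum = subspace_sum[OF U_subspace]

lemma U_h: "w \<in> U \<Longrightarrow> Y h m w \<in> U"
  using U_Y h_in by blast

lemma sign_square [simp]: "\<sigma> * \<sigma> = 1"
  by (auto simp: sign super_sign_def)

lemma U_smul_cancel: "c \<noteq> 0 \<Longrightarrow> smul c w \<in> U \<Longrightarrow> w \<in> U"
  using U_smul[of "smul c w" "inverse c"] by simp

lemma y_swap: "smul \<sigma> (Y y p (Y x m w)) = Y x m (Y y p w) - Y h (m + p) w
               - (if m + p = 0 then smul (of_int m * \<kappa>) w else 0)"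
  using xy[of m p w] by (simp add: algebra_simps)

text \<open>Both mode numbers are negative, so the scalar term is absent and the commutator is a
  mode of \<open>h\<close> on the vacuum.\<close>

lemma yx_cong:
  assumes "a \<ge> 1" "b \<ge> 1"
  shows "Y y (-b) (Y x (-a) vac) - smul \<sigma> (Y x (-a) (Y y (-b) vac)) \<in> U"
proof -
  have "Y y (-b) (Y x (-a) vac) - smul \<sigma> (Y x (-a) (Y y (-b) vac)) = - smul \<sigma> (Y h (-a-b) vac)"
    using assms by (simp add: xy scale_right_distrib)
  also have "\<dots> \<in> U"
    by (intro U_neg U_smul U_h U_vac)
  finally show ?thesis .
qed

section \<open>Calculation modulo U\<close>

definition mod_eq :: "'v \<Rightarrow> 'v \<Rightarrow> bool" (infix "\<doteq>" 50) where
  "u \<doteq> v \<longleftrightarrow> u - v \<in> U"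

lemma mod_refl: "u \<doteq> u"
  using U_zero by (simp add: mod_eq_def)

lemma mod_trans [trans]: "u \<doteq> v \<Longrightarrow> v \<doteq> w \<Longrightarrow> u \<doteq> w"
  unfolding mod_eq_def using U_add[of "u - v" "v - w"] by simp

lemma mod_add: "u \<doteq> u' \<Longrightarrow> v \<doteq> v' \<Longrightarrow> u + v \<doteq> u' + v'"
  unfolding mod_eq_def using U_add[of "u - u'" "v - v'"] by (simp add: algebra_simps)

lemma mod_diff: "u \<doteq> u' \<Longrightarrow> v \<doteq> v' \<Longrightarrow> u - v \<doteq> u' - v'"
  unfolding mod_eq_def using U_diff[of "u - u'" "v - v'"] by (simp add: algebra_simps)

lemma mod_smul: "u \<doteq> v \<Longrightarrow> smul c u \<doteq> smul c v"
  unfolding mod_eq_def using U_smul[of "u - v" c] by (simp add: scale_right_diff_distrib)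

lemma mod_sum: "(\<And>i. i \<in> A \<Longrightarrow> g i \<doteq> g' i) \<Longrightarrow> sum g A \<doteq> sum g' A"
  unfolding mod_eq_def sum_subtractf[symmetric] by (rule U_sum)

text \<open>The sum \<open>a + b\<close> is the conformal weight of x(-a)y(-b)1, so this is the
  induction hypothesis up to weight \<open>N\<close>.\<close>

definition pairs_upto :: "int \<Rightarrow> bool" where
  "pairs_upto N \<longleftrightarrow> (\<forall>a b. 1 \<le> a \<longrightarrow> 1 \<le> b \<longrightarrow> a + b \<le> N \<longrightarrow> Y x (-a) (Y y (-b) vac) \<in> U)"

lemma pairs_uptoD:
  "pairs_upto N \<Longrightarrow> 1 \<le> a \<Longrightarrow> 1 \<le> b \<Longrightarrow> a + b \<le> N \<Longrightarrow> Y x (-a) (Y y (-b) vac) \<in> U"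
  by (auto simp: pairs_upto_def)

lemma pairs_uptoD':
  assumes "pairs_upto N" "1 \<le> a" "1 \<le> b" "a + b \<le> N"
  shows "Y y (-b) (Y x (-a) vac) \<in> U"
  using U_add[OF yx_cong[of a b] U_smul[OF pairs_uptoD[OF assms], of \<sigma>]] assms by simp

text \<open>The generator has total mode number 3. Since h(1) kills x(-1)1, it acts on the generator
  only through y(-2) and gives a nonzero multiple of y(-1)x(-1)1.\<close>

lemma pairs_upto_2: "pairs_upto 2"
proof -
  have "Y h 1 (Y y (-2) (Y x (-1) vac)) = - smul \<mu> (Y y (-1) (Y x (-1) vac))"
    using hx[of 1 "-1" vac] by (simp add: hy creation)
  moreover have "Y h 1 (Y y (-2) (Y x (-1) vac)) \<in> U"
    using gen_in by (simp add: U_h creation)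
  ultimately have "smul (-\<mu>) (Y y (-1) (Y x (-1) vac)) \<in> U"
    by simp
  then have 1: "Y y (-1) (Y x (-1) vac) \<in> U"
    using U_smul_cancel \<mu>_nonzero by (metis neg_equal_0_iff_equal)
  have "Y x (-1) (Y y (-1) vac) = smul \<sigma> (Y y (-1) (Y x (-1) vac)) + Y h (-2) vac"
    by (simp add: xy)
  also have "\<dots> \<in> U"
    by (intro U_add U_smul 1 U_h U_vac)
  finally have 2: "Y x (-1) (Y y (-1) vac) \<in> U" .
  show ?thesis
    unfolding pairs_upto_def
  proof (intro allI impI)
    fix a b :: int assume "1 \<le> a" "1 \<le> b" "a + b \<le> 2"
    then have "a = 1" "b = 1" by auto
    then show "Y x (-a) (Y y (-b) vac) \<in> U" using 2 by simp
  qed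
qed

section \<open>From total mode number a + 1 to a + 2\<close>

context
  fixes a :: nat
  assumes a_pos: "a \<ge> 1" and upto: "pairs_upto (int a + 1)"
begin

abbreviation top_pair :: "nat \<Rightarrow> 'v" where
  "top_pair r \<equiv> Y x (- (int a + 1 - int r)) (Y y (- (1 + int r)) vac)"

text \<open>Translating x(-(a-r))y(-(1+r))1, which has total mode number \<open>a + 1\<close>,
  raises each of its two modes in turn. This relates neighbouring vectors of total mode number
  \<open>a + 2\<close>.\<close>

lemma top_pair_step:
  assumes "r < a"
  shows "smul (of_nat (a - r)) (top_pair r) + smul (of_nat (r + 1)) (top_pair (r + 1)) \<in> U"
proof -
  define v where "v = Y y (- (1 + int r)) vac"
  have v: "v \<in> V s"
    using parity[OF y_part vac_even, of "- (1 + int r)"] by (simp add: v_def)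
  have "Y x (- (int a - int r)) v \<in> U"
    unfolding v_def by (rule pairs_uptoD[OF upto]) (use assms in auto)
  then have "Y (Y x (- (int a - int r)) v) (-2) vac \<in> U"
    using U_Y U_vac by blast
  also have "Y (Y x (- (int a - int r)) v) (-2) vac
     = smul (of_nat (a - r)) (top_pair r) + smul (of_nat (r + 1)) (top_pair (r + 1))"
  proof -
    have "Y v (-2) vac = smul (of_nat (r + 1)) (Y y (- (2 + int r)) vac)"
      unfolding v_def Y_vac_translate[OF y_part]
      by (simp add: scale_minus_left[symmetric] algebra_simps)
    then show ?thesis
      unfolding Y_translate[OF x_part v] using assms
      by (simp add: v_def Y_smul_right Y_add_right scale_minus_left[symmetric] of_nat_diff algebra_simps
           del: scale_minus_left)
  qed
  finally show ?thesis .
qed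

text \<open>The two-term recursion of \<open>top_pair_step\<close> is satisfied by signed binomial
  coefficients. Hence the vectors of total mode number \<open>a + 2\<close> span at most a line
  modulo U.\<close>

lemma top_pair_cong:
  "r \<le> a \<Longrightarrow> top_pair r - smul ((-1) ^ r * of_nat (a choose r)) (top_pair 0) \<in> U"
proof (induction r)
  case 0
  then show ?case using U_zero by simp
next
  case (Suc r)
  define c :: complex where "c = (-1) ^ r * of_nat (a choose r)"
  define d :: complex where "d = (-1) ^ Suc r * of_nat (a choose Suc r)"
  \<comment> \<open>The absorption identity (r+1) C(a,r+1) = (a-r) C(a,r) with alternating
    signs.\<close>
  have cd: "of_nat (Suc r) * d = - (of_nat (a - r) * c)"
  proof -
    have "Suc r * (a choose Suc r) = (a - r) * (a choose r)"
      using binomial_absorb_comp[of a r] Suc_times_binomial_eq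
      by (metis Suc_times_binomial_add binomial_absorption le_add_diff_inverse Suc.prems Suc_leD
          mult.commute times_binomial_minus1_eq diff_Suc_1 zero_less_Suc)
    then have "(of_nat (Suc r) :: complex) * of_nat (a choose Suc r)
        = of_nat (a - r) * of_nat (a choose r)"
      by (metis of_nat_mult)
    moreover have "of_nat (Suc r) * d
        = - ((-1) ^ r * (of_nat (Suc r) * of_nat (a choose Suc r)))"
      by (simp add: d_def algebra_simps)
    ultimately show ?thesis by (simp add: c_def)
  qed
  have 1: "smul (of_nat (a - r)) (top_pair r) + smul (of_nat (r + 1)) (top_pair (r + 1)) \<in> U"
    using Suc.prems by (intro top_pair_step) simp
  have 2: "smul (of_nat (a - r)) (top_pair r - smul c (top_pair 0)) \<in> U"
    using Suc by (intro U_smul) (auto simp: c_def)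
  have "smul (of_nat (Suc r)) (top_pair (Suc r) - smul d (top_pair 0))
     = smul (of_nat (a - r)) (top_pair r) + smul (of_nat (r + 1)) (top_pair (r + 1))
       - smul (of_nat (a - r)) (top_pair r - smul c (top_pair 0))"
    unfolding scale_right_diff_distrib scale_scale cd by simp
  also have "\<dots> \<in> U" by (rule U_diff[OF 1 2])
  finally show ?case
    unfolding d_def using U_smul_cancel[of "of_nat (Suc r)"] by (metis of_nat_neq_0)
qed


abbreviation "v0 \<equiv> Y x (-1 - int a) (Y y (-1) vac)"

text \<open>The test vector: its total mode number \<open>a + 1\<close> puts it in U, and mode 1 of
  the generator takes it to the weight of \<open>v0\<close>.\<close>

abbreviation "w0 \<equiv> Y x (- int a) (Y y (-1) vac)"

lemma cong_v1: "Y y (-2) (Y x (- int a) vac) \<doteq> smul (- \<sigma> * of_nat a) v0"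
proof -
  have "Y x (- int a) (Y y (-2) vac) \<doteq> smul (- of_nat a) v0"
    using top_pair_cong[of 1] a_pos unfolding mod_eq_def by (simp add: algebra_simps)
  then have "smul \<sigma> (Y x (- int a) (Y y (-2) vac)) \<doteq> smul \<sigma> (smul (- of_nat a) v0)"
    by (rule mod_smul)
  moreover have "Y y (-2) (Y x (- int a) vac) \<doteq> smul \<sigma> (Y x (- int a) (Y y (-2) vac))"
    using yx_cong[of "int a" 2] a_pos unfolding mod_eq_def by simp
  ultimately show ?thesis using mod_trans by fastforce
qed

lemma cong_va: "Y x (-1) (Y y (-1 - int a) vac) \<doteq> smul ((-1) ^ a) v0"
  using top_pair_cong[of a] unfolding mod_eq_def by (simp add: algebra_simps)

lemma cong_va': "Y y (-1 - int a) (Y x (-1) vac) \<doteq> smul (\<sigma> * (-1) ^ a) v0"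
proof -
  have "Y y (-1 - int a) (Y x (-1) vac) \<doteq> smul \<sigma> (Y x (-1) (Y y (-1 - int a) vac))"
    using yx_cong[of 1 "int a + 1"] unfolding mod_eq_def by (simp add: algebra_simps)
  moreover have "smul \<sigma> (Y x (-1) (Y y (-1 - int a) vac)) \<doteq> smul \<sigma> (smul ((-1) ^ a) v0)"
    by (rule mod_smul[OF cong_va])
  ultimately show ?thesis using mod_trans by fastforce
qed

text \<open>In the odd case the brackets \<open>[x,x]\<close> and \<open>[y,y]\<close> produce vectors with three modes.  They are
  obtained from the action of products of modes of e and f, which preserve U, on shorter vectors.\<close>

lemma fxx_in: "Y f (-1) (Y x (-1) (Y x (- int a) vac)) \<in> U"
proof (cases "\<tau> = 0")
  case True
  then show ?thesis using \<tau>_zero U_zero by simp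
next
  case False
  have "Y e 0 (Y x (- int a) vac) = 0"
    by (simp add: ex creation)
  then have "Y e 0 (Y y (-1) (Y x (- int a) vac)) = - smul \<tau> (Y x (-1) (Y x (- int a) vac))"
    by (simp add: ey)
  moreover have "Y f (-1) (Y e 0 (Y y (-1) (Y x (- int a) vac))) \<in> U"
    by (intro fe_in pairs_uptoD'[OF upto]) (use a_pos in auto)
  ultimately have "smul (-\<tau>) (Y f (-1) (Y x (-1) (Y x (- int a) vac))) \<in> U"
    by (simp add: Y_minus_right Y_smul_right)
  then show ?thesis using U_smul_cancel False by (metis neg_equal_0_iff_equal)
qed

lemma eyy_in:
  assumes "1 \<le> j" "j < int a"
  shows "Y e c (Y y (-1-j) (Y y (-1) vac)) \<in> U"
proof (cases "\<tau> = 0")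
  case True
  then show ?thesis using \<tau>_zero U_zero by simp
next
  case False
  have "Y f 0 (Y y (-1) vac) = 0"
    by (simp only: fy) (simp add: creation)
  then have "Y f 0 (Y x (-1-j) (Y y (-1) vac)) = smul \<tau> (Y y (-1-j) (Y y (-1) vac))"
    by (simp add: fx)
  moreover have "Y e c (Y f 0 (Y x (- (1+j)) (Y y (-1) vac))) \<in> U"
    by (intro ef_in pairs_uptoD[OF upto]) (use assms in auto)
  ultimately have "smul \<tau> (Y e c (Y y (-1-j) (Y y (-1) vac))) \<in> U"
    by (simp add: Y_smul_right)
  then show ?thesis using U_smul_cancel False by metis
qed

text \<open>Moving the mode of \<open>h\<close> to the front merges it with the mode of
  \<open>x\<close> into x(-1-a), which accounts for the multiple of \<open>v0\<close>. What is left
  is a mode of \<open>h\<close> on a pair of total mode number i + 2, at most a + 1.\<close>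

lemma xhy_cong:
  assumes "0 \<le> i" "i < int a"
  shows "Y x (-1-i) (Y h (i - int a) (Y y (-1) vac)) \<doteq> smul (-\<mu>) v0"
proof -
  have "Y x (-1-i) (Y h (i - int a) (Y y (-1) vac)) - smul (-\<mu>) v0
      = Y h (i - int a) (Y x (- (1+i)) (Y y (-1) vac))"
    by (simp add: hx algebra_simps)
  also have "\<dots> \<in> U"
    by (intro U_h pairs_uptoD[OF upto]) (use assms in auto)
  finally show ?thesis unfolding mod_eq_def .
qed

text \<open>Moving f(-1) to the front gives the vector of \<open>fxx_in\<close>; the two commutators
  turn one \<open>x\<close> into \<open>y\<close> and leave pairs that are known multiples of
  \<open>v0\<close>.\<close>

lemma xxf_cong: "Y x (-1) (Y x (- int a) (Y f (-1) vac))
    \<doteq> smul (- \<tau> * (((-1) ^ a) - \<sigma> * of_nat a)) v0"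
proof -
  have "Y f (-1) (Y x (-1) (Y x (- int a) vac))
     = Y x (-1) (Y x (- int a) (Y f (-1) vac)) + smul \<tau> (Y x (-1) (Y y (-1 - int a) vac))
       + smul \<tau> (Y y (-2) (Y x (- int a) vac))"
    by (simp add: fx Y_add_right Y_smul_right algebra_simps)
  then have "Y x (-1) (Y x (- int a) (Y f (-1) vac))
     = Y f (-1) (Y x (-1) (Y x (- int a) vac)) + smul (-\<tau>) (Y x (-1) (Y y (-1 - int a) vac))
       + smul (-\<tau>) (Y y (-2) (Y x (- int a) vac))"
    by (simp add: algebra_simps)
  also have "\<dots> \<doteq> 0 + smul (-\<tau>) (smul ((-1) ^ a) v0) + smul (-\<tau>) (smul (- \<sigma> * of_nat a) v0)"
    by (intro mod_add mod_smul cong_va cong_v1) (use fxx_in in \<open>simp add: mod_eq_def\<close>)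
  also have "\<dots> = smul (- \<tau> * (((-1) ^ a) - \<sigma> * of_nat a)) v0"
    by (simp add: algebra_simps)
  finally show ?thesis .
qed

text \<open>Up to the factor \<open>i + 1\<close>, the difference of \<open>high_term i\<close> and
  \<open>low_term i\<close> is the summand of index \<open>i\<close> in the iterate formula for mode
  1 of y(-2)x(-1)1 on \<open>w0\<close>.\<close>

definition low_term :: "nat \<Rightarrow> 'v" where
  "low_term i = smul \<sigma> (Y x (-1 - int i) (Y y (int i) w0))"

definition high_term :: "nat \<Rightarrow> 'v" where
  "high_term i = Y y (-2 - int i) (Y x (1 + int i) w0)"

text \<open>The mode y(i) is contracted with both factors of \<open>w0\<close>. With y(-1) it gives
  a mode of \<open>f\<close>, which survives on the vacuum only for \<open>i = 0\<close>; with x(-a)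
  it gives a mode of \<open>h\<close>, and a scalar exactly for \<open>i = a\<close>.\<close>

lemma low_term_eq: "low_term i =
    (if i = 0 then Y x (-1) (Y x (- int a) (Y f (-1) vac)) else 0)
    - Y x (-1 - int i) (Y h (int i - int a) (Y y (-1) vac))
    + (if i = a then smul (of_nat a * \<kappa>) v0 else 0)"
proof -
  have "Y y (int i) (Y y (-1) vac) = (if i = 0 then Y f (-1) vac else 0)"
    by (subst yy) (simp add: creation)
  moreover have "smul \<sigma> (Y y (int i) w0) = Y x (- int a) (Y y (int i) (Y y (-1) vac))
      - Y h (int i - int a) (Y y (-1) vac)
      + (if i = a then smul (of_nat a * \<kappa>) (Y y (-1) vac) else 0)"
    unfolding y_swap by (simp add: algebra_simps)
  ultimately have "smul \<sigma> (Y y (int i) w0) = (if i = 0 then Y x (- int a) (Y f (-1) vac) else 0)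
      - Y h (int i - int a) (Y y (-1) vac)
      + (if i = a then smul (of_nat a * \<kappa>) (Y y (-1) vac) else 0)"
    by simp
  moreover have "low_term i = Y x (-1 - int i) (smul \<sigma> (Y y (int i) w0))"
    by (simp add: low_term_def Y_smul_right)
  ultimately show ?thesis
    by (simp add: Y_add_right Y_diff_right Y_smul_right)
qed

lemma low_term_cong:
  assumes "i < a"
  shows "low_term i \<doteq> smul (\<mu> - (if i = 0 then \<tau> * (((-1) ^ a) - \<sigma> * of_nat a) else 0)) v0"
proof -
  have "low_term i = (if i = 0 then Y x (-1) (Y x (- int a) (Y f (-1) vac)) else 0)
    - Y x (-1 - int i) (Y h (int i - int a) (Y y (-1) vac))"
    using assms by (simp add: low_term_eq)
  also have "\<dots> \<doteq> (if i = 0 then smul (- \<tau> * (((-1) ^ a) - \<sigma> * of_nat a)) v0 else 0)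
      - smul (-\<mu>) v0"
    by (intro mod_diff xhy_cong) (use xxf_cong mod_refl assms in auto)
  also have "\<dots> = smul (\<mu> - (if i = 0 then \<tau> * (((-1) ^ a) - \<sigma> * of_nat a) else 0)) v0"
    by (simp add: algebra_simps)
  finally show ?thesis .
qed

lemma low_term_last: "low_term a = smul (\<mu> + of_nat a * \<kappa>) v0"
proof -
  have "Y h 0 (Y y (-1) vac) = smul (-\<mu>) (Y y (-1) vac)"
    by (simp only: hy) (simp add: creation)
  then show ?thesis
    using a_pos by (simp add: low_term_eq Y_smul_right Y_minus_right algebra_simps)
qed

lemma low_term_zero:
  assumes "i > a"
  shows "low_term i = 0"
proof -
  have "Y h (int i - int a) (Y y (-1) vac) = 0"
    using assms by (simp only: hy) (simp add: creation)
  then show ?thesis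
    using assms a_pos by (simp add: low_term_eq)
qed

text \<open>The mode x(1+i) contracts with y(-1) to the scalar \<kappa> only for
  \<open>i = 0\<close>, the nonnegative modes of \<open>h\<close> killing the vacuum, and with x(-a)
  to a mode of \<open>e\<close>.\<close>

lemma high_term_eq: "high_term i =
    (if i = 0 then smul (\<sigma> * \<kappa>) (Y y (-2) (Y x (- int a) vac)) else 0)
    + Y y (-2 - int i) (Y e (1 + int i - int a) (Y y (-1) vac))"
proof -
  have "Y x (1 + int i) (Y y (-1) vac) = (if i = 0 then smul \<kappa> vac else 0)"
    by (simp only: xy) (simp add: creation)
  moreover have "Y x (1 + int i) w0 = smul \<sigma> (Y x (- int a) (Y x (1 + int i) (Y y (-1) vac)))
      + Y e (1 + int i - int a) (Y y (-1) vac)"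
    by (subst xx) simp
  ultimately show ?thesis
    unfolding high_term_def
    by (auto simp: Y_add_right Y_smul_right)
qed

lemma high_term_cong:
  assumes "i \<le> a"
  shows "high_term i \<doteq> smul ((if i = 0 then - \<kappa> * of_nat a else 0)
     + (if i + 1 < a then \<tau> else if i + 1 = a then - \<tau> * \<sigma> * (-1) ^ a else 0)) v0"
proof -
  have 1: "(if i = 0 then smul (\<sigma> * \<kappa>) (Y y (-2) (Y x (- int a) vac)) else 0)
     \<doteq> (if i = 0 then smul (\<sigma> * \<kappa>) (smul (- \<sigma> * of_nat a) v0) else 0)"
    using mod_smul[OF cong_v1] mod_refl by simp
  \<comment> \<open>The cases are the sign of the mode number of \<open>e\<close>. A negative mode
    is moved to the front, where \<open>eyy_in\<close> applies; mode 0 acts on y(-1)1 by the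
    bracket; mode 1 kills y(-1)1.\<close>
  consider "i + 1 < a" | "i + 1 = a" | "i = a" using assms by linarith
  then have 2: "Y y (-2 - int i) (Y e (1 + int i - int a) (Y y (-1) vac))
     \<doteq> (if i + 1 < a then smul \<tau> v0 else if i + 1 = a then smul (- \<tau> * \<sigma> * (-1) ^ a) v0 else 0)"
  proof cases
    case 1
    have "Y y (-2 - int i) (Y e (1 + int i - int a) (Y y (-1) vac)) - smul \<tau> v0
      = Y e (1 + int i - int a) (Y y (-1 - (1 + int i)) (Y y (-1) vac))"
      using ey[of "1 + int i - int a" "-2 - int i" "Y y (-1) vac"]
      by (simp add: diff_diff_eq)
    also have "\<dots> \<in> U"
      by (rule eyy_in) (use 1 in auto)
    finally show ?thesis using 1 by (simp add: mod_eq_def)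
  next
    case 2
    have "Y e 0 (Y y (-1) vac) = - smul \<tau> (Y x (-1) vac)"
      by (subst ey) (simp add: creation)
    moreover have "1 + int i - int a = 0" "-2 - int i = -1 - int a" using 2 by auto
    ultimately have "Y y (-2 - int i) (Y e (1 + int i - int a) (Y y (-1) vac))
       = smul (-\<tau>) (Y y (-1 - int a) (Y x (-1) vac))"
      by (simp only: Y_minus_right Y_smul_right scale_minus_left)
    also have "\<dots> \<doteq> smul (-\<tau>) (smul (\<sigma> * (-1) ^ a) v0)"
      by (intro mod_smul cong_va')
    finally show ?thesis using 2 by (simp add: mult.assoc)
  next
    case 3
    then show ?thesis
      using mod_refl by (simp only: ey) (simp add: creation)
  qed
  have "high_term i \<doteq> (if i = 0 then smul (\<sigma> * \<kappa>) (smul (- \<sigma> * of_nat a) v0) else 0)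
   + (if i + 1 < a then smul \<tau> v0 else if i + 1 = a then smul (- \<tau> * \<sigma> * (-1) ^ a) v0 else 0)"
    unfolding high_term_eq by (rule mod_add[OF 1 2])
  also have "\<dots> = smul ((if i = 0 then - \<kappa> * of_nat a else 0)
     + (if i + 1 < a then \<tau> else if i + 1 = a then - \<tau> * \<sigma> * (-1) ^ a else 0)) v0"
  proof -
    have "\<sigma> * (\<kappa> * (\<sigma> * of_nat a)) = \<kappa> * of_nat a" 
      using sign_square by (metis (no_types, lifting) mult.left_commute mult.left_neutral mult.assoc)
    then show ?thesis by (simp add: algebra_simps)
  qed
  finally show ?thesis .
qed

lemma high_term_zero:
  assumes "i > a"
  shows "high_term i = 0"
proof -
  have "Y e (1 + int i - int a) (Y y (-1) vac) = 0"
    using assms by (simp only: ey) (simp add: creation)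
  then show ?thesis using assms by (simp add: high_term_eq)
qed

text \<open>The weights are (-1)^i (-2 choose i) = i + 1, and all contractions vanish for
  \<open>i > a\<close>.\<close>

lemma generator_action: "Y (Y y (-2) x) 1 w0 = (\<Sum>i\<le>a. smul (of_nat (i + 1)) (high_term i - low_term i))"
proof -
  have gb: "(-1) ^ i * ((-2 :: complex) gchoose i) = of_nat (i + 1)" for i
  proof -
    have "(of_nat (Suc i) :: complex) gchoose i = of_nat (Suc i)"
      by (simp only: flip: binomial_gbinomial) simp
    then show ?thesis
      by (simp add: gbinomial_minus add.commute flip: power_mult_distrib mult.assoc)
  qed
  have "Y (Y y (-2) x) 1 w0 = Sum_any (\<lambda>i. smul (of_nat (i + 1)) (high_term i - low_term i))"
    unfolding Y_iterate[OF y_part x_part] high_term_def low_term_def using gb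
    by (simp add: sign algebra_simps)
  also have "\<dots> = (\<Sum>i\<le>a. smul (of_nat (i + 1)) (high_term i - low_term i))"
  proof (rule Sum_any.expand_superset)
    show "{i. smul (of_nat (i + 1)) (high_term i - low_term i) \<noteq> 0} \<subseteq> {..a}"
    proof
      fix i assume "i \<in> {i. smul (of_nat (i + 1)) (high_term i - low_term i) \<noteq> 0}"
      then have "\<not> i > a" using high_term_zero low_term_zero by auto
      then show "i \<in> {..a}" by auto
    qed
  qed simp
  finally show ?thesis .
qed


lemma v0_in: "v0 \<in> U"
proof -
  \<comment> \<open>\<open>c i\<close> is the coefficient of \<open>v0\<close> in
    \<open>high_term i - low_term i\<close> modulo U, and \<open>C\<close> is the total
    coefficient.\<close>
  define c where "c i = (if i = 0 then - \<kappa> * of_nat a else 0)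
     + (if i + 1 < a then \<tau> else if i + 1 = a then - \<tau> * \<sigma> * (-1) ^ a else 0)
     - (if i = a then \<mu> + of_nat a * \<kappa>
        else \<mu> - (if i = 0 then \<tau> * (((-1) ^ a) - \<sigma> * of_nat a) else 0))" for i
  define C where "C = (\<Sum>i\<le>a. of_nat (i + 1) * c i)"
  obtain b where b: "a = Suc b" using a_pos by (cases a) auto
  have tri: "(\<Sum>i<n. of_nat (i + 1)) = (of_nat n * (of_nat n + 1) / 2 :: complex)" for n
    by (induction n) (auto simp: field_simps)
  \<comment> \<open>Below \<open>a\<close> the coefficient is constant up to corrections at the two
    ends 0 and \<open>b = a - 1\<close>. They are written additively because for
    \<open>a = 1\<close> both ends coincide.\<close>
  have c_mid: "c i = \<tau> - \<mu> + (if i = 0 then - \<kappa> * of_nat a + \<tau> * ((-1) ^ a - \<sigma> * of_nat a) else 0)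
      + (if i = b then - \<tau> * \<sigma> * (-1) ^ a - \<tau> else 0)" if "i < a" for i
    using that by (auto simp: c_def b algebra_simps)
  have "C = (\<Sum>i<a. of_nat (i + 1) * c i) + (of_nat a + 1) * c a"
    by (simp add: C_def lessThan_Suc_atMost[symmetric] add.commute)
  also have "(\<Sum>i<a. of_nat (i + 1) * c i) = (\<Sum>i<a. of_nat (i + 1) * (\<tau> - \<mu>)
     + (if i = 0 then - \<kappa> * of_nat a + \<tau> * ((-1) ^ a - \<sigma> * of_nat a) else 0)
     + (if i = b then of_nat a * (- \<tau> * \<sigma> * (-1) ^ a - \<tau>) else 0))"
    by (rule sum.cong) (auto simp: c_mid b algebra_simps)
  also have "\<dots> = of_nat a * (of_nat a + 1) / 2 * (\<tau> - \<mu>)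
     + (- \<kappa> * of_nat a + \<tau> * ((-1) ^ a - \<sigma> * of_nat a))
     + of_nat a * (- \<tau> * \<sigma> * (-1) ^ a - \<tau>)"
    using a_pos unfolding sum.distrib sum_distrib_right[symmetric] tri
    by (simp add: b)
  also have "c a = - (\<mu> + of_nat a * \<kappa>)"
    using a_pos by (simp add: c_def)
  finally have C: "C = of_nat a * (of_nat a + 1) / 2 * (\<tau> - \<mu>)
     + (- \<kappa> * of_nat a + \<tau> * ((-1) ^ a - \<sigma> * of_nat a))
     + of_nat a * (- \<tau> * \<sigma> * (-1) ^ a - \<tau>) + (of_nat a + 1) * - (\<mu> + of_nat a * \<kappa>)" .
  have "C = \<tau> * (of_nat a * (of_nat a - 1) / 2) - \<tau> * \<sigma> * of_nat a * (-1) ^ a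
        - \<mu> * (of_nat a * (of_nat a + 1) / 2) - (of_nat a + 1) * (\<mu> + of_nat a * \<kappa>)
        - of_nat a * \<kappa> + \<tau> * ((-1) ^ a - \<sigma> * of_nat a)"
    unfolding C by (simp add: field_simps)
  then have "C \<noteq> 0"
    using nondeg[OF a_pos] by simp
  have "high_term i - low_term i \<doteq> smul (c i) v0" if "i \<le> a" for i
  proof -
    have "low_term i \<doteq> smul (if i = a then \<mu> + of_nat a * \<kappa>
        else \<mu> - (if i = 0 then \<tau> * (((-1) ^ a) - \<sigma> * of_nat a) else 0)) v0"
      using that low_term_cong[of i] mod_refl by (cases "i = a") (auto simp: low_term_last)
    from mod_diff[OF high_term_cong[OF that] this] show ?thesis
      by (simp only: c_def scale_left_diff_distrib)
  qed
  then have "(\<Sum>i\<le>a. smul (of_nat (i + 1)) (high_term i - low_term i))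
      \<doteq> (\<Sum>i\<le>a. smul (of_nat (i + 1)) (smul (c i) v0))"
    by (intro mod_sum mod_smul) simp
  then have "Y (Y y (-2) x) 1 w0 \<doteq> smul C v0"
    unfolding generator_action C_def by (simp add: scale_sum_left)
  moreover have "Y (Y y (-2) x) 1 w0 \<in> U"
    by (intro U_Y gen_in pairs_uptoD[OF upto]) (use a_pos in auto)
  ultimately have "smul C v0 \<in> U"
    unfolding mod_eq_def using U_diff by fastforce
  then show ?thesis using U_smul_cancel \<open>C \<noteq> 0\<close> by blast
qed

lemma pairs_upto_step: "pairs_upto (int a + 2)"
  unfolding pairs_upto_def
proof (intro allI impI)
  fix b c :: int assume bc: "1 \<le> b" "1 \<le> c" "b + c \<le> int a + 2"
  show "Y x (- b) (Y y (- c) vac) \<in> U"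
  proof (cases "b + c \<le> int a + 1")
    case True
    then show ?thesis using pairs_uptoD[OF upto] bc by simp
  next
    case False
    define r where "r = nat (c - 1)"
    have r: "c = 1 + int r" "b = int a + 1 - int r" "r \<le> a" using False bc by (auto simp: r_def)
    have "top_pair 0 = v0" by (simp add: algebra_simps)
    then have "top_pair r - smul ((-1) ^ r * of_nat (a choose r)) v0 \<in> U"
      using top_pair_cong[OF r(3)] by metis
    from U_add[OF this U_smul[OF v0_in, of "(-1) ^ r * of_nat (a choose r)"]]
    show ?thesis by (simp add: r)
  qed
qed

end

lemma pairs_upto_all: "pairs_upto (int n)"
proof (induction n)
  case 0
  then show ?case by (auto simp: pairs_upto_def)
next
  case (Suc n)
  show ?case
  proof (cases "n \<le> 1")
    case True
    then show ?thesis using pairs_upto_2 by (auto simp: pairs_upto_def)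
  next
    case False
    then have "int (Suc n) = int (n - 1) + 2" "int n = int (n - 1) + 1" "n - 1 \<ge> 1" by auto
    then show ?thesis using pairs_upto_step[of "n - 1"] Suc.IH by metis
  qed
qed

lemma yx_in:
  assumes "m \<ge> 1"
  shows "Y y (- m) x \<in> U"
  using pairs_uptoD'[OF pairs_upto_all[of "nat (m + 1)"], of 1 m] assms by (simp add: creation)


section \<open>Products of single modes from the fields of the vectors y(-m)x(-1)1\<close>

definition ordered_product :: "int \<Rightarrow> 'v \<Rightarrow> int \<Rightarrow> 'v" where
  "ordered_product p w i =
     (if i < 0 then Y y i (Y x (p - i) w) else smul \<sigma> (Y x (p - i) (Y y i w)))"

text \<open>The factor acting first has a large mode number at either end of the range of
  \<open>i\<close>. This is why normal ordering is used instead of a fixed order of the two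
  factors.\<close>

lemma ordered_product_support:
  obtains K :: nat where "\<And>i. i < - int K \<Longrightarrow> ordered_product p w i = 0"
    "\<And>i. int K \<le> i \<Longrightarrow> ordered_product p w i = 0"
proof -
  obtain M where M: "\<forall>m\<ge>M. Y x m w = 0" using truncation by blast
  obtain M' where M': "\<forall>m\<ge>M'. Y y m w = 0" using truncation by blast
  show ?thesis
  proof (rule that[of "nat (\<bar>M\<bar> + \<bar>M'\<bar> + \<bar>p\<bar>)"])
    fix i assume "i < - int (nat (\<bar>M\<bar> + \<bar>M'\<bar> + \<bar>p\<bar>))"
    then have "i < 0" "p - i \<ge> M" by auto
    then show "ordered_product p w i = 0" using M by (simp add: ordered_product_def)
  next
    fix i assume "int (nat (\<bar>M\<bar> + \<bar>M'\<bar> + \<bar>p\<bar>)) \<le> i"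
    then have "\<not> i < 0" "i \<ge> M'" by auto
    then show "ordered_product p w i = 0" using M' by (simp add: ordered_product_def)
  qed
qed

text \<open>The field of y(-q-1)x(-1)1 is the normally ordered product of the divided derivative of
  order \<open>q\<close> of y(z) with x(z). Since y(i) comes with z^(-i-1), differentiation
  contributes the binomial coefficient of -i-1 over q.\<close>

lemma yx_field:
  assumes lo: "\<And>i. i < - int K \<Longrightarrow> ordered_product p w i = 0"
    and hi: "\<And>i. int K \<le> i \<Longrightarrow> ordered_product p w i = 0"
  shows "Y (Y y (- int (Suc q)) x) (p + int (Suc q)) w
    = (\<Sum>i\<in>{- int K..<int K}. smul (of_int (- i - 1) gchoose q) (ordered_product p w i))"
proof -
  define Z where "Z = ordered_product p w"
  define G :: "int \<Rightarrow> complex" where "G i = of_int (- i - 1) gchoose q" for i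
  have bin: "(-1) ^ n * (of_int (- int (Suc q)) gchoose n) = (of_nat (q + n choose q) :: complex)" for n
  proof -
    have "(of_int (- int (Suc q)) :: complex) = - of_nat (Suc q)"
      by simp
    then have "(of_int (- int (Suc q)) :: complex) gchoose n = (-1) ^ n * (of_nat (q + n) gchoose n)"
      by (simp only: gbinomial_minus) simp
    also have "(of_nat (q + n) :: complex) gchoose n = of_nat (q + n choose q)"
      by (simp only: binomial_gbinomial[symmetric] binomial_symmetric[of n "q + n"]) simp
    finally show ?thesis
      by (simp flip: mult.assoc power_mult_distrib)
  qed
  have G_neg: "G (- int (Suc q) - int n) = of_nat (q + n choose q)" for n
  proof -
    have "(of_int (- (- int (Suc q) - int n) - 1) :: complex) = of_nat (q + n)" by simp
    then show ?thesis unfolding G_def by (simp only: binomial_gbinomial)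
  qed
  have G_pos: "G (int n) = (-1) ^ q * of_nat (q + n choose q)" for n
  proof -
    have "(of_int (- int n - 1) :: complex) = - of_nat (Suc n)" by simp
    then have "G (int n) = (-1) ^ q * (of_nat (q + n) gchoose q)"
      unfolding G_def by (simp only: gbinomial_minus) (simp add: add.commute)
    then show ?thesis by (simp only: binomial_gbinomial)
  qed
  have sgn: "(-1 :: complex) powi (- int (Suc q)) = - ((-1) ^ q)"
    by (simp only: power_int_minus power_int_of_nat flip: power_inverse) simp
  have term_eq: "smul ((-1) ^ n * (of_int (- int (Suc q)) gchoose n))
        (Y y (- int (Suc q) - int n) (Y x (p + int (Suc q) + int n) w)
         - smul (super_sign s s * (-1) powi (- int (Suc q)))
             (Y x (p + int (Suc q) + - int (Suc q) - int n) (Y y (int n) w)))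
     = smul (G (- int (Suc q) - int n)) (Z (- int (Suc q) - int n)) + smul (G (int n)) (Z (int n))" for n
    unfolding bin G_neg G_pos sgn
    by (simp add: Z_def ordered_product_def sign[symmetric] scale_right_distrib algebra_simps)
  have "Y (Y y (- int (Suc q)) x) (p + int (Suc q)) w
    = Sum_any (\<lambda>n. smul (G (- int (Suc q) - int n)) (Z (- int (Suc q) - int n)) + smul (G (int n)) (Z (int n)))"
    unfolding Y_iterate[OF y_part x_part] term_eq ..
  also have "\<dots> = (\<Sum>n<K. smul (G (- int (Suc q) - int n)) (Z (- int (Suc q) - int n)) + smul (G (int n)) (Z (int n)))"
  proof (rule Sum_any.expand_superset)
    show "{n. smul (G (- int (Suc q) - int n)) (Z (- int (Suc q) - int n)) + smul (G (int n)) (Z (int n)) \<noteq> 0} \<subseteq> {..<K}"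
    proof
      fix n assume "n \<in> {n. smul (G (- int (Suc q) - int n)) (Z (- int (Suc q) - int n)) + smul (G (int n)) (Z (int n)) \<noteq> 0}"
      then have "Z (- int (Suc q) - int n) \<noteq> 0 \<or> Z (int n) \<noteq> 0" by auto
      then show "n \<in> {..<K}" using lo[of "- int (Suc q) - int n"] hi[of "int n"] unfolding Z_def by force
    qed
  qed simp
  also have "\<dots> = (\<Sum>n<K. smul (G (- int (Suc q) - int n)) (Z (- int (Suc q) - int n)))
      + (\<Sum>n<K. smul (G (int n)) (Z (int n)))"
    by (rule sum.distrib)
  also have "(\<Sum>n<K. smul (G (int n)) (Z (int n))) = (\<Sum>i\<in>{0..<int K}. smul (G i) (Z i))"
    by (rule sum.reindex_bij_witness[of _ nat int]) auto
  also have "(\<Sum>n<K. smul (G (- int (Suc q) - int n)) (Z (- int (Suc q) - int n)))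
      = (\<Sum>i\<in>{- int (Suc q) - int K<.. - int (Suc q)}. smul (G i) (Z i))"
    by (rule sum.reindex_bij_witness[of _ "\<lambda>i. nat (- int (Suc q) - i)" "\<lambda>n. - int (Suc q) - int n"]) auto
  \<comment> \<open>For \<open>-q \<le> i \<le> -1\<close> the number \<open>-i-1\<close> lies
    between 0 and \<open>q-1\<close>, so the weight vanishes and the gap below 0 can be
    filled.\<close>
  also have "\<dots> = (\<Sum>i\<in>{- int (Suc q) - int K<..<0}. smul (G i) (Z i))"
  proof (rule sum.mono_neutral_left)
    show "\<forall>i\<in>{- int (Suc q) - int K<..<0} - {- int (Suc q) - int K<..- int (Suc q)}. smul (G i) (Z i) = 0"
    proof
      fix i assume i: "i \<in> {- int (Suc q) - int K<..<0} - {- int (Suc q) - int K<..- int (Suc q)}"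
      then have "(of_int (- i - 1) :: complex) = of_nat (nat (- i - 1))" by (simp add: of_nat_nat)
      then have "G i = of_nat (nat (- i - 1) choose q)" unfolding G_def by (simp only: binomial_gbinomial)
      moreover have "nat (- i - 1) < q" using i by auto
      ultimately show "smul (G i) (Z i) = 0" by (simp add: binomial_eq_0)
    qed
  qed auto
  also have "\<dots> = (\<Sum>i\<in>{- int K..<0}. smul (G i) (Z i))"
    by (rule sum.mono_neutral_right) (auto simp: Z_def lo)
  also have "\<dots> + (\<Sum>i\<in>{0..<int K}. smul (G i) (Z i)) = (\<Sum>i\<in>{- int K..<int K}. smul (G i) (Z i))"
    by (subst sum.union_disjoint[symmetric]) (auto intro: arg_cong2[where f = sum])
  finally show ?thesis unfolding G_def Z_def .
qed

text \<open>By \<open>yx_field\<close> the ordered products occur weighted by arbitrary polynomials in the mode number,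
  so Lagrange interpolation isolates each of them.\<close>

lemma ordered_product_in:
  assumes w: "w \<in> U"
  shows "ordered_product p w i \<in> U"
proof -
  obtain K :: nat where lo: "\<And>i. i < - int K \<Longrightarrow> ordered_product p w i = 0"
    and hi: "\<And>i. int K \<le> i \<Longrightarrow> ordered_product p w i = 0"
    using ordered_product_support by blast
  define S where "S = {- int K..<int K}"
  define z :: "int \<Rightarrow> complex" where "z i = of_int (- i - 1)" for i
  \<comment> \<open>Linear factors are introduced one at a time. Multiplying
    \<open>z gchoose q\<close> by z - z_j gives a combination of the binomials for \<open>q\<close>
    and \<open>q + 1\<close>, so the claim has to be made for every \<open>q\<close>.\<close>
  have all: "(\<Sum>i\<in>S. smul ((\<Prod>j\<in>T. z i - z j) * (z i gchoose q)) (ordered_product p w i)) \<in> U"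
    if "finite T" for T q
    using that
  proof (induction T arbitrary: q)
    case empty
    have "Y (Y y (- int (Suc q)) x) (p + int (Suc q)) w \<in> U"
      by (intro U_Y yx_in w) simp
    moreover have "Y (Y y (- int (Suc q)) x) (p + int (Suc q)) w
      = (\<Sum>i\<in>S. smul (z i gchoose q) (ordered_product p w i))"
      unfolding S_def z_def by (rule yx_field) (auto intro: lo hi)
    ultimately show ?case by simp
  next
    case (insert j T)
    define g where "g i = (\<Prod>j\<in>T. z i - z j)" for i
    have "(\<Prod>j\<in>insert j T. z i - z j) * (z i gchoose q)
        = of_nat (Suc q) * (g i * (z i gchoose Suc q)) + (of_nat q - z j) * (g i * (z i gchoose q))" for i
    proof -
      have "z i * (z i gchoose q) = of_nat q * (z i gchoose q) + of_nat (Suc q) * (z i gchoose Suc q)"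
        by (rule gbinomial_mult_1)
      then have "(z i - z j) * (z i gchoose q)
         = of_nat (Suc q) * (z i gchoose Suc q) + (of_nat q - z j) * (z i gchoose q)"
        by (simp add: algebra_simps)
      then have "g i * ((z i - z j) * (z i gchoose q))
         = g i * (of_nat (Suc q) * (z i gchoose Suc q) + (of_nat q - z j) * (z i gchoose q))"
        by simp
      then show ?thesis
        using insert.hyps by (simp add: g_def algebra_simps)
    qed
    then have "(\<Sum>i\<in>S. smul ((\<Prod>j\<in>insert j T. z i - z j) * (z i gchoose q)) (ordered_product p w i))
      = smul (of_nat (Suc q)) (\<Sum>i\<in>S. smul (g i * (z i gchoose Suc q)) (ordered_product p w i))
        + smul (of_nat q - z j) (\<Sum>i\<in>S. smul (g i * (z i gchoose q)) (ordered_product p w i))"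
      by (simp only: scale_left_distrib sum.distrib scale_scale[symmetric] scale_sum_right)
    also have "\<dots> \<in> U"
      unfolding g_def by (intro U_add U_smul insert.IH)
    finally show ?case .
  qed
  show ?thesis
  proof (cases "i \<in> S")
    case False
    then have "ordered_product p w i = 0" using lo[of i] hi[of i] by (auto simp: S_def)
    then show ?thesis using U_zero by simp
  next
    case True
    define c where "c = (\<Prod>j\<in>S - {i}. z i - z j)"
    have "c \<noteq> 0" by (auto simp: c_def S_def z_def)
    have "(\<Sum>i'\<in>S. smul ((\<Prod>j\<in>S - {i}. z i' - z j) * (z i' gchoose 0)) (ordered_product p w i'))
       = (\<Sum>i'\<in>{i}. smul ((\<Prod>j\<in>S - {i}. z i' - z j) * (z i' gchoose 0)) (ordered_product p w i'))"
    proof (rule sum.mono_neutral_right)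
      show "\<forall>i'\<in>S - {i}. smul ((\<Prod>j\<in>S - {i}. z i' - z j) * (z i' gchoose 0)) (ordered_product p w i') = 0"
      proof
        fix i' assume "i' \<in> S - {i}"
        then have "(\<Prod>j\<in>S - {i}. z i' - z j) = 0"
          by (intro prod_zero) (auto simp: S_def)
        then show "smul ((\<Prod>j\<in>S - {i}. z i' - z j) * (z i' gchoose 0)) (ordered_product p w i') = 0"
          by simp
      qed
    qed (use True in \<open>auto simp: S_def\<close>)
    then have "smul c (ordered_product p w i) \<in> U"
      using all[of "S - {i}" 0] by (simp add: c_def S_def)
    then show ?thesis using U_smul_cancel \<open>c \<noteq> 0\<close> by blast
  qed
qed

text \<open>The sign of \<open>m\<close> decides which order is the normal one. The other order
  differs from it by a mode of \<open>h\<close> and a scalar, both of which preserve U.\<close>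

lemma U_yx_xy:
  assumes w: "w \<in> U"
  shows "Y y m (Y x p w) \<in> U" "Y x p (Y y m w) \<in> U"
proof -
  have h: "Y h (p + m) w \<in> U" "(if p + m = 0 then smul (of_int p * \<kappa>) w else 0) \<in> U"
    using U_h[OF w] U_smul[OF w] U_zero by auto
  have "Y y m (Y x p w) \<in> U \<and> Y x p (Y y m w) \<in> U"
  proof (cases "m < 0")
    case True
    then have 1: "Y y m (Y x p w) \<in> U"
      using ordered_product_in[OF w, of "m + p" m] by (simp add: ordered_product_def)
    then show ?thesis
      unfolding xy[of p m w] using U_add[OF U_add[OF U_smul h(1)] h(2)] by blast
  next
    case False
    then have "smul \<sigma> (Y x p (Y y m w)) \<in> U"
      using ordered_product_in[OF w, of "m + p" m] by (simp add: ordered_product_def)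
    then have 1: "Y x p (Y y m w) \<in> U"
      by (rule U_smul_cancel[rotated]) (auto simp: sign super_sign_def)
    then have "smul \<sigma> (Y y m (Y x p w)) \<in> U"
      unfolding y_swap using U_diff[OF U_diff[OF 1 h(1)] h(2)] by blast
    then show ?thesis
      using 1 U_smul_cancel[of \<sigma>] by (auto simp: sign super_sign_def split: if_splits)
  qed
  then show "Y y m (Y x p w) \<in> U" "Y x p (Y y m w) \<in> U" by auto
qed

end

section \<open>The root structure of osp(1|2n)\<close>

lemma mat_scale_nth [simp]: "mat_scale c X $ i $ j = c * X $ i $ j"
  by (simp add: mat_scale_def)

lemma gl_part_nth: "gl_part s X $ i $ j = (if (isl i \<noteq> isl j) = s then X $ i $ j else 0)"
  by (simp add: gl_part_def)

lemma gl_eqI: "(\<And>i j. X $ i $ j = Z $ i $ j) \<Longrightarrow> X = (Z :: 'n::finite gl)"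
  by (simp add: vec_eq_iff)

lemma gl_part_eq_iff:
  "gl_part s X = X \<longleftrightarrow> (\<forall>i j. X $ i $ j \<noteq> 0 \<longrightarrow> (isl i \<noteq> isl j) = s)"
  by (auto simp: vec_eq_iff gl_part_nth)

lemma gl_part_other: "gl_part s X = X \<Longrightarrow> t \<noteq> s \<Longrightarrow> gl_part t X = 0"
  by (auto simp: vec_eq_iff gl_part_nth) metis+

lemma gl_part_scale: "gl_part s (mat_scale c X) = mat_scale c (gl_part s X)"
  and gl_part_zero: "gl_part s 0 = 0"
  by (auto intro!: gl_eqI simp: gl_part_nth)

lemma gl_part_sum: "gl_part False X + gl_part True X = X"
  by (auto simp: vec_eq_iff gl_part_nth)

lemma mat_scale_zero_left [simp]: "mat_scale 0 X = 0"
  and mat_scale_zero_right [simp]: "mat_scale c 0 = 0"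
  and mat_scale_one [simp]: "mat_scale 1 X = X"
  by (auto intro!: gl_eqI)

lemma matrix_mult_nth: "(X ** Z) $ i $ j = (\<Sum>l\<in>UNIV. X $ i $ l * Z $ l $ j)"
  by (simp add: matrix_matrix_mult_def)

lemma matrix_mult_zero [simp]: "(0 :: 'n::finite gl) ** X = 0" "X ** (0 :: 'n gl) = 0"
  by (auto simp: vec_eq_iff matrix_mult_nth)

lemma super_bracket_homogeneous:
  assumes "gl_part s X = X" "gl_part t Z = Z"
  shows "super_bracket X Z = X ** Z - mat_scale (super_sign s t) (Z ** X)"
proof -
  have X: "gl_part s' X = (if s' = s then X else 0)" for s'
    using assms gl_part_other[of s X s'] by auto
  have Z: "gl_part s' Z = (if s' = t then Z else 0)" for s'
    using assms gl_part_other[of t Z s'] by auto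
  show ?thesis
    unfolding super_bracket_def X Z by (cases s; cases t) (simp_all add: UNIV_bool)
qed

section \<open>The mirror symmetry that cuts osp out of all matrices\<close>

fun dual_index :: "'n super_index \<Rightarrow> 'n super_index" where
  "dual_index (Inl u) = Inl u"
| "dual_index (Inr (Inl i)) = Inr (Inr i)"
| "dual_index (Inr (Inr i)) = Inr (Inl i)"

fun gram_sign :: "'n super_index \<Rightarrow> complex" where
  "gram_sign (Inl u) = 1"
| "gram_sign (Inr (Inl i)) = -1"
| "gram_sign (Inr (Inr i)) = 1"

fun index_weight :: "'n super_index \<Rightarrow> complex ^ 'n::finite" where
  "index_weight (Inl u) = 0"
| "index_weight (Inr (Inl i)) = axis i 1"
| "index_weight (Inr (Inr i)) = - axis i 1"

text \<open>An element X of osp satisfies \<open>X $ j* $ i* = mirror_sign i j * X $ i $ j\<close>, where * denotes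
  \<open>dual_index\<close>; see \<open>osp_iff\<close>.\<close>

definition mirror_sign :: "'n super_index \<Rightarrow> 'n super_index \<Rightarrow> complex" where
  "mirror_sign i j = - super_sign (isl i \<noteq> isl j) (\<not> isl i) * gram_sign i * gram_sign j"

lemma dual_dual [simp]: "dual_index (dual_index i) = i"
  by (cases i rule: dual_index.cases) auto

lemma dual_eq_iff [simp]: "dual_index i = dual_index j \<longleftrightarrow> i = j"
  by (metis dual_dual)

lemma dual_eq_swap: "dual_index i = j \<longleftrightarrow> i = dual_index j"
  by auto

lemma isl_dual [simp]: "isl (dual_index i) = isl i"
  by (cases i rule: dual_index.cases) auto

lemma weight_dual [simp]: "index_weight (dual_index i) = - index_weight i"
  by (cases i rule: dual_index.cases) auto

lemma gram_sign_square [simp]: "gram_sign i * gram_sign i = 1"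
  by (cases i rule: dual_index.cases) auto

lemma gram_sign_nonzero [simp]: "gram_sign i \<noteq> 0"
  by (metis gram_sign_square mult_zero_left zero_neq_one)

lemma mirror_sign_square: "mirror_sign (dual_index q) (dual_index p) * mirror_sign p q = 1"
  by (cases p rule: dual_index.cases; cases q rule: dual_index.cases)
    (auto simp: mirror_sign_def super_sign_def)

lemma osp_gram_eq: "osp_gram i j = (if i = dual_index j then gram_sign j else 0)"
  by (cases i rule: dual_index.cases; cases j rule: dual_index.cases) auto

lemma square_one_solve:
  assumes "g * g = (1 :: 'a::idom)"
  shows "a * g + c = 0 \<longleftrightarrow> a = - (c * g)"
proof
  assume "a * g + c = 0"
  then have "(a * g + c) * g = 0" by simp
  then show "a = - (c * g)" using assms by (simp add: distrib_right mult.assoc add_eq_0_iff2)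
next
  assume "a = - (c * g)"
  then show "a * g + c = 0" using assms by (simp add: mult.assoc)
qed

text \<open>The Gram matrix has one nonzero entry in each row and column, so each sum in the
  defining condition has one term. Replacing the index \<open>i\<close> by its dual turns the
  condition into a symmetry of the entries.\<close>

lemma osp_part_iff:
  fixes X :: "'n::finite gl"
  shows
  "X \<in> osp_part s \<longleftrightarrow> gl_part s X = X \<and>
     (\<forall>i j. X $ dual_index j $ dual_index i = mirror_sign i j * X $ i $ j)"
proof -
  have eq: "((\<Sum>l\<in>UNIV. X $ l $ dual_index i * osp_gram l j)
          + super_sign s (\<not> isl (dual_index i)) * (\<Sum>l\<in>UNIV. osp_gram (dual_index i) l * X $ l $ j) = 0)
     \<longleftrightarrow> X $ dual_index j $ dual_index i = mirror_sign i j * X $ i $ j"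
    if g: "gl_part s X = X" for i j
  proof -
    have "(\<Sum>l\<in>UNIV. X $ l $ dual_index i * osp_gram l j) = X $ dual_index j $ dual_index i * gram_sign j"
      by (simp add: osp_gram_eq if_distrib[of "(*) _"] cong: if_cong)
    moreover have "(\<Sum>l\<in>UNIV. osp_gram (dual_index i) l * X $ l $ j) = gram_sign i * X $ i $ j"
      by (simp add: osp_gram_eq if_distrib[of "\<lambda>x. x * _"] cong: if_cong)
    moreover have "X $ i $ j \<noteq> 0 \<Longrightarrow> s = (isl i \<noteq> isl j)"
      using g unfolding gl_part_eq_iff by blast
    ultimately show ?thesis
      using square_one_solve[OF gram_sign_square, of "X $ dual_index j $ dual_index i" j]
      by (cases "X $ i $ j = 0") (auto simp: mirror_sign_def mult.assoc)
  qed
  show ?thesis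
  proof (cases "gl_part s X = X")
    case True
    define C where "C i j \<longleftrightarrow> (\<Sum>l\<in>UNIV. X $ l $ i * osp_gram l j)
          + super_sign s (\<not> isl i) * (\<Sum>l\<in>UNIV. osp_gram i l * X $ l $ j) = 0" for i j
    have "X \<in> osp_part s \<longleftrightarrow> (\<forall>i j. C i j)"
      using True by (simp add: osp_part_def C_def)
    also have "\<dots> \<longleftrightarrow> (\<forall>i j. C (dual_index i) j)"
      by (metis dual_dual)
    finally show ?thesis
      using True unfolding C_def eq[OF True] by simp
  qed (simp add: osp_part_def)
qed

text \<open>The factor \<open>mirror_sign\<close> reads the parity off the position of the entry, so
  the conditions on the two homogeneous parts combine into one.\<close>

lemma osp_iff:
  "X \<in> osp \<longleftrightarrow> (\<forall>i j. X $ dual_index j $ dual_index i = mirror_sign i j * X $ i $ j)"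
  unfolding osp_def osp_part_iff mem_Collect_eq
  by (auto simp: gl_part_nth vec_eq_iff split: if_splits)

lemma osp_part_eq: "osp_part s = {X \<in> osp. gl_part s X = X}"
  by (auto simp: osp_iff osp_part_iff)

lemma osp_part_osp: "X \<in> osp_part s \<Longrightarrow> X \<in> osp"
  by (simp add: osp_part_eq)

lemma osp_add: "X \<in> osp \<Longrightarrow> Z \<in> osp \<Longrightarrow> X + Z \<in> osp"
  and osp_scale: "X \<in> osp \<Longrightarrow> mat_scale c X \<in> osp"
  and osp_zero: "0 \<in> osp"
  by (auto simp: osp_iff algebra_simps)

lemma osp_part_scale: "X \<in> osp_part s \<Longrightarrow> mat_scale c X \<in> osp_part s"
  and osp_part_zero: "0 \<in> osp_part s"
  by (auto simp: osp_part_eq osp_scale osp_zero gl_part_scale gl_part_zero)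

text \<open>Mirroring reverses the order of a matrix product up to a sign, so it exchanges the two
  products in the supercommutator.\<close>

lemma osp_part_bracket:
  fixes X Z :: "'n::finite gl"
  assumes X: "X \<in> osp_part s" and Z: "Z \<in> osp_part t"
  shows "super_bracket X Z \<in> osp_part (s \<noteq> t)"
proof -
  have gX: "gl_part s X = X" and gZ: "gl_part t Z = Z"
    using assms by (auto simp: osp_part_iff)
  have br: "super_bracket X Z = X ** Z - mat_scale (super_sign s t) (Z ** X)"
    by (rule super_bracket_homogeneous[OF gX gZ])
  have par: "(P ** Q) $ i $ j \<noteq> 0 \<Longrightarrow> (isl i \<noteq> isl j) = (s' \<noteq> t')"
    if "gl_part s' P = P" "gl_part t' Q = Q" for P Q :: "'n gl" and s' t' i j
  proof -
    assume "(P ** Q) $ i $ j \<noteq> 0"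
    then obtain l where "P $ i $ l * Q $ l $ j \<noteq> 0"
      unfolding matrix_mult_nth by (metis (no_types, lifting) sum.neutral)
    then have "P $ i $ l \<noteq> 0" "Q $ l $ j \<noteq> 0" by auto
    then show ?thesis using that unfolding gl_part_eq_iff by blast
  qed
  have "gl_part (s \<noteq> t) (super_bracket X Z) = super_bracket X Z"
    unfolding gl_part_eq_iff
  proof (intro allI impI)
    fix i j assume "super_bracket X Z $ i $ j \<noteq> 0"
    then have "(X ** Z) $ i $ j \<noteq> 0 \<or> (Z ** X) $ i $ j \<noteq> 0" by (auto simp: br)
    then show "(isl i \<noteq> isl j) = (s \<noteq> t)" using par[OF gX gZ, of i j] par[OF gZ gX, of i j] by auto
  qed
  moreover have "super_bracket X Z $ dual_index j $ dual_index i = mirror_sign i j * super_bracket X Z $ i $ j" for i j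
  proof -
    \<comment> \<open>\<open>D\<close> collects the signs that do not depend on the summation index:
      in the product of the two mirror signs, \<open>gram_sign l\<close> occurs squared.\<close>
    define D where "D = gram_sign i * gram_sign j * super_sign (s \<noteq> t) (\<not> isl i)"
    have bij: "bij dual_index" by (rule o_bij[of dual_index]) (auto simp: fun_eq_iff)
    have prod: "(P ** Q) $ dual_index j $ dual_index i = super_sign s' t' * D * (Q ** P) $ i $ j"
      if P: "P \<in> osp_part s'" and Q: "Q \<in> osp_part t'" and st: "(s' \<noteq> t') = (s \<noteq> t)" for P Q s' t'
    proof -
      have "(P ** Q) $ dual_index j $ dual_index i
         = (\<Sum>l\<in>UNIV. P $ dual_index j $ dual_index l * Q $ dual_index l $ dual_index i)"
        unfolding matrix_mult_nth by (rule sum.reindex_bij_betw[OF bij, symmetric])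
      also have "\<dots> = (\<Sum>l\<in>UNIV. super_sign s' t' * D * (Q $ i $ l * P $ l $ j))"
      proof (rule sum.cong[OF refl])
        fix l :: "'n super_index"
        have "P $ dual_index j $ dual_index l = mirror_sign l j * P $ l $ j"
          "Q $ dual_index l $ dual_index i = mirror_sign i l * Q $ i $ l"
          using P Q unfolding osp_part_iff by blast+
        moreover have "mirror_sign l j * mirror_sign i l = super_sign s' t' * D"
          if "P $ l $ j \<noteq> 0" "Q $ i $ l \<noteq> 0"
        proof -
          have "(isl l \<noteq> isl j) = s'" "(isl i \<noteq> isl l) = t'"
            using P Q that unfolding osp_part_iff gl_part_eq_iff by blast+
          then have "mirror_sign l j * mirror_sign i l = super_sign s' (\<not> isl l) * super_sign t' (\<not> isl i)
              * (gram_sign l * gram_sign l) * gram_sign i * gram_sign j"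
            by (simp add: mirror_sign_def)
          moreover have "super_sign s' (\<not> isl l) * super_sign t' (\<not> isl i)
             = super_sign s' t' * super_sign (s \<noteq> t) (\<not> isl i)"
            using \<open>(isl i \<noteq> isl l) = t'\<close> unfolding st[symmetric]
            by (cases s'; cases t'; cases "isl l"; cases "isl i") (auto simp: super_sign_def)
          ultimately show ?thesis by (simp add: D_def)
        qed
        ultimately show "P $ dual_index j $ dual_index l * Q $ dual_index l $ dual_index i
            = super_sign s' t' * D * (Q $ i $ l * P $ l $ j)"
          by (cases "P $ l $ j = 0"; cases "Q $ i $ l = 0") (auto simp: algebra_simps)
      qed
      finally show ?thesis by (simp add: matrix_mult_nth sum_distrib_left)
    qed
    have "super_bracket X Z $ dual_index j $ dual_index i
       = super_sign s t * D * (Z ** X) $ i $ j - super_sign s t * (super_sign t s * D * (X ** Z) $ i $ j)"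
      unfolding br using prod[OF X Z] prod[OF Z X] by auto
    also have "\<dots> = - D * super_bracket X Z $ i $ j"
      unfolding br by (cases s; cases t) (auto simp: super_sign_def algebra_simps)
    also have "\<dots> = mirror_sign i j * super_bracket X Z $ i $ j"
    proof (cases "super_bracket X Z $ i $ j = 0")
      case False
      then have "(isl i \<noteq> isl j) = (s \<noteq> t)"
        using calculation \<open>gl_part (s \<noteq> t) (super_bracket X Z) = super_bracket X Z\<close>
        unfolding gl_part_eq_iff by blast
      then show ?thesis by (simp add: mirror_sign_def D_def)
    qed simp
    finally show ?thesis .
  qed
  ultimately show ?thesis by (simp add: osp_part_iff)
qed

lemma super_bracket_swap:
  assumes "X \<in> osp_part s" "Z \<in> osp_part t"
  shows "super_bracket Z X = mat_scale (- super_sign s t) (super_bracket X Z)"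
proof -
  have "gl_part s X = X" "gl_part t Z = Z" using assms by (auto simp: osp_part_iff)
  then show ?thesis
    by (simp add: super_bracket_homogeneous)
       (cases s; cases t; auto intro!: gl_eqI simp: super_sign_def algebra_simps)
qed


section \<open>The Cartan subalgebra, weights and root spaces\<close>

fun diag_entry :: "complex ^ 'n::finite \<Rightarrow> 'n super_index \<Rightarrow> complex" where
  "diag_entry \<mu> (Inl u) = 0"
| "diag_entry \<mu> (Inr (Inl i)) = \<mu> $ i"
| "diag_entry \<mu> (Inr (Inr i)) = - \<mu> $ i"

definition diag_matrix :: "complex ^ 'n::finite \<Rightarrow> 'n gl" where
  "diag_matrix \<mu> = (\<chi> i j. if i = j then diag_entry \<mu> i else 0)"

lemma diag_matrix_nth: "diag_matrix \<mu> $ i $ j = (if i = j then diag_entry \<mu> i else 0)"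
  by (simp add: diag_matrix_def)

lemma diag_entry_dual: "diag_entry \<mu> (dual_index i) = - diag_entry \<mu> i"
  by (cases i rule: dual_index.cases) auto

lemma mirror_sign_diag: "mirror_sign i i = -1"
  by (simp add: mirror_sign_def super_sign_def mult.assoc)

lemma diag_matrix_cartan: "diag_matrix \<mu> \<in> cartan"
  by (auto simp: cartan_def osp_iff diag_matrix_nth diag_entry_dual mirror_sign_diag)

lemma cartan_osp_part: "H \<in> cartan \<Longrightarrow> H \<in> osp_part False"
  unfolding cartan_def osp_part_eq gl_part_eq_iff mem_Collect_eq by metis

lemma cartan_osp: "H \<in> cartan \<Longrightarrow> H \<in> osp"
  by (simp add: cartan_def)

lemma cartan_diag:
  assumes "H \<in> cartan"
  shows "H = diag_matrix (\<chi> i. H $ Inr (Inl i) $ Inr (Inl i))"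
proof (rule gl_eqI)
  fix i j
  have d: "H $ dual_index i $ dual_index i = - H $ i $ i" for i
    using assms mirror_sign_diag[of i] by (auto simp: cartan_def osp_iff)
  have "H $ Inl u $ Inl u = 0" for u
    using d[of "Inl u"] by simp
  moreover have "H $ Inr (Inr l) $ Inr (Inr l) = - H $ Inr (Inl l) $ Inr (Inl l)" for l
    using d[of "Inr (Inl l)"] by simp
  ultimately show "H $ i $ j = diag_matrix (\<chi> i. H $ Inr (Inl i) $ Inr (Inl i)) $ i $ j"
    using assms by (cases i rule: dual_index.cases) (auto simp: diag_matrix_nth cartan_def)
qed

lemma cartan_cases:
  assumes "H \<in> cartan" obtains \<mu> where "H = diag_matrix \<mu>"
  using cartan_diag[OF assms] by blast

lemma weight_eval_diag: "weight_eval \<nu> (diag_matrix \<mu>) = (\<Sum>i\<in>UNIV. \<nu> $ i * \<mu> $ i)"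
  by (simp add: weight_eval_def diag_matrix_nth)

lemma weight_eval_axis: "weight_eval \<nu> (diag_matrix (axis i 1)) = \<nu> $ i"
  by (simp add: weight_eval_diag axis_def if_distrib[of "(*) _"] cong: if_cong)

lemma weight_eval_add: "weight_eval (\<mu> + \<nu>) H = weight_eval \<mu> H + weight_eval \<nu> H"
  and weight_eval_diff: "weight_eval (\<mu> - \<nu>) H = weight_eval \<mu> H - weight_eval \<nu> H"
  and weight_eval_minus: "weight_eval (- \<mu>) H = - weight_eval \<mu> H"
  and weight_eval_zero [simp]: "weight_eval 0 H = 0"
  and weight_eval_smult: "weight_eval (c *s \<mu>) H = c * weight_eval \<mu> H"
  by (auto simp: weight_eval_def algebra_simps sum.distrib sum_subtractf sum_negf sum_distrib_left)

lemma weight_eval_index: "weight_eval (index_weight i) (diag_matrix \<mu>) = diag_entry \<mu> i"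
  by (cases i rule: dual_index.cases)
     (auto simp: weight_eval_minus weight_eval_diag axis_def sum_negf if_distrib[of "\<lambda>x. x * _"] cong: if_cong)

lemma weight_eqI: "(\<And>H. H \<in> cartan \<Longrightarrow> weight_eval \<mu> H = weight_eval \<nu> H) \<Longrightarrow> \<mu> = \<nu>"
  unfolding vec_eq_iff using weight_eval_axis diag_matrix_cartan by metis

lemma weight_nonzeroE:
  assumes "\<mu> \<noteq> 0" obtains H where "H \<in> cartan" "weight_eval \<mu> H \<noteq> 0"
  using weight_eqI[of \<mu> 0] assms by auto

lemma matrix_add_rdistrib':
  fixes X Z W :: "'n::finite gl"
  shows "(X + Z) ** W = X ** W + Z ** W"
  by (auto intro!: gl_eqI simp: matrix_mult_nth distrib_right sum.distrib)

lemma super_bracket_even_left: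
  assumes "gl_part False H = H"
  shows "super_bracket H X = H ** X - X ** H"
proof -
  have H: "gl_part s H = (if s then 0 else H)" for s
    using assms gl_part_other[of False H s] by auto
  have "super_bracket H X = H ** (gl_part False X + gl_part True X) - (gl_part False X + gl_part True X) ** H"
    unfolding super_bracket_def H
    by (simp add: UNIV_bool super_sign_def matrix_add_ldistrib matrix_add_rdistrib')
  then show ?thesis by (simp only: gl_part_sum)
qed

lemma super_bracket_cartan:
  assumes "H \<in> cartan"
  shows "super_bracket H X $ i $ j = weight_eval (index_weight i - index_weight j) H * X $ i $ j"
proof -
  obtain \<mu> where H: "H = diag_matrix \<mu>" using assms by (rule cartan_cases)
  have "super_bracket H X $ i $ j = (H ** X) $ i $ j - (X ** H) $ i $ j"
    using cartan_osp_part[OF assms] by (simp add: super_bracket_even_left osp_part_iff)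
  also have "(H ** X) $ i $ j = diag_entry \<mu> i * X $ i $ j"
    by (simp add: matrix_mult_nth H diag_matrix_nth if_distrib[of "\<lambda>x. x * _"] cong: if_cong)
  also have "(X ** H) $ i $ j = diag_entry \<mu> j * X $ i $ j"
    by (simp add: matrix_mult_nth H diag_matrix_nth if_distrib[of "\<lambda>x. _ * x"] cong: if_cong)
  finally show ?thesis
    by (simp add: weight_eval_diff weight_eval_index H algebra_simps)
qed

text \<open>A Cartan element multiplies the entry at (i, j) by the difference of the weights of
  \<open>i\<close> and \<open>j\<close>, so membership in a root space is a condition on the support
  of the matrix.\<close>

lemma root_space_iff:
  "X \<in> root_space \<beta> \<longleftrightarrow> X \<in> osp \<and> (\<forall>i j. X $ i $ j \<noteq> 0 \<longrightarrow> index_weight i - index_weight j = \<beta>)"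
  (is "?L \<longleftrightarrow> ?R")
proof
  assume L: ?L
  have "index_weight i - index_weight j = \<beta>" if nz: "X $ i $ j \<noteq> 0" for i j
  proof (rule weight_eqI)
    fix H :: "'a gl" assume H: "H \<in> cartan"
    then have "super_bracket H X $ i $ j = mat_scale (weight_eval \<beta> H) X $ i $ j"
      using L by (simp add: root_space_def)
    then show "weight_eval (index_weight i - index_weight j) H = weight_eval \<beta> H"
      using nz by (simp add: super_bracket_cartan[OF H])
  qed
  then show ?R using L by (auto simp: root_space_def)
next
  assume R: ?R
  have "super_bracket H X = mat_scale (weight_eval \<beta> H) X" if "H \<in> cartan" for H
  proof (rule gl_eqI)
    fix i j
    show "super_bracket H X $ i $ j = mat_scale (weight_eval \<beta> H) X $ i $ j"
      using R by (cases "X $ i $ j = 0") (auto simp: super_bracket_cartan[OF that])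
  qed
  then show ?L using R by (simp add: root_space_def)
qed

lemma index_weight_inj: "index_weight i = (index_weight j :: complex ^ 'n::finite) \<Longrightarrow> i = j"
  by (cases i rule: dual_index.cases; cases j rule: dual_index.cases)
     (auto simp: axis_eq_axis vec_eq_iff axis_def split: if_splits)

text \<open>The weights of the basis vectors of the defining representation are distinct, so entries
  of weight zero are diagonal.\<close>

lemma root_space_0: "root_space 0 = cartan"
proof -
  have "H \<in> root_space 0 \<longleftrightarrow> H \<in> cartan" for H :: "'a gl"
    unfolding cartan_def root_space_iff mem_Collect_eq
    by (metis diff_self eq_iff_diff_eq_0 index_weight_inj)
  then show ?thesis by blast
qed

lemma cartan_root_space_zero: "H \<in> cartan \<longleftrightarrow> H \<in> root_space 0 \<and> H \<in> osp_part False"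
  using cartan_osp_part root_space_0 by blast

lemma root_space_scale: "X \<in> root_space \<beta> \<Longrightarrow> mat_scale c X \<in> root_space \<beta>"
  by (auto simp: root_space_iff osp_scale)

lemma root_space_osp: "X \<in> root_space \<beta> \<Longrightarrow> X \<in> osp"
  by (simp add: root_space_def)

lemma root_space_bracket:
  assumes "X \<in> root_space \<beta>" "Z \<in> root_space \<gamma>" "X \<in> osp_part s" "Z \<in> osp_part t"
  shows "super_bracket X Z \<in> root_space (\<beta> + \<gamma>)"
proof -
  have wt: "index_weight i - index_weight j = \<beta> + \<gamma>"
    if P: "P \<in> root_space \<beta>'" and Q: "Q \<in> root_space \<gamma>'"
      and sum: "\<beta>' + \<gamma>' = \<beta> + \<gamma>" and nz: "(P ** Q) $ i $ j \<noteq> 0" for i j P Q \<beta>' \<gamma>'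
  proof -
    obtain l where "P $ i $ l * Q $ l $ j \<noteq> 0"
      using nz unfolding matrix_mult_nth by (metis (no_types, lifting) sum.neutral)
    then have "index_weight i - index_weight l = \<beta>'" "index_weight l - index_weight j = \<gamma>'"
      using P Q unfolding root_space_iff by auto
    then show ?thesis using sum by (metis add_diff_eq diff_add_cancel)
  qed
  have br: "super_bracket X Z = X ** Z - mat_scale (super_sign s t) (Z ** X)"
    using assms by (intro super_bracket_homogeneous) (auto simp: osp_part_iff)
  have "index_weight i - index_weight j = \<beta> + \<gamma>" if "super_bracket X Z $ i $ j \<noteq> 0" for i j
  proof -
    have "(X ** Z) $ i $ j \<noteq> 0 \<or> (Z ** X) $ i $ j \<noteq> 0" using that by (auto simp: br)
    then show ?thesis using wt[OF assms(1,2) refl] wt[OF assms(2,1) add.commute] by blast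
  qed
  then show ?thesis
    using osp_part_osp[OF osp_part_bracket[OF assms(3,4)]] by (auto simp: root_space_iff)
qed

text \<open>The matrix unit at (p, q) plus its mirror image, that is, twice its projection to osp.
  If \<open>p\<close> is the dual of \<open>q\<close> the two positions coincide, which explains the
  value 2 in \<open>root_vec_self\<close>.\<close>

definition root_vec :: "'n super_index \<Rightarrow> 'n super_index \<Rightarrow> 'n::finite gl" where
  "root_vec p q = (\<chi> i j. (if i = p \<and> j = q then 1 else 0)
     + (if i = dual_index q \<and> j = dual_index p then mirror_sign p q else 0))"

lemma root_vec_nth: "root_vec p q $ i $ j = (if i = p \<and> j = q then 1 else 0)
     + (if i = dual_index q \<and> j = dual_index p then mirror_sign p q else 0)"
  by (simp add: root_vec_def)

lemma root_vec_nth': "root_vec p q $ i $ j = (if p = i \<and> q = j then 1 else 0)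
     + (if p = dual_index j \<and> q = dual_index i then mirror_sign p q else 0)"
proof -
  have "(i = dual_index q \<and> j = dual_index p) = (p = dual_index j \<and> q = dual_index i)"
    "(i = p \<and> j = q) = (p = i \<and> q = j)"
    by (metis dual_dual) (metis)
  then show ?thesis by (simp only: root_vec_nth)
qed

lemma mirror_sign_inverse: "mirror_sign p q * mirror_sign (dual_index q) (dual_index p) = 1"
  using mirror_sign_square by (metis mult.commute)

lemma root_vec_osp: "root_vec p q \<in> osp"
  unfolding osp_iff
proof (intro allI)
  fix i j
  have "root_vec p q $ dual_index j $ dual_index i = (if p = dual_index j \<and> q = dual_index i then 1 else 0)
     + (if p = i \<and> q = j then mirror_sign p q else 0)"
    using root_vec_nth'[of p q "dual_index j" "dual_index i"] by (simp only: dual_dual)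
  moreover have "(if p = i \<and> q = j then mirror_sign p q else 0)
     = mirror_sign i j * (if p = i \<and> q = j then 1 else 0)"
    by simp
  moreover have "(if p = dual_index j \<and> q = dual_index i then 1 else 0)
     = mirror_sign i j * (if p = dual_index j \<and> q = dual_index i then mirror_sign p q else 0)"
    using mirror_sign_inverse[of i j] by simp
  ultimately show "root_vec p q $ dual_index j $ dual_index i = mirror_sign i j * root_vec p q $ i $ j"
    unfolding root_vec_nth'[of p q i j] by (simp only: distrib_left add.commute)
qed

lemma root_vec_nonzero:
  assumes "root_vec p q $ i $ j \<noteq> 0"
  shows "(i = p \<and> j = q) \<or> (i = dual_index q \<and> j = dual_index p)"
proof (rule ccontr)
  assume "\<not> ((i = p \<and> j = q) \<or> (i = dual_index q \<and> j = dual_index p))"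
  then have "\<not> (i = p \<and> j = q)" "\<not> (i = dual_index q \<and> j = dual_index p)" by auto
  then show False using assms unfolding root_vec_nth by (simp only: if_False) simp
qed

lemma root_vec_part: "root_vec p q \<in> osp_part (isl p \<noteq> isl q)"
proof -
  have "(isl i \<noteq> isl j) = (isl p \<noteq> isl q)" if "root_vec p q $ i $ j \<noteq> 0" for i j
    using root_vec_nonzero[OF that] by (elim disjE conjE) (simp_all add: eq_commute)
  then show ?thesis using root_vec_osp unfolding osp_part_eq gl_part_eq_iff by blast
qed

lemma root_vec_root_space: "root_vec p q \<in> root_space (index_weight p - index_weight q)"
proof -
  have "index_weight i - index_weight j = index_weight p - index_weight q"
    if "root_vec p q $ i $ j \<noteq> 0" for i j
    using root_vec_nonzero[OF that] by auto
  then show ?thesis by (simp add: root_space_iff root_vec_osp)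
qed

text \<open>The factor 1/2 compensates that every entry is produced twice, once from its own
  position and once from the mirrored one.\<close>

lemma osp_expansion:
  assumes "X \<in> osp"
  shows "X = (\<Sum>p\<in>UNIV. \<Sum>q\<in>UNIV. mat_scale (X $ p $ q / 2) (root_vec p q))"
proof (rule gl_eqI)
  fix i j
  have nested: "(\<Sum>p\<in>UNIV. \<Sum>q\<in>UNIV. if p = a \<and> q = b then f p q else 0) = f a b"
    for a b :: "'a super_index" and f :: "'a super_index \<Rightarrow> 'a super_index \<Rightarrow> complex"
  proof -
    have "(\<Sum>q\<in>UNIV. if p = a \<and> q = b then f p q else 0) = (if p = a then f p b else 0)" for p
      by (cases "p = a") auto
    then show ?thesis by simp
  qed
  have split: "x * ((if P then 1 else 0) + (if Q then m else 0)) = (if P then x else 0) + (if Q then x * m else 0)"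
    for x m :: complex and P Q
    by (simp add: distrib_left)
  have "(\<Sum>p\<in>UNIV. \<Sum>q\<in>UNIV. mat_scale (X $ p $ q / 2) (root_vec p q)) $ i $ j
     = (\<Sum>p\<in>UNIV. \<Sum>q\<in>UNIV. X $ p $ q / 2 * root_vec p q $ i $ j)"
    by simp
  also have "\<dots> = (\<Sum>p\<in>UNIV. \<Sum>q\<in>UNIV. if p = i \<and> q = j then X $ p $ q / 2 else 0)
     + (\<Sum>p\<in>UNIV. \<Sum>q\<in>UNIV. if p = dual_index j \<and> q = dual_index i
          then X $ p $ q / 2 * mirror_sign p q else 0)"
    unfolding root_vec_nth' split sum.distrib ..
  also have "\<dots> = X $ i $ j / 2 + X $ dual_index j $ dual_index i / 2
        * mirror_sign (dual_index j) (dual_index i)"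
    unfolding nested ..
  also have "X $ dual_index j $ dual_index i / 2 * mirror_sign (dual_index j) (dual_index i) = X $ i $ j / 2"
  proof -
    have "X $ dual_index j $ dual_index i = mirror_sign i j * X $ i $ j"
      using assms by (simp add: osp_iff)
    then have "X $ dual_index j $ dual_index i * mirror_sign (dual_index j) (dual_index i)
       = (mirror_sign i j * mirror_sign (dual_index j) (dual_index i)) * X $ i $ j"
      by simp
    then show ?thesis by (simp only: mirror_sign_inverse) simp
  qed
  finally show "X $ i $ j = (\<Sum>p\<in>UNIV. \<Sum>q\<in>UNIV. mat_scale (X $ p $ q / 2) (root_vec p q)) $ i $ j"
    by simp
qed


section \<open>Root spaces are lines, and brackets of root vectors\<close>

lemma diag_entry_add: "diag_entry (\<mu> + \<nu>) r = diag_entry \<mu> r + diag_entry \<nu> r"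
  and diag_entry_diff: "diag_entry (\<mu> - \<nu>) r = diag_entry \<mu> r - diag_entry \<nu> r"
  and diag_entry_zero: "diag_entry 0 r = 0"
  by (cases r rule: dual_index.cases; simp)+

lemma dual_neq: "\<not> isl r \<Longrightarrow> dual_index r \<noteq> r"
  by (cases r rule: dual_index.cases) auto

lemma diag_entry_weight:
  "\<not> isl r \<Longrightarrow> diag_entry (index_weight i) r = (if i = r then 1 else if i = dual_index r then -1 else 0)"
  by (cases i rule: dual_index.cases; cases r rule: dual_index.cases) (auto simp: axis_def)

text \<open>Compare coordinates at \<open>a\<close>. Since \<open>b\<close> is not dual to
  \<open>a\<close>, nothing cancels on the left and the coordinate is positive, so \<open>a'\<close>
  or \<open>b'\<close> must be \<open>a\<close>; injectivity of the weights settles the other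
  index.\<close>

lemma weight_sum_unique:
  assumes sum: "index_weight a + index_weight b = index_weight a' + (index_weight b' :: complex ^ 'n::finite)"
    and ab: "a \<noteq> dual_index b" and a: "\<not> isl a"
  shows "a' = a \<and> b' = b \<or> a' = b \<and> b' = a"
proof -
  have "diag_entry (index_weight a :: complex ^ 'n) a + diag_entry (index_weight b :: complex ^ 'n) a
      = diag_entry (index_weight a' :: complex ^ 'n) a + diag_entry (index_weight b' :: complex ^ 'n) a"
    using sum by (metis diag_entry_add)
  moreover have "b \<noteq> dual_index a" using ab by auto
  ultimately have "a' = a \<or> b' = a"
    unfolding diag_entry_weight[OF a] by (auto split: if_splits)
  then show ?thesis
  proof
    assume "a' = a"
    then show ?thesis using sum index_weight_inj[of b b'] by auto
  next
    assume "b' = a"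
    then show ?thesis using sum index_weight_inj[of b a'] by (auto simp: add.commute)
  qed
qed

lemma weight_diff_unique:
  assumes eq: "index_weight i - index_weight j = index_weight p - (index_weight q :: complex ^ 'n::finite)"
    and "p \<noteq> q"
  shows "(i = p \<and> j = q) \<or> (i = dual_index q \<and> j = dual_index p)"
proof (cases "isl p")
  case False
  have "index_weight p + index_weight (dual_index q) = index_weight i + (index_weight (dual_index j) :: complex ^ 'n)"
    using eq by simp
  from weight_sum_unique[OF this] False \<open>p \<noteq> q\<close> show ?thesis by (auto simp: dual_eq_swap)
next
  case True
  then have q: "\<not> isl (dual_index q)" using \<open>p \<noteq> q\<close> by (cases p; cases q) auto
  have "index_weight (dual_index q) + index_weight p = index_weight i + (index_weight (dual_index j) :: complex ^ 'n)"
    using eq by (simp add: add.commute)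
  from weight_sum_unique[OF this] q \<open>p \<noteq> q\<close> show ?thesis by (auto simp: dual_eq_swap)
qed

lemma gram_sign_dual: "\<not> isl q \<Longrightarrow> gram_sign (dual_index q) * gram_sign q = -1"
  by (cases q rule: dual_index.cases) auto

lemma root_vec_self:
  assumes "p \<noteq> q"
  shows "root_vec p q $ p $ q = (if p = dual_index q then 2 else 1)"
proof (cases "p = dual_index q")
  case True
  then have "\<not> isl q" using assms by (cases q) auto
  then have "mirror_sign p q = 1"
    using gram_sign_dual[of q] by (simp add: True mirror_sign_def super_sign_def)
  then show ?thesis by (simp add: root_vec_nth True)
qed (simp add: root_vec_nth)

lemma root_vec_neq_0: "p \<noteq> q \<Longrightarrow> root_vec p q \<noteq> 0"
  using root_vec_self[of p q] by (auto split: if_splits)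

text \<open>A nonzero weight difference occurs only at (p, q) and at its mirror position, and the
  entries at these two positions determine each other.\<close>

lemma root_space_one_dim:
  assumes "p \<noteq> q" and X: "X \<in> root_space (index_weight p - index_weight q)"
  shows "X = mat_scale (X $ p $ q / root_vec p q $ p $ q) (root_vec p q)"
proof (rule gl_eqI)
  fix i j
  define c where "c = X $ p $ q / root_vec p q $ p $ q"
  have pq: "X $ p $ q = c * root_vec p q $ p $ q"
    using root_vec_self[OF assms(1)] by (simp add: c_def)
  consider "i = p" "j = q" | "i = dual_index q" "j = dual_index p"
    | "X $ i $ j = 0" "root_vec p q $ i $ j = 0"
    using weight_diff_unique[OF _ assms(1), of i j] X root_vec_root_space[of p q]
    unfolding root_space_iff by blast
  then show "X $ i $ j = mat_scale (X $ p $ q / root_vec p q $ p $ q) (root_vec p q) $ i $ j"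
  proof cases
    case 1
    then show ?thesis using pq by (simp add: c_def)
  next
    case 2
    have "X \<in> osp" using X by (rule root_space_osp)
    then show ?thesis
      using 2 pq root_vec_osp[of p q] unfolding osp_iff c_def by (simp add: mult.left_commute)
  qed simp
qed

text \<open>The position and its mirror carry the same root. Choosing between them makes
  \<open>p\<close> an index of the symplectic part, so that the root has a positive coordinate at
  \<open>p\<close>.\<close>

lemma root_space_cases:
  assumes X: "X \<in> root_space \<beta>" "X \<noteq> 0" and "\<beta> \<noteq> 0"
  obtains p q c where "\<not> isl p" "p \<noteq> q" "\<beta> = index_weight p - index_weight q" "c \<noteq> 0"
    "X = mat_scale c (root_vec p q)"
proof -
  obtain i j where nz: "X $ i $ j \<noteq> 0" using X(2) by (metis gl_eqI zero_index)
  then have \<beta>: "\<beta> = index_weight i - index_weight j" using X(1) by (auto simp: root_space_iff)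
  then have "i \<noteq> j" using \<open>\<beta> \<noteq> 0\<close> by auto
  define p where "p = (if isl i then dual_index j else i)"
  define q where "q = (if isl i then dual_index i else j)"
  have "p \<noteq> q" using \<open>i \<noteq> j\<close> by (simp add: p_def q_def)
  moreover have "\<not> isl p" using \<open>i \<noteq> j\<close> by (cases i; cases j) (auto simp: p_def)
  moreover have pq: "\<beta> = index_weight p - index_weight q" by (simp add: \<beta> p_def q_def)
  moreover have "X = mat_scale (X $ p $ q / root_vec p q $ p $ q) (root_vec p q)"
    using root_space_one_dim[OF \<open>p \<noteq> q\<close>] X(1) pq by simp
  moreover from this have "X $ p $ q / root_vec p q $ p $ q \<noteq> 0"
    using X(2) by (metis mat_scale_zero_left)
  ultimately show ?thesis using that by blast
qed

lemma root_space_multiple: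
  assumes "X \<in> root_space \<beta>" "X \<noteq> 0" "Z \<in> root_space \<beta>" "\<beta> \<noteq> 0"
  obtains c where "Z = mat_scale c X"
proof -
  obtain p q c where pq: "p \<noteq> q" "\<beta> = index_weight p - index_weight q" "c \<noteq> 0" "X = mat_scale c (root_vec p q)"
    using root_space_cases[OF assms(1,2,4)] by metis
  define d where "d = Z $ p $ q / root_vec p q $ p $ q"
  have Z: "Z = mat_scale d (root_vec p q)"
    unfolding d_def using root_space_one_dim[OF pq(1)] assms(3) pq(2) by simp
  have "Z = mat_scale (d / c) X"
    unfolding Z pq(4) using pq(3) by (intro gl_eqI) simp
  then show ?thesis using that by blast
qed

lemma sum_single: "(\<And>l. l \<noteq> a \<Longrightarrow> f l = 0) \<Longrightarrow> (\<Sum>l\<in>UNIV. f l) = (f a :: complex)"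
  for f :: "'b::finite \<Rightarrow> complex"
  by (subst sum.mono_neutral_right[of UNIV "{a}"]) auto

text \<open>The bracket lies in a one-dimensional root space, so it is enough that its entry at (r,
  p) does not vanish. The product in the reverse order reaches this entry only if \<open>r\<close>
  is the dual of \<open>p\<close>.\<close>

lemma root_vec_bracket:
  assumes "p \<noteq> q" "r \<noteq> p" "r \<noteq> q"
  obtains c where "c \<noteq> 0" "super_bracket (root_vec r q) (root_vec q p) = mat_scale c (root_vec r p :: 'n::finite gl)"
proof -
  let ?s = "isl r \<noteq> isl q" and ?t = "isl q \<noteq> isl p"
  let ?Z = "super_bracket (root_vec r q) (root_vec q p) :: 'n gl"
  have "(root_vec r q ** root_vec q p) $ r $ p = root_vec r q $ r $ q * root_vec q p $ q $ p"
    unfolding matrix_mult_nth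
    by (rule sum_single) (use root_vec_nonzero[of r q r] in \<open>fastforce simp: assms\<close>)
  moreover have "(root_vec q p ** root_vec r q) $ r $ p
      = (if r = dual_index p then mirror_sign q p * mirror_sign r q else 0)"
  proof -
    have "(root_vec q p ** root_vec r q) $ r $ p
      = root_vec q p $ r $ dual_index q * root_vec r q $ dual_index q $ p"
      unfolding matrix_mult_nth
      by (rule sum_single) (use root_vec_nonzero[of q p r] assms in fastforce)
    also have "\<dots> = (if r = dual_index p then mirror_sign q p * mirror_sign r q else 0)"
      using assms by (auto simp: root_vec_nth)
    finally show ?thesis .
  qed
  moreover have "?Z = root_vec r q ** root_vec q p - mat_scale (super_sign ?s ?t) (root_vec q p ** root_vec r q)"
    using root_vec_part[of r q] root_vec_part[of q p]
    by (intro super_bracket_homogeneous) (auto simp: osp_part_iff)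
  ultimately have eq: "?Z $ r $ p = root_vec r q $ r $ q * root_vec q p $ q $ p
     - super_sign ?s ?t * (if r = dual_index p then mirror_sign q p * mirror_sign r q else 0)"
    by simp
  have nz: "?Z $ r $ p \<noteq> 0"
  proof (cases "r = dual_index p")
    case False
    then show ?thesis using assms by (simp add: eq root_vec_self)
  next
    case True
    then have p: "\<not> isl p" using assms by (cases p) auto
    \<comment> \<open>Here both products contribute to the entry; the sign computation shows that
      the contributions add up and do not cancel.\<close>
    have "mirror_sign q p * mirror_sign (dual_index p) q
        = super_sign ?t (\<not> isl q) * super_sign ?t (\<not> isl p)
          * (gram_sign q * gram_sign q) * (gram_sign (dual_index p) * gram_sign p)"
    proof -
      have t: "(isl (dual_index p) \<noteq> isl q) = ?t" by auto
      show ?thesis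
        unfolding mirror_sign_def t
        by (simp only: mult_minus_left mult_minus_right minus_minus isl_dual ac_simps)
    qed
    also have "\<dots> = - super_sign ?t (\<not> isl q) * super_sign ?t (\<not> isl p)"
      by (simp add: gram_sign_dual[OF p])
    finally have "super_sign ?s ?t * (mirror_sign q p * mirror_sign (dual_index p) q) = -1"
      using p by (cases "isl q") (auto simp: True super_sign_def)
    then show ?thesis
      using assms True unfolding eq by (auto simp: root_vec_self)
  qed
  have "?Z \<in> root_space (index_weight r - index_weight p)"
    using root_space_bracket[OF root_vec_root_space root_vec_root_space root_vec_part root_vec_part, of r q q p]
    by simp
  then have "?Z = mat_scale (?Z $ r $ p / root_vec r p $ r $ p) (root_vec r p)"
    by (rule root_space_one_dim[OF assms(2)])
  moreover have "?Z $ r $ p / root_vec r p $ r $ p \<noteq> 0"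
    using nz root_vec_self[OF assms(2)] by simp
  ultimately show ?thesis using that by blast
qed

text \<open>In the two uses below, \<open>p\<close> and \<open>q\<close> are of the form
  \<open>Inr (Inl _)\<close> or \<open>Inl ()\<close>. The entries computed here then include all
  those at \<open>Inr (Inl l)\<close>, which determine an element of the Cartan subalgebra.\<close>

lemma root_vec_coroot_nth:
  assumes "p \<noteq> q" "p \<noteq> dual_index q" "i \<noteq> dual_index p" "i \<noteq> dual_index q"
  shows "super_bracket (root_vec p q) (root_vec q p) $ i $ i
    = (if i = p then 1 else 0) - super_sign (isl p \<noteq> isl q) (isl p \<noteq> isl q) * (if i = q then 1 else 0)"
proof -
  have m: "(root_vec a b ** root_vec b a) $ i $ i = (if i = a then 1 else 0)"
    if "a \<noteq> b" "b \<noteq> dual_index a" "i \<noteq> dual_index b" for a b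
  proof -
    have "(root_vec a b ** root_vec b a) $ i $ i = root_vec a b $ i $ b * root_vec b a $ b $ i"
      unfolding matrix_mult_nth
      by (rule sum_single) (use root_vec_nonzero[of a b i] that in fastforce)
    also have "\<dots> = (if i = a then 1 else 0)"
      using that root_vec_self[of a b] root_vec_self[of b a] root_vec_nonzero[of a b i b]
      by (auto simp: dual_eq_swap)
    finally show ?thesis .
  qed
  have "super_bracket (root_vec p q) (root_vec q p) = root_vec p q ** root_vec q p
      - mat_scale (super_sign (isl p \<noteq> isl q) (isl q \<noteq> isl p)) (root_vec q p ** root_vec p q)"
    using root_vec_part[of p q] root_vec_part[of q p]
    by (intro super_bracket_homogeneous) (auto simp: osp_part_iff)
  moreover have "q \<noteq> dual_index p" using assms by auto
  ultimately show ?thesis using m[of p q] m[of q p] assms by (auto simp: eq_commute)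
qed


section \<open>The invariant form on the Cartan subalgebra\<close>

lemma finite_sum_closed:
  assumes "P 0" "\<And>a b. P a \<Longrightarrow> P b \<Longrightarrow> P (a + b)" "\<And>i. i \<in> A \<Longrightarrow> P (f i)"
  shows "P (sum f A)"
  using assms(3) by (induction A rule: infinite_finite_induct) (auto intro: assms(1,2))

lemma diag_matrix_sum: "diag_matrix \<mu> = (\<Sum>i\<in>UNIV. mat_scale (\<mu> $ i) (diag_matrix (axis i 1)))"
proof (rule gl_eqI)
  fix i j :: "'a super_index"
  show "diag_matrix \<mu> $ i $ j = (\<Sum>l\<in>UNIV. mat_scale (\<mu> $ l) (diag_matrix (axis l 1))) $ i $ j"
    by (cases i rule: dual_index.cases)
       (auto simp: diag_matrix_nth axis_def sum_negf if_distrib[of "(*) _"] cong: if_cong)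
qed

lemma diag_matrix_add: "diag_matrix (\<mu> + \<nu>) = diag_matrix \<mu> + diag_matrix \<nu>"
  and diag_matrix_smult: "diag_matrix (c *s \<mu>) = mat_scale c (diag_matrix \<mu>)"
proof -
  show "diag_matrix (\<mu> + \<nu>) = diag_matrix \<mu> + diag_matrix \<nu>"
    by (rule gl_eqI) (simp add: diag_matrix_nth diag_entry_add)
  have "diag_entry (c *s \<mu>) i = c * diag_entry \<mu> i" for i
    by (cases i rule: dual_index.cases) auto
  then show "diag_matrix (c *s \<mu>) = mat_scale c (diag_matrix \<mu>)"
    by (intro gl_eqI) (simp add: diag_matrix_nth)
qed

lemma root_space_index_bracket:
  assumes "H \<in> cartan" "X \<in> root_space \<beta>"
  shows "super_bracket H X = mat_scale (weight_eval \<beta> H) X"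
  using assms by (simp add: root_space_def)

text \<open>These coroots form a basis of the Cartan subalgebra. The even coroots of
  \<open>even_coroot\<close> serve to compare the values of the form at different
  \<open>i\<close>.\<close>

lemma odd_coroot:
  "super_bracket (root_vec (Inr (Inl i)) (Inl ())) (root_vec (Inl ()) (Inr (Inl i)))
    = diag_matrix (axis i 1)" (is "?Z = _")
proof -
  have "?Z \<in> cartan"
    unfolding cartan_root_space_zero
    using root_space_bracket[OF root_vec_root_space root_vec_root_space root_vec_part root_vec_part,
        of "Inr (Inl i)" "Inl ()" "Inl ()" "Inr (Inl i)"]
      osp_part_bracket[OF root_vec_part root_vec_part, of "Inr (Inl i)" "Inl ()" "Inl ()" "Inr (Inl i)"]
    by simp
  moreover have "?Z $ Inr (Inl l) $ Inr (Inl l) = axis i 1 $ l" for l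
    by (subst root_vec_coroot_nth) (auto simp: axis_def)
  ultimately show ?thesis by (subst cartan_diag[of ?Z]) (auto simp: vec_lambda_eta)
qed

lemma even_coroot:
  assumes "i \<noteq> j"
  shows "super_bracket (root_vec (Inr (Inl i)) (Inr (Inl j))) (root_vec (Inr (Inl j)) (Inr (Inl i)))
    = diag_matrix (axis i 1 - axis j 1)" (is "?Z = _")
proof -
  have "?Z \<in> cartan"
    unfolding cartan_root_space_zero
    using root_space_bracket[OF root_vec_root_space root_vec_root_space root_vec_part root_vec_part,
        of "Inr (Inl i)" "Inr (Inl j)" "Inr (Inl j)" "Inr (Inl i)"]
      osp_part_bracket[OF root_vec_part root_vec_part, of "Inr (Inl i)" "Inr (Inl j)" "Inr (Inl j)" "Inr (Inl i)"]
    by simp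
  moreover have "(\<chi> l. ?Z $ Inr (Inl l) $ Inr (Inl l)) = axis i 1 - axis j 1"
    unfolding vec_eq_iff using assms
    by (subst root_vec_coroot_nth) (auto simp: axis_def super_sign_def)
  ultimately show ?thesis using cartan_diag[of ?Z] by simp
qed

definition root_norm :: "complex ^ 'n::finite \<Rightarrow> complex" where
  "root_norm \<beta> = (\<Sum>i\<in>UNIV. \<beta> $ i * \<beta> $ i)"

lemma root_norm_weight_diff:
  assumes "\<not> isl p" "\<not> isl q" "p \<noteq> q"
  shows "root_norm (index_weight p - index_weight q) = (if p = dual_index q then 4 else 2)"
proof -
  have ip: "(\<Sum>i\<in>UNIV. index_weight a $ i * index_weight b $ i) = (diag_entry (index_weight b) a :: complex)"
    for a b :: "'a super_index"
    using weight_eval_index[of a "index_weight b"] by (simp add: weight_eval_diag)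
  have "root_norm (index_weight p - index_weight q)
     = (\<Sum>i\<in>UNIV. index_weight p $ i * index_weight p $ i) - 2 * (\<Sum>i\<in>UNIV. index_weight p $ i * index_weight q $ i)
       + (\<Sum>i\<in>UNIV. index_weight q $ i * index_weight q $ i)"
    unfolding root_norm_def sum_distrib_left sum_subtractf[symmetric] sum.distrib[symmetric]
    by (intro sum.cong) (auto simp: algebra_simps)
  then show ?thesis
    using assms by (auto simp: ip diag_entry_weight dual_eq_swap)
qed

lemma root_vec_in_roots:
  assumes "p \<noteq> q"
  shows "index_weight p - index_weight q \<in> roots_of_parity (isl p \<noteq> isl q)"
proof -
  have "root_vec p q \<in> root_space (index_weight p - index_weight q) \<inter> osp_part (isl p \<noteq> isl q)"
    using root_vec_root_space root_vec_part by blast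
  then show ?thesis
    using assms root_vec_neq_0[of p q] index_weight_inj[of p q] unfolding roots_of_parity_def by auto
qed

lemma even_roots_cases:
  assumes "\<beta> \<in> even_roots"
  obtains p q where "\<not> isl p" "\<not> isl q" "p \<noteq> q" "\<beta> = index_weight p - index_weight q"
proof -
  obtain X where X: "\<beta> \<noteq> 0" "X \<in> root_space \<beta>" "X \<in> osp_part False" "X \<noteq> 0"
    using assms by (auto simp: roots_of_parity_def)
  obtain p q c where pq: "\<not> isl p" "p \<noteq> q" "\<beta> = index_weight p - index_weight q" "c \<noteq> 0"
    "X = mat_scale c (root_vec p q)"
    using root_space_cases[OF X(2,4,1)] by metis
  have "X $ p $ q \<noteq> 0" using pq root_vec_self[of p q] by (auto split: if_splits)
  then have "isl p = isl q" using X(3) by (auto simp: osp_part_eq gl_part_eq_iff)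
  then show ?thesis using that pq by blast
qed

section \<open>Consequences of invariance and nondegeneracy\<close>

context
  fixes B :: "'n::finite gl \<Rightarrow> 'n gl \<Rightarrow> complex"
  assumes inv: "invariant_form B"
begin

lemma form_add_left: "X \<in> osp \<Longrightarrow> Y \<in> osp \<Longrightarrow> Z \<in> osp \<Longrightarrow> B (X + Y) Z = B X Z + B Y Z"
  and form_add_right: "X \<in> osp \<Longrightarrow> Y \<in> osp \<Longrightarrow> Z \<in> osp \<Longrightarrow> B X (Y + Z) = B X Y + B X Z"
  using inv[unfolded invariant_form_def, THEN conjunct1] by blast+

lemma form_scale_left: "X \<in> osp \<Longrightarrow> Y \<in> osp \<Longrightarrow> B (mat_scale c X) Y = c * B X Y"
  and form_scale_right: "X \<in> osp \<Longrightarrow> Y \<in> osp \<Longrightarrow> B X (mat_scale c Y) = c * B X Y"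
  using inv[unfolded invariant_form_def, THEN conjunct2, THEN conjunct1] by blast+

lemma form_invariant: "X \<in> osp \<Longrightarrow> Y \<in> osp \<Longrightarrow> Z \<in> osp \<Longrightarrow> B (super_bracket X Y) Z = B X (super_bracket Y Z)"
  using inv[unfolded invariant_form_def, THEN conjunct2, THEN conjunct2, THEN conjunct2, THEN conjunct2, THEN conjunct1] by blast

lemma form_nondeg: "X \<in> osp \<Longrightarrow> (\<And>Y. Y \<in> osp \<Longrightarrow> B X Y = 0) \<Longrightarrow> X = 0"
  using inv[unfolded invariant_form_def, THEN conjunct2, THEN conjunct2, THEN conjunct2, THEN conjunct2, THEN conjunct2] by blast

lemma form_zero_left: "Y \<in> osp \<Longrightarrow> B 0 Y = 0" and form_zero_right: "Y \<in> osp \<Longrightarrow> B Y 0 = 0"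
  using form_scale_left[of Y Y 0] form_scale_right[of Y Y 0] by auto

lemma form_sum_left:
  assumes "\<And>i. i \<in> A \<Longrightarrow> f i \<in> osp" "Y \<in> osp"
  shows "B (sum f A) Y = (\<Sum>i\<in>A. B (f i) Y)"
  using assms(1)
proof (induction A rule: infinite_finite_induct)
  case (insert a A)
  have "sum f A \<in> osp" using insert by (intro finite_sum_closed[of "\<lambda>X. X \<in> osp"] osp_zero osp_add) auto
  then show ?case using insert assms(2) by (simp add: form_add_left)
qed (auto simp: form_zero_left assms(2))

lemma form_sum_right:
  assumes "\<And>i. i \<in> A \<Longrightarrow> f i \<in> osp" "Y \<in> osp"
  shows "B Y (sum f A) = (\<Sum>i\<in>A. B Y (f i))"
  using assms(1)
proof (induction A rule: infinite_finite_induct)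
  case (insert a A)
  have "sum f A \<in> osp" using insert by (intro finite_sum_closed[of "\<lambda>X. X \<in> osp"] osp_zero osp_add) auto
  then show ?case using insert assms(2) by (simp add: form_add_right)
qed (auto simp: form_zero_right assms(2))

text \<open>Moving a Cartan element \<open>H\<close> across the form multiplies \<open>B X Y\<close>
  by the value of \<beta> + \<gamma> at \<open>H\<close> and must give 0.\<close>

lemma form_root_spaces:
  assumes X: "X \<in> root_space \<beta>" "X \<in> osp_part s" and Y: "Y \<in> root_space \<gamma>" and "\<beta> + \<gamma> \<noteq> 0"
  shows "B X Y = 0"
proof -
  obtain H where H: "H \<in> cartan" "weight_eval (\<beta> + \<gamma>) H \<noteq> 0"
    using weight_nonzeroE[OF assms(4)] by blast
  have "super_bracket X H = mat_scale (-1) (super_bracket H X)"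
    using super_bracket_swap[OF cartan_osp_part[OF H(1)] X(2)] by (simp add: super_sign_def)
  also have "\<dots> = mat_scale (- weight_eval \<beta> H) X"
    using root_space_index_bracket[OF H(1) X(1)] by (auto intro: gl_eqI)
  finally have "B (super_bracket X H) Y = - weight_eval \<beta> H * B X Y"
    using X Y by (simp add: form_scale_left root_space_osp)
  moreover have "B X (super_bracket H Y) = weight_eval \<gamma> H * B X Y"
    using X Y root_space_index_bracket[OF H(1) Y] by (simp add: form_scale_right root_space_osp)
  moreover have "B (super_bracket X H) Y = B X (super_bracket H Y)"
    using X Y H by (intro form_invariant) (auto simp: root_space_osp cartan_osp)
  ultimately have "weight_eval (\<beta> + \<gamma>) H * B X Y = 0"
    by (simp add: weight_eval_add algebra_simps)
  then show ?thesis using H(2) by simp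
qed

lemma form_coroot:
  assumes X: "X \<in> root_space \<beta>" and Y: "Y \<in> root_space (- \<beta>)" "Y \<in> osp_part t" and H: "H \<in> cartan"
  shows "B (super_bracket X Y) H = weight_eval \<beta> H * B X Y"
proof -
  have "super_bracket Y H = mat_scale (-1) (super_bracket H Y)"
    using super_bracket_swap[OF cartan_osp_part[OF H(1)] Y(2)] by (simp add: super_sign_def)
  also have "\<dots> = mat_scale (weight_eval \<beta> H) Y"
    using root_space_index_bracket[OF H(1) Y(1)] by (auto intro: gl_eqI simp: weight_eval_minus)
  finally have "B X (super_bracket Y H) = weight_eval \<beta> H * B X Y"
    using X Y by (simp add: form_scale_right root_space_osp)
  then show ?thesis
    using X Y H by (simp add: form_invariant root_space_osp cartan_osp)
qed

text \<open>Invariance makes each odd coroot a multiple of the corresponding coordinate functional.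
  The coroot of an even root vector with weight difference of two coordinates forces all these
  multiples to be equal.\<close>

lemma cartan_form:
  obtains c where "c \<noteq> 0" "\<And>\<mu> H. H \<in> cartan \<Longrightarrow> B (diag_matrix \<mu>) H = c * weight_eval \<mu> H"
proof -
  define b where "b i = B (root_vec (Inr (Inl i)) (Inl ())) (root_vec (Inl ()) (Inr (Inl i)))" for i
  have b: "B (diag_matrix (axis i 1)) H = weight_eval (axis i 1) H * b i" if "H \<in> cartan" for i H
  proof -
    have "B (super_bracket (root_vec (Inr (Inl i)) (Inl ())) (root_vec (Inl ()) (Inr (Inl i)))) H
      = weight_eval (axis i 1) H * b i"
      unfolding b_def
      by (rule form_coroot[OF _ _ root_vec_part that])
         (use root_vec_root_space[of "Inr (Inl i)" "Inl ()"] root_vec_root_space[of "Inl ()" "Inr (Inl i)"] in simp_all)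
    then show ?thesis unfolding odd_coroot .
  qed
  have same: "b i = b j" for i j
  proof (cases "i = j")
    case False
    define d where "d = B (root_vec (Inr (Inl i)) (Inr (Inl j))) (root_vec (Inr (Inl j)) (Inr (Inl i)))"
    have d: "B (diag_matrix (axis i 1 - axis j 1)) H = weight_eval (axis i 1 - axis j 1) H * d" if "H \<in> cartan" for H
    proof -
      have "B (super_bracket (root_vec (Inr (Inl i)) (Inr (Inl j))) (root_vec (Inr (Inl j)) (Inr (Inl i)))) H
        = weight_eval (axis i 1 - axis j 1) H * d"
        unfolding d_def
        by (rule form_coroot[OF _ _ root_vec_part that])
           (use root_vec_root_space[of "Inr (Inl i)" "Inr (Inl j)"] root_vec_root_space[of "Inr (Inl j)" "Inr (Inl i)"] in simp_all)
      then show ?thesis unfolding even_coroot[OF False] .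
    qed
    have "B (diag_matrix (axis i 1 - axis j 1)) H
        = B (diag_matrix (axis i 1)) H - B (diag_matrix (axis j 1)) H" if "H \<in> cartan" for H
    proof -
      have "diag_matrix (axis i 1 - axis j 1) = diag_matrix (axis i 1) + mat_scale (-1) (diag_matrix (axis j 1))"
        by (rule gl_eqI) (simp add: diag_matrix_nth diag_entry_diff)
      then show ?thesis
        using that by (simp add: form_add_left form_scale_left osp_scale cartan_osp diag_matrix_cartan)
    qed
    \<comment> \<open>Testing on the two coordinate directions gives \<open>b i = d\<close> and
      \<open>b j = d\<close>.\<close>
    from this[OF diag_matrix_cartan[of "axis i 1"]] this[OF diag_matrix_cartan[of "axis j 1"]]
    show ?thesis using False
      by (simp add: b d diag_matrix_cartan weight_eval_axis) (simp add: axis_def)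
  qed auto
  obtain i0 :: 'n where True by simp
  define c where "c = b i0"
  have form: "B (diag_matrix \<mu>) H = c * weight_eval \<mu> H" if H: "H \<in> cartan" for \<mu> H
  proof -
    obtain \<nu> where \<nu>: "H = diag_matrix \<nu>" using cartan_cases[OF H] by blast
    have "B (diag_matrix \<mu>) H = (\<Sum>i\<in>UNIV. \<mu> $ i * (weight_eval (axis i 1) H * c))"
      using H
      by (subst diag_matrix_sum, subst form_sum_left)
         (auto simp: osp_scale cartan_osp diag_matrix_cartan form_scale_left c_def b
            intro!: sum.cong same)
    also have "\<dots> = c * weight_eval \<mu> H"
      by (simp add: \<nu> weight_eval_diag axis_def sum_distrib_left algebra_simps if_distrib[of "(*) _"] cong: if_cong)
    finally show ?thesis .
  qed
  have "c \<noteq> 0"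
  proof
    \<comment> \<open>Then \<open>H\<close> would be orthogonal to the Cartan subalgebra, and by
      weights to all root vectors, hence to all of osp.\<close>
    assume c: "c = 0"
    define H where "H = diag_matrix (axis i0 1)"
    have H: "H \<in> cartan" by (simp add: H_def diag_matrix_cartan)
    have "H = 0"
    proof (rule form_nondeg[OF cartan_osp[OF H]])
      fix Y :: "'n gl" assume Y: "Y \<in> osp"
      have "B H (root_vec p q) = 0" for p q :: "'n super_index"
      proof (cases "p = q")
        case True
        then have "root_vec p q \<in> cartan"
          using root_vec_root_space[of p q] root_vec_part[of p q] by (simp add: cartan_root_space_zero)
        then show ?thesis using form[of "root_vec p q"] by (simp add: H_def c)
      next
        case False
        then have "0 + (index_weight p - index_weight q) \<noteq> (0 :: complex ^ 'n)"
          using index_weight_inj[of p q] by auto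
        then show ?thesis
          using form_root_spaces[OF _ _ root_vec_root_space] H cartan_root_space_zero by metis
      qed
      then have "B H (mat_scale (Y $ p $ q / 2) (root_vec p q)) = 0" for p q :: "'n super_index"
        using H by (simp add: form_scale_right root_vec_osp cartan_osp)
      moreover have "(\<Sum>q\<in>UNIV. mat_scale (Y $ p $ q / 2) (root_vec p q)) \<in> osp" for p
        by (intro finite_sum_closed[of "\<lambda>X. X \<in> osp"] osp_zero osp_add osp_scale root_vec_osp)
      ultimately have "B H (\<Sum>p\<in>UNIV. \<Sum>q\<in>UNIV. mat_scale (Y $ p $ q / 2) (root_vec p q)) = 0"
        using H by (simp add: form_sum_right root_vec_osp cartan_osp osp_scale)
      then show "B H Y = 0" using osp_expansion[OF Y] by simp
    qed
    then have "H $ Inr (Inl i0) $ Inr (Inl i0) = 0" by simp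
    then show False by (simp add: H_def diag_matrix_nth axis_def)
  qed
  with form that show ?thesis by blast
qed

lemma t_vec_diag:
  obtains c where "c \<noteq> 0" "\<And>\<mu>. t_vec B \<mu> = diag_matrix (c *s \<mu>)"
    "\<And>\<mu> H. H \<in> cartan \<Longrightarrow> B (t_vec B \<mu>) H = weight_eval \<mu> H"
proof -
  obtain c where c: "c \<noteq> 0" "\<And>\<mu> H. H \<in> cartan \<Longrightarrow> B (diag_matrix \<mu>) H = c * weight_eval \<mu> H"
    using cartan_form by blast
  have "t_vec B \<mu> = diag_matrix ((1/c) *s \<mu>)" for \<mu>
    unfolding t_vec_def
  proof (rule the_equality)
    show "diag_matrix ((1/c) *s \<mu>) \<in> cartan \<and> (\<forall>H\<in>cartan. weight_eval \<mu> H = B (diag_matrix ((1/c) *s \<mu>)) H)"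
      using c by (simp add: diag_matrix_cartan weight_eval_smult)
  next
    fix T assume T: "T \<in> cartan \<and> (\<forall>H\<in>cartan. weight_eval \<mu> H = B T H)"
    then obtain \<nu> where \<nu>: "T = diag_matrix \<nu>" using cartan_cases by blast
    have "\<mu> = c *s \<nu>"
      by (rule weight_eqI) (use T \<nu> c in \<open>simp add: weight_eval_smult\<close>)
    then show "T = diag_matrix ((1/c) *s \<mu>)" using c(1) by (simp add: \<nu> vector_smult_assoc)
  qed
  then show ?thesis
    using that[of "1/c"] c by (simp add: weight_eval_smult)
qed

lemma t_vec_cartan: "t_vec B \<mu> \<in> cartan"
proof -
  obtain c where c: "c \<noteq> 0" "\<And>\<mu>. t_vec B \<mu> = diag_matrix (c *s \<mu>)"
    "\<And>\<mu> H. H \<in> cartan \<Longrightarrow> B (t_vec B \<mu>) H = weight_eval \<mu> H" by (rule t_vec_diag) blast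
  from c(2) show ?thesis by (simp add: diag_matrix_cartan)
qed

lemma t_vec_form: "H \<in> cartan \<Longrightarrow> B (t_vec B \<mu>) H = weight_eval \<mu> H"
  by (rule t_vec_diag) blast

lemma t_vec_add: "t_vec B (\<mu> + \<nu>) = t_vec B \<mu> + t_vec B \<nu>"
proof -
  obtain c where c: "c \<noteq> 0" "\<And>\<mu>. t_vec B \<mu> = diag_matrix (c *s \<mu>)"
    "\<And>\<mu> H. H \<in> cartan \<Longrightarrow> B (t_vec B \<mu>) H = weight_eval \<mu> H" by (rule t_vec_diag) blast
  from c(2) show ?thesis by (simp add: vector_add_ldistrib diag_matrix_add)
qed

lemma t_vec_smult: "t_vec B (a *s \<mu>) = mat_scale a (t_vec B \<mu>)"
proof -
  obtain c where c: "c \<noteq> 0" "\<And>\<mu>. t_vec B \<mu> = diag_matrix (c *s \<mu>)"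
    "\<And>\<mu> H. H \<in> cartan \<Longrightarrow> B (t_vec B \<mu>) H = weight_eval \<mu> H" by (rule t_vec_diag) blast
  from c(2) show ?thesis by (simp add: diag_matrix_smult[symmetric] vector_smult_assoc mult.commute)
qed

lemma t_vec_eq_0:
  assumes "t_vec B \<mu> = 0"
  shows "\<mu> = 0"
proof (rule weight_eqI)
  fix H :: "'n gl" assume H: "H \<in> cartan"
  show "weight_eval \<mu> H = weight_eval 0 H"
    using t_vec_form[OF H, of \<mu>] form_zero_left[OF cartan_osp[OF H]] by (simp add: assms)
qed

lemma t_vec_surj:
  assumes "H \<in> cartan" obtains \<mu> where "H = t_vec B \<mu>"
proof -
  obtain c where c: "c \<noteq> 0" "\<And>\<mu>. t_vec B \<mu> = diag_matrix (c *s \<mu>)"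
    "\<And>\<mu> H. H \<in> cartan \<Longrightarrow> B (t_vec B \<mu>) H = weight_eval \<mu> H" by (rule t_vec_diag) blast
  obtain \<mu> where "H = diag_matrix \<mu>" using cartan_cases[OF assms] by blast
  then have "H = t_vec B ((1/c) *s \<mu>)" using c by (simp add: vector_smult_assoc)
  then show ?thesis using that by blast
qed

text \<open>The form on the dual of the Cartan subalgebra is a multiple of the standard one, for which an
  even root \<open>\<plusminus>\<delta>\<^sub>i \<plusminus> \<delta>\<^sub>j\<close> has norm 2 and \<open>\<plusminus>2\<delta>\<^sub>i\<close> has norm 4.\<close>

lemma long_root:
  assumes "\<not> isl p"
  shows "2 *s index_weight p \<in> long_roots B"
proof -
  obtain c where c: "c \<noteq> 0" "\<And>\<mu>. t_vec B \<mu> = diag_matrix (c *s \<mu>)"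
    "\<And>\<mu> H. H \<in> cartan \<Longrightarrow> B (t_vec B \<mu>) H = weight_eval \<mu> H" by (rule t_vec_diag) blast
  have dual: "dual_form B \<mu> \<mu> = c * root_norm \<mu>" for \<mu>
    unfolding dual_form_def
    by (subst c(3)) (auto simp: t_vec_cartan diag_matrix_cartan c(2) weight_eval_diag root_norm_def sum_distrib_left algebra_simps)
  have two: "2 *s index_weight p = index_weight p - (index_weight (dual_index p) :: complex ^ 'n)"
    by (simp add: vec_eq_iff)
  have p: "p \<noteq> dual_index p" using dual_neq[OF assms] by metis
  have "2 *s index_weight p \<in> even_roots"
    unfolding two using root_vec_in_roots[OF p] by simp
  moreover have "cmod (dual_form B \<beta> \<beta>) \<le> cmod (dual_form B (2 *s index_weight p) (2 *s index_weight p))"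
    if even: "\<beta> \<in> even_roots" for \<beta>
  proof -
    obtain q r where "\<not> isl q" "\<not> isl r" "q \<noteq> r" "\<beta> = index_weight q - index_weight r"
      using even_roots_cases[OF even] by blast
    then have "cmod (root_norm \<beta>) \<le> 4" by (simp add: root_norm_weight_diff)
    moreover have "root_norm (2 *s index_weight p :: complex ^ 'n) = 4"
      unfolding two using root_norm_weight_diff[of p "dual_index p"] p assms by simp
    ultimately show ?thesis by (simp add: dual norm_mult mult_left_mono)
  qed
  ultimately show ?thesis by (simp add: long_roots_def)
qed

end

section \<open>Words in the modes of root vectors\<close>

lemma loop_add: "loop (a + b) m = loop a m + loop b m"
  by (simp add: loop_def single_add)

lemma loop_zero [simp]: "loop 0 m = 0"
  by (simp add: loop_def zero_prod_def)

lemma loop_scale: "loop (mat_scale c a) m = aff_scale c (loop a m)"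
  by (simp add: loop_def aff_scale_def map_single)

lemma loop_aff: "a \<in> osp \<Longrightarrow> loop a m \<in> aff_alg"
  by (auto simp: loop_def aff_alg_def lookup_single when_def osp_zero)

lemma loop_aff_part: "a \<in> osp_part s \<Longrightarrow> loop a m \<in> aff_part s"
  by (auto simp: loop_def aff_part_def lookup_single when_def osp_part_zero)

lemma central_aff_part: "(0, z) \<in> aff_part False"
  by (simp add: aff_part_def osp_part_zero)

lemma aff_add: "y \<in> aff_alg \<Longrightarrow> y' \<in> aff_alg \<Longrightarrow> y + y' \<in> aff_alg"
  and aff_zero: "0 \<in> aff_alg"
  by (auto simp: aff_alg_def lookup_add osp_add osp_zero zero_prod_def)

lemma super_bracket_zero: "super_bracket 0 b = 0" "super_bracket a 0 = 0"
  by (auto simp: super_bracket_def gl_part_zero)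

lemma aff_bracket_loop:
  assumes "invariant_form B" "a \<in> osp" "b \<in> osp"
  shows "aff_bracket B (loop a m) (loop b p)
    = loop (super_bracket a b) (m + p) + (0, if m + p = 0 then of_int m * B a b else 0)"
  using assms
  by (auto simp: aff_bracket_def loop_def super_bracket_zero form_zero_left form_zero_right)

lemma aff_decompose:
  "(X, z) = (\<Sum>m\<in>Poly_Mapping.keys X. loop (Poly_Mapping.lookup X m) m) + (0, z)"
proof -
  have "fst (\<Sum>m\<in>Poly_Mapping.keys X. loop (Poly_Mapping.lookup X m) m) = X"
  proof (rule poly_mapping_eqI)
    fix i
    have "Poly_Mapping.lookup (fst (\<Sum>m\<in>Poly_Mapping.keys X. loop (Poly_Mapping.lookup X m) m)) i
       = (\<Sum>m\<in>Poly_Mapping.keys X. if m = i then Poly_Mapping.lookup X m else 0)"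
      by (simp add: fst_sum lookup_sum loop_def lookup_single when_def)
    also have "\<dots> = Poly_Mapping.lookup X i"
      by (simp add: in_keys_iff)
    finally show "Poly_Mapping.lookup (fst (\<Sum>m\<in>Poly_Mapping.keys X. loop (Poly_Mapping.lookup X m) m)) i
       = Poly_Mapping.lookup X i" .
  qed
  moreover have "snd (\<Sum>m\<in>Poly_Mapping.keys X. loop (Poly_Mapping.lookup X m) m) = 0"
    by (simp add: snd_sum loop_def)
  ultimately show ?thesis by (simp add: prod_eq_iff)
qed

locale affine_vertex_superalgebra = vertex_superalgebra smul V Y vac
  for smul :: "complex \<Rightarrow> 'v::ab_group_add \<Rightarrow> 'v"
    and V :: "bool \<Rightarrow> 'v set" and Y :: "'v \<Rightarrow> int \<Rightarrow> 'v \<Rightarrow> 'v" and vac :: 'v +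
  fixes B :: "'n::finite gl \<Rightarrow> 'n gl \<Rightarrow> complex" and k :: complex and \<rho> :: "'n aff \<Rightarrow> 'v \<Rightarrow> 'v"
  assumes form: "invariant_form B"
    and module: "universal_affine_module B k smul \<rho> vac"
    and current_part: "a \<in> osp_part s \<Longrightarrow> \<rho> (loop a (-1)) vac \<in> V s"
    and current_field: "a \<in> osp \<Longrightarrow> Y (\<rho> (loop a (-1)) vac) m = \<rho> (loop a m)"
begin

sublocale induced: induced_module aff_alg aff_part aff_scale "aff_bracket B"
    aff_nonneg "level_character k" smul \<rho> vac
  using module by (simp add: universal_affine_module_def)

abbreviation mode :: "'n gl \<Rightarrow> int \<Rightarrow> 'v \<Rightarrow> 'v" where
  "mode a m \<equiv> \<rho> (loop a m)"

abbreviation current :: "'n gl \<Rightarrow> 'v" where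
  "current a \<equiv> mode a (-1) vac"

lemma aff_act_add_right: "y \<in> aff_alg \<Longrightarrow> \<rho> y (v + w) = \<rho> y v + \<rho> y w"
  and aff_act_smul_right: "y \<in> aff_alg \<Longrightarrow> \<rho> y (smul c v) = smul c (\<rho> y v)"
  using induced.act_linear by (auto simp: Vector_Spaces.linear_iff)

lemma aff_act_zero_left: "\<rho> 0 v = 0"
  using induced.act_add[OF aff_zero aff_zero, of v] by simp

lemma aff_act_zero_right: "y \<in> aff_alg \<Longrightarrow> \<rho> y 0 = 0"
  using aff_act_smul_right[of y 0 0] by simp

lemma mode_add: "a \<in> osp \<Longrightarrow> b \<in> osp \<Longrightarrow> mode (a + b) m v = mode a m v + mode b m v"
  by (simp add: loop_add induced.act_add loop_aff)

lemma mode_scale: "a \<in> osp \<Longrightarrow> mode (mat_scale c a) m v = smul c (mode a m v)"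
  by (simp add: loop_scale induced.act_scale loop_aff)

lemma mode_add_right: "a \<in> osp \<Longrightarrow> mode a m (v + w) = mode a m v + mode a m w"
  and mode_smul_right: "a \<in> osp \<Longrightarrow> mode a m (smul c v) = smul c (mode a m v)"
  and mode_zero_right: "a \<in> osp \<Longrightarrow> mode a m 0 = 0"
  by (simp_all add: aff_act_add_right aff_act_smul_right aff_act_zero_right loop_aff)

lemma mode_vac: "a \<in> osp \<Longrightarrow> m \<ge> 0 \<Longrightarrow> mode a m vac = 0"
  using creation(1)[of m "current a"] by (simp add: current_field)

lemma mode_truncation: "a \<in> osp \<Longrightarrow> \<exists>N. \<forall>m\<ge>N. mode a m v = 0"
  using truncation[of "current a" v] by (simp add: current_field)

lemma central_vac: "\<rho> (0, z) vac = smul (k * z) vac"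
  using induced.act_vac[of "(0, z)"]
  by (simp add: aff_nonneg_def aff_alg_def osp_zero level_character_def)

text \<open>The central element still appears here as an operator. Its value is known so far only on
  the vacuum, which suffices for the products of two currents.\<close>

lemma mode_comm_central:
  assumes a: "a \<in> osp_part s" and b: "b \<in> osp_part t"
  shows "mode a m (mode b p v) = smul (super_sign s t) (mode b p (mode a m v))
    + mode (super_bracket a b) (m + p) v
    + \<rho> (0, if m + p = 0 then of_int m * B a b else 0) v"
proof -
  have osp: "a \<in> osp" "b \<in> osp" "super_bracket a b \<in> osp"
    using osp_part_osp a b osp_part_bracket by blast+
  have z: "(0, z) \<in> aff_alg" for z by (simp add: aff_alg_def osp_zero)
  show ?thesis
    using induced.act_bracket[OF loop_aff_part[OF a, of m] loop_aff_part[OF b, of p], of v]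
    by (simp add: aff_bracket_loop form osp induced.act_add loop_aff z algebra_simps)
qed

lemma current_product_0:
  assumes "a \<in> osp_part s" "b \<in> osp_part t"
  shows "mode a 0 (current b) = current (super_bracket a b)"
  using mode_comm_central[OF assms, of 0 "-1" vac] assms
  by (simp add: mode_vac osp_part_osp mode_zero_right central_vac)

lemma current_product_pos:
  assumes "a \<in> osp_part s" "b \<in> osp_part t" "m > 0"
  shows "mode a m (current b) = (if m = 1 then smul (k * B a b) vac else 0)"
  using mode_comm_central[OF assms(1,2), of m "-1" vac] assms osp_part_bracket[OF assms(1,2)]
  by (simp add: mode_vac osp_part_osp mode_zero_right central_vac)

text \<open>The commutator formula needs only the products of the two currents, of which those of
  index 0 and 1 can be nonzero. They involve the central element on the vacuum only, so its
  contribution becomes the scalar \<open>k\<close> on every vector.\<close>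

lemma mode_comm:
  assumes a: "a \<in> osp_part s" and b: "b \<in> osp_part t"
  shows "mode a m (mode b p v) = smul (super_sign s t) (mode b p (mode a m v))
    + mode (super_bracket a b) (m + p) v
    + (if m + p = 0 then smul (of_int m * (k * B a b)) v else 0)"
proof -
  have osp: "a \<in> osp" "b \<in> osp" "super_bracket a b \<in> osp"
    using osp_part_osp a b osp_part_bracket by blast+
  have "mode a m (mode b p v) - smul (super_sign s t) (mode b p (mode a m v))
     = Sum_any (\<lambda>i::nat. smul (of_int m gchoose i) (Y (mode a (int i) (current b)) (m + p - int i) v))"
    using Y_comm[OF current_part[OF a] current_part[OF b], of m p v]
    by (simp only: current_field osp)
  also have "\<dots> = (\<Sum>i\<in>{0,1}. smul (of_int m gchoose i) (Y (mode a (int i) (current b)) (m + p - int i) v))"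
  proof (rule Sum_any.expand_superset)
    show "{i::nat. smul (of_int m gchoose i) (Y (mode a (int i) (current b)) (m + p - int i) v) \<noteq> 0} \<subseteq> {0,1}"
    proof
      fix i :: nat assume i: "i \<in> {i. smul (of_int m gchoose i) (Y (mode a (int i) (current b)) (m + p - int i) v) \<noteq> 0}"
      show "i \<in> {0,1}"
      proof (rule ccontr)
        assume "i \<notin> {0,1}"
        then have "mode a (int i) (current b) = 0"
          using current_product_pos[OF a b, of "int i"] by simp
        then show False using i by simp
      qed
    qed
  qed simp
  also have "\<dots> = mode (super_bracket a b) (m + p) v
     + (if m + p = 0 then smul (of_int m * (k * B a b)) v else 0)"
    using current_product_pos[OF a b, of 1]
    by (simp add: current_product_0[OF a b] current_field osp Y_smul_left vac_left)
  finally show ?thesis by (simp add: algebra_simps)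
qed

end

section \<open>Words, their weights and their span\<close>

context affine_vertex_superalgebra
begin

text \<open>A letter records a mode together with the weight assigned to it, because the zero matrix has
  no weight of its own.\<close>

definition letters :: "('n gl \<times> (complex ^ 'n) \<times> int) set" where
  "letters = {(a, \<beta>, m). a \<in> root_space \<beta> \<and> (\<exists>s. a \<in> osp_part s)}"

definition word_act :: "('n gl \<times> (complex ^ 'n) \<times> int) list \<Rightarrow> 'v \<Rightarrow> 'v" where
  "word_act = foldr (\<lambda>(a, \<beta>, m). mode a m)"

definition word_weight :: "('n gl \<times> (complex ^ 'n) \<times> int) list \<Rightarrow> complex ^ 'n" where
  "word_weight w = sum_list (map (\<lambda>(a, \<beta>, m). \<beta>) w)"

lemma word_act_simps [simp]:
  "word_act [] v = v" "word_act ((a, \<beta>, m) # w) v = mode a m (word_act w v)"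
  "word_act (u @ w) v = word_act u (word_act w v)"
  by (simp_all add: word_act_def)

lemma word_weight_simps [simp]:
  "word_weight [] = 0" "word_weight ((a, \<beta>, m) # w) = \<beta> + word_weight w"
  "word_weight (u @ w) = word_weight u + word_weight w"
  by (simp_all add: word_weight_def)

lemma letters_osp: "(a, \<beta>, m) \<in> letters \<Longrightarrow> a \<in> osp"
  by (auto simp: letters_def root_space_osp)

lemma word_act_add: "w \<in> lists letters \<Longrightarrow> word_act w (u + v) = word_act w u + word_act w v"
  by (induction w) (auto simp: letters_osp mode_add_right)

lemma word_act_smul: "w \<in> lists letters \<Longrightarrow> word_act w (smul c v) = smul c (word_act w v)"
  by (induction w) (auto simp: letters_osp mode_smul_right)

lemma central_mode:
  assumes "a \<in> osp_part s"
  shows "\<rho> (0, z) (mode a m v) = mode a m (\<rho> (0, z) v)"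
  using induced.act_bracket[OF central_aff_part loop_aff_part[OF assms], of z m v]
  by (simp add: aff_bracket_def loop_def super_sign_def aff_act_zero_left flip: zero_prod_def)

lemma central_word:
  "w \<in> lists letters \<Longrightarrow> \<rho> (0, z) (word_act w vac) = smul (k * z) (word_act w vac)"
proof (induction w)
  case Nil
  then show ?case by (simp add: central_vac)
next
  case (Cons l w)
  obtain a \<beta> m where l: "l = (a, \<beta>, m)" by (cases l)
  then obtain s where "a \<in> osp_part s" using Cons.prems by (auto simp: letters_def)
  then show ?case
    using Cons by (simp add: l central_mode mode_smul_right osp_part_osp)
qed

definition words_span :: "'v set" where
  "words_span = span {word_act w vac | w. w \<in> lists letters}"

lemma word_in_span: "w \<in> lists letters \<Longrightarrow> word_act w vac \<in> words_span"
  unfolding words_span_def by (intro span_base) auto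

lemma words_span_subspace: "subspace words_span"
  unfolding words_span_def by (rule subspace_span)

lemma linear_preserves_words_span:
  assumes "\<And>u v. f (u + v) = f u + f v" "\<And>c v. f (smul c v) = smul c (f v)"
    and "\<And>w. w \<in> lists letters \<Longrightarrow> f (word_act w vac) \<in> words_span"
    and "v \<in> words_span"
  shows "f v \<in> words_span"
  using assms(4) unfolding words_span_def
proof (induction rule: span_induct)
  case base
  have "f 0 = 0" using assms(2)[of 0 0] by simp
  then show ?case
    using assms(1,2) words_span_subspace unfolding words_span_def
    by (intro subspaceI) (auto simp: subspace_0 subspace_add subspace_scale)
next
  case (step x)
  then show ?case using assms(3) by (auto simp: words_span_def)
qed

lemma letter_words_span:
  assumes "(a, \<beta>, m) \<in> letters" "v \<in> words_span"
  shows "mode a m v \<in> words_span"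
proof (rule linear_preserves_words_span[OF _ _ _ assms(2)])
  fix w assume "w \<in> lists letters"
  then have "word_act ((a, \<beta>, m) # w) vac \<in> words_span"
    using assms(1) by (intro word_in_span) auto
  then show "mode a m (word_act w vac) \<in> words_span" by simp
qed (auto simp: letters_osp[OF assms(1)] mode_add_right mode_smul_right)

lemma root_vec_letter: "(mat_scale c (root_vec p q), index_weight p - index_weight q, m) \<in> letters"
  unfolding letters_def
  using root_space_scale[OF root_vec_root_space] osp_part_scale[OF root_vec_part] by blast

lemma mode_sum:
  assumes "\<And>i. i \<in> A \<Longrightarrow> f i \<in> osp"
  shows "mode (sum f A) m v = (\<Sum>i\<in>A. mode (f i) m v) \<and> sum f A \<in> osp"
  using assms
  by (induction A rule: infinite_finite_induct) (auto simp: aff_act_zero_left osp_zero mode_add osp_add)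

lemma mode_words_span:
  assumes "a \<in> osp" "v \<in> words_span"
  shows "mode a m v \<in> words_span"
proof -
  have 1: "(\<Sum>q\<in>UNIV. mat_scale (a $ p $ q / 2) (root_vec p q)) \<in> osp" for p
    by (rule conjunct2[OF mode_sum]) (simp add: osp_scale root_vec_osp)
  have "mode a m v = (\<Sum>p\<in>UNIV. \<Sum>q\<in>UNIV. mode (mat_scale (a $ p $ q / 2) (root_vec p q)) m v)"
    by (subst osp_expansion[OF assms(1)])
       (simp add: mode_sum 1 osp_scale root_vec_osp)
  also have "\<dots> \<in> words_span"
    by (intro subspace_sum[OF words_span_subspace] letter_words_span[OF root_vec_letter assms(2)])
  finally show ?thesis .
qed

lemma aff_words_span:
  assumes "y \<in> aff_alg" "v \<in> words_span"
  shows "\<rho> y v \<in> words_span"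
proof -
  obtain X z where y: "y = (X, z)" by (cases y)
  have X: "Poly_Mapping.lookup X m \<in> osp" for m using assms(1) by (simp add: y aff_alg_def)
  have z: "(0, z) \<in> aff_alg" by (simp add: aff_alg_def osp_zero)
  have sum: "\<rho> (\<Sum>m\<in>A. loop (Poly_Mapping.lookup X m) m) v = (\<Sum>m\<in>A. mode (Poly_Mapping.lookup X m) m v)
      \<and> (\<Sum>m\<in>A. loop (Poly_Mapping.lookup X m) m) \<in> aff_alg" for A
    by (induction A rule: infinite_finite_induct)
       (auto simp: aff_act_zero_left aff_zero induced.act_add aff_add loop_aff X)
  have "\<rho> (0, z) v \<in> words_span"
    by (rule linear_preserves_words_span[OF _ _ _ assms(2)])
       (auto simp: aff_act_add_right aff_act_smul_right z central_word word_in_span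
          subspace_scale[OF words_span_subspace])
  moreover have "(\<Sum>m\<in>Poly_Mapping.keys X. mode (Poly_Mapping.lookup X m) m v) \<in> words_span"
    by (intro subspace_sum[OF words_span_subspace] mode_words_span X assms(2))
  ultimately show ?thesis
    unfolding y by (subst aff_decompose)
      (simp add: induced.act_add sum z subspace_add[OF words_span_subspace])
qed

lemma words_span_UNIV: "words_span = UNIV"
proof -
  have "foldr \<rho> w vac \<in> words_span" if "w \<in> lists aff_alg" for w
    using that by (induction w) (use word_in_span[of "[]"] aff_words_span in auto)
  then have "span {foldr \<rho> w vac | w. w \<in> lists aff_alg} \<subseteq> words_span"
    by (intro span_minimal words_span_subspace) auto
  then show ?thesis using induced.cyclic by blast
qed

lemma cartan_word:
  assumes "H \<in> cartan"
  shows "w \<in> lists letters \<Longrightarrow>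
    mode H 0 (word_act w vac) = smul (weight_eval (word_weight w) H) (word_act w vac)"
proof (induction w)
  case Nil
  then show ?case using mode_vac[OF cartan_osp[OF assms]] by simp
next
  case (Cons l w)
  obtain a \<beta> m where l: "l = (a, \<beta>, m)" by (cases l)
  then have "(a, \<beta>, m) \<in> letters" using Cons.prems by simp
  then obtain s where a: "a \<in> osp_part s" "a \<in> root_space \<beta>" by (auto simp: letters_def)
  have "mode H 0 (mode a m (word_act w vac))
     = mode a m (mode H 0 (word_act w vac)) + mode (mat_scale (weight_eval \<beta> H) a) m (word_act w vac)"
    using mode_comm[OF cartan_osp_part[OF assms] a(1), of 0 m] root_space_index_bracket[OF assms a(2)]
    by (simp add: super_sign_def)
  then show ?case
    using Cons a by (simp add: l mode_smul_right mode_scale osp_part_osp weight_eval_add scale_left_distrib)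
qed

section \<open>Vectors of weight zero are combinations of words of weight zero\<close>

definition zero_words_span :: "'v set" where
  "zero_words_span = span {word_act w vac | w. w \<in> lists letters \<and> word_weight w = 0}"

lemma cartan_zero_words_span:
  assumes "H \<in> cartan" "v \<in> zero_words_span"
  shows "mode H 0 v = 0"
  using assms(2) unfolding zero_words_span_def
proof (induction rule: span_induct)
  case base
  show ?case
    by (intro subspaceI)
      (auto simp: cartan_osp[OF assms(1)] mode_add_right mode_smul_right mode_zero_right)
next
  case (step x)
  then obtain w where "w \<in> lists letters" "x = word_act w vac" "word_weight w = 0" by blast
  then show ?case using cartan_word[OF assms(1)] by simp
qed

lemma mode_sum_right:
  "a \<in> osp \<Longrightarrow> mode a m (sum f A) = (\<Sum>i\<in>A. mode a m (f i))"
  by (induction A rule: infinite_finite_induct) (auto simp: mode_zero_right mode_add_right)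

text \<open>Eigenvectors of nonzero weight are eliminated one at a time: applying a Cartan element on
  which the weight of one of them is nonzero expresses it through the others.\<close>

lemma weight_extraction:
  assumes "finite T"
    and "\<And>u. u \<in> T \<Longrightarrow> \<exists>\<mu>. \<mu> \<noteq> 0 \<and> (\<forall>H\<in>cartan. mode H 0 u = smul (weight_eval \<mu> H) u)"
    and "v0 \<in> zero_words_span"
    and "\<And>H. H \<in> cartan \<Longrightarrow> mode H 0 (v0 + (\<Sum>u\<in>T. smul (c u) u)) = 0"
  shows "v0 + (\<Sum>u\<in>T. smul (c u) u) \<in> zero_words_span"
  using assms
proof (induction T arbitrary: c rule: finite_induct)
  case empty
  then show ?case by simp
next
  case (insert u0 T)
  obtain \<mu>0 where \<mu>0: "\<mu>0 \<noteq> 0" "\<forall>H\<in>cartan. mode H 0 u0 = smul (weight_eval \<mu>0 H) u0"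
    using insert.prems(1)[of u0] by auto
  obtain H where H: "H \<in> cartan" and nz: "weight_eval \<mu>0 H \<noteq> 0"
    using weight_nonzeroE[OF \<mu>0(1)] by blast
  have "\<exists>e. mode H 0 u = smul e u" if "u \<in> T" for u
    using insert.prems(1)[of u] that H by auto
  then obtain e where e: "\<And>u. u \<in> T \<Longrightarrow> mode H 0 u = smul (e u) u" by metis
  define c' where "c' u = c u - c u * e u / weight_eval \<mu>0 H" for u
  have "0 = mode H 0 (v0 + (\<Sum>u\<in>insert u0 T. smul (c u) u))"
    using insert.prems(3)[OF H] by simp
  also have "\<dots> = smul (c u0 * weight_eval \<mu>0 H) u0 + (\<Sum>u\<in>T. smul (c u * e u) u)"
    using insert.hyps H \<mu>0(2) insert.prems(2)
    by (simp add: mode_add_right mode_smul_right mode_sum_right cartan_osp cartan_zero_words_span e)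
  finally have "smul (1 / weight_eval \<mu>0 H) (smul (c u0 * weight_eval \<mu>0 H) u0 + (\<Sum>u\<in>T. smul (c u * e u) u)) = 0"
    by simp
  then have u0: "smul (c u0) u0 = - (\<Sum>u\<in>T. smul (c u * e u / weight_eval \<mu>0 H) u)"
    using nz by (simp add: scale_right_distrib scale_sum_right eq_neg_iff_add_eq_0)
  have "v0 + (\<Sum>u\<in>insert u0 T. smul (c u) u) = v0 + (\<Sum>u\<in>T. smul (c' u) u)"
    using insert.hyps by (simp add: u0 c'_def scale_left_diff_distrib sum_subtractf)
  then show ?case
    using insert.IH[of c'] insert.prems by simp
qed

lemma weight_zero_subset: "weight_zero_space \<rho> \<subseteq> zero_words_span"
proof
  fix v assume v: "v \<in> weight_zero_space \<rho>"
  define S where "S = {word_act w vac | w. w \<in> lists letters}"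
  define S0 where "S0 = {word_act w vac | w. w \<in> lists letters \<and> word_weight w = 0}"
  have "v \<in> span S" using words_span_UNIV by (simp add: words_span_def S_def)
  then obtain t r where t: "finite t" "t \<subseteq> S" "v = (\<Sum>u\<in>t. smul (r u) u)"
    unfolding span_explicit by blast
  \<comment> \<open>The splitting is by vectors and not by words: a vector given by some word of
    weight zero goes into \<open>v0\<close>, and each remaining one comes from a word of nonzero
    weight.\<close>
  define v0 where "v0 = (\<Sum>u\<in>t \<inter> S0. smul (r u) u)"
  have "v = (\<Sum>u\<in>(t \<inter> S0) \<union> (t - S0). smul (r u) u)" by (simp add: t(3) Int_Diff_Un)
  also have "\<dots> = v0 + (\<Sum>u\<in>t - S0. smul (r u) u)"
    unfolding v0_def using t(1) by (intro sum.union_disjoint) auto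
  finally have v_eq: "v = v0 + (\<Sum>u\<in>t - S0. smul (r u) u)" .
  have "v0 + (\<Sum>u\<in>t - S0. smul (r u) u) \<in> zero_words_span"
  proof (rule weight_extraction)
    show "v0 \<in> zero_words_span"
      unfolding v0_def zero_words_span_def S0_def[symmetric]
      by (intro span_sum span_scale span_base) auto
    show "mode H 0 (v0 + (\<Sum>u\<in>t - S0. smul (r u) u)) = 0" if "H \<in> cartan" for H
      using v that unfolding v_eq weight_zero_space_def by blast
  next
    fix u assume "u \<in> t - S0"
    then obtain w where w: "w \<in> lists letters" "u = word_act w vac" "word_weight w \<noteq> 0"
      using t(2) unfolding S_def S0_def by blast
    show "\<exists>\<mu>. \<mu> \<noteq> 0 \<and> (\<forall>H\<in>cartan. mode H 0 u = smul (weight_eval \<mu> H) u)"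
      using w cartan_word by blast
  qed (use t(1) in auto)
  then show "v \<in> zero_words_span" using v_eq by simp
qed

text \<open>The zero mode of a current is a derivation of all products.\<close>

lemma weight_zero_subalgebra: "vertex_subalgebra (weight_zero_space \<rho>)"
  unfolding vertex_subalgebra_def
proof (intro conjI ballI allI)
  show "subspace (weight_zero_space \<rho>)"
    unfolding weight_zero_space_def
    by (intro subspaceI) (auto simp: cartan_osp mode_add_right mode_smul_right mode_zero_right)
  show "vac \<in> weight_zero_space \<rho>"
    by (auto simp: weight_zero_space_def mode_vac cartan_osp)
next
  fix u v m assume u: "u \<in> weight_zero_space \<rho>" and v: "v \<in> weight_zero_space \<rho>"
  have "mode H 0 (Y u m v) = 0" if H: "H \<in> cartan" for H
  proof -
    \<comment> \<open>The commutator formula is available for homogeneous vectors. Since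
      \<open>H\<close> is even no sign appears, and the two parities can be added
      afterwards.\<close>
    have der: "mode H 0 (Y u' m v) = Y u' m (mode H 0 v) + Y (mode H 0 u') m v" if "u' \<in> V s" for u' s
    proof -
      have "Y (current H) 0 (Y u' m v) - Y u' m (Y (current H) 0 v)
        = Sum_any (\<lambda>i::nat. smul (of_int 0 gchoose i) (Y (Y (current H) (int i) u') (0 + m - int i) v))"
        using Y_comm[OF current_part[OF cartan_osp_part[OF H]] that, of 0 m v]
        by (simp add: super_sign_def)
      also have "\<dots> = (\<Sum>i\<in>{0}. smul (of_int 0 gchoose i) (Y (Y (current H) (int i) u') (0 + m - int i) v))"
        by (rule Sum_any.expand_superset) (auto dest: gbinomial_zero_nonzeroD)
      finally show ?thesis by (simp add: current_field cartan_osp[OF H] algebra_simps)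
    qed
    obtain u0 u1 where "u0 \<in> V False" "u1 \<in> V True" and u01: "u = u0 + u1" using parts_span by blast
    then have "mode H 0 (Y u m v) = Y u m (mode H 0 v) + Y (mode H 0 u) m v"
      using der[of u0 False] der[of u1 True]
      by (simp add: Y_add_left mode_add_right cartan_osp[OF H] algebra_simps)
    then show ?thesis using u v H by (simp add: weight_zero_space_def)
  qed
  then show "Y u m v \<in> weight_zero_space \<rho>" by (simp add: weight_zero_space_def)
qed

end

section \<open>Subalgebras closed under opposite pairs\<close>

text \<open>A difference of two weights has a negative coordinate at \<open>p\<close> only if its
  second index is \<open>p\<close> or its first index is the dual of \<open>p\<close>; mirroring
  turns the latter case into the former.\<close>

lemma root_space_scaled_vec:
  assumes X: "X \<in> root_space \<beta>" "X \<noteq> 0" and "\<not> isl p" "Re (diag_entry \<beta> p) < 0"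
  obtains r c where "r \<noteq> p" "\<beta> = index_weight r - index_weight p" "X = mat_scale c (root_vec r p)"
proof -
  have "\<beta> \<noteq> 0" using assms(4) by (auto simp: diag_entry_zero)
  then obtain s t c where st: "s \<noteq> t" "\<beta> = index_weight s - index_weight t" "X = mat_scale c (root_vec s t)"
    using root_space_cases[OF X] by metis
  have "Re (diag_entry (index_weight s) p) < Re (diag_entry (index_weight t) p)"
    using assms(4) by (simp add: st(2) diag_entry_diff)
  then have "s = dual_index p \<or> t = p"
    unfolding diag_entry_weight[OF assms(3)] by (auto split: if_splits)
  then have "\<exists>r. r \<noteq> p \<and> \<beta> = index_weight r - index_weight p"
  proof
    assume "s = dual_index p"
    then show ?thesis using st(1,2) by (intro exI[of _ "dual_index t"]) auto
  next
    assume "t = p"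
    then show ?thesis using st(1,2) by auto
  qed
  then obtain r where r: "r \<noteq> p" "\<beta> = index_weight r - index_weight p" by blast
  then show ?thesis using that root_space_one_dim[OF r(1)] X(1) by blast
qed

locale pair_closed_subalgebra = affine_vertex_superalgebra smul V Y vac B k \<rho>
  for smul :: "complex \<Rightarrow> 'v::ab_group_add \<Rightarrow> 'v"
    and V :: "bool \<Rightarrow> 'v set" and Y :: "'v \<Rightarrow> int \<Rightarrow> 'v \<Rightarrow> 'v" and vac :: 'v
    and B :: "'n::finite gl \<Rightarrow> 'n gl \<Rightarrow> complex" and k :: complex and \<rho> :: "'n aff \<Rightarrow> 'v \<Rightarrow> 'v" +
  fixes U :: "'v set"
  assumes subalgebra: "vertex_subalgebra U"
    and cartan_current: "H \<in> cartan \<Longrightarrow> current H \<in> U"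
    and root_pair: "\<beta> \<noteq> 0 \<Longrightarrow> a \<in> root_space \<beta> \<Longrightarrow> b \<in> root_space (- \<beta>) \<Longrightarrow> v \<in> U \<Longrightarrow>
      mode a m (mode b p v) \<in> U"
begin

lemma sub_subspace: "subspace U"
  using subalgebra by (simp add: vertex_subalgebra_def)

lemma cartan_mode:
  assumes "H \<in> cartan" "v \<in> U"
  shows "mode H m v \<in> U"
  using subalgebra cartan_current[OF assms(1)] assms(2) current_field[OF cartan_osp[OF assms(1)]]
  unfolding vertex_subalgebra_def by metis

text \<open>The commutator of two adjacent letters gives a word of weight zero with one letter
  fewer, and a scalar. The scalar is nonzero only for opposite roots, and then the word without both
  letters has weight zero too.\<close>

lemma word_swap:
  assumes IH: "\<And>w v. w \<in> lists letters \<Longrightarrow> word_weight w = 0 \<Longrightarrow> length w < length p + length q + 2 \<Longrightarrow>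
      v \<in> U \<Longrightarrow> word_act w v \<in> U"
    and l: "p \<in> lists letters" "q \<in> lists letters" "x \<in> letters" "y \<in> letters"
    and wt: "word_weight (p @ [y, x] @ q) = 0" and v: "v \<in> U"
    and yx: "word_act (p @ [y, x] @ q) v \<in> U"
  shows "word_act (p @ [x, y] @ q) v \<in> U"
proof -
  obtain a \<beta> m b \<gamma> n where x: "x = (a, \<beta>, m)" and y: "y = (b, \<gamma>, n)" by (cases x; cases y)
  obtain s t where a: "a \<in> root_space \<beta>" "a \<in> osp_part s" and b: "b \<in> root_space \<gamma>" "b \<in> osp_part t"
    using l by (auto simp: letters_def x y)
  have ab: "(super_bracket a b, \<beta> + \<gamma>, m + n) \<in> letters"
    using root_space_bracket[OF a(1) b(1) a(2) b(2)] osp_part_bracket[OF a(2) b(2)]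
    unfolding letters_def by blast
  define r where "r = word_act q v"
  define z where "z = (if m + n = 0 then of_int m * (k * B a b) else 0)"
  have "word_act (p @ [x, y] @ q) v = word_act p (mode a m (mode b n r))"
    by (simp add: x y r_def)
  also have "mode a m (mode b n r) = smul (super_sign s t) (mode b n (mode a m r))
      + mode (super_bracket a b) (m + n) r + smul z r"
    unfolding mode_comm[OF a(2) b(2)] z_def by simp
  also have "word_act p \<dots> = smul (super_sign s t) (word_act (p @ [y, x] @ q) v)
      + word_act (p @ [(super_bracket a b, \<beta> + \<gamma>, m + n)] @ q) v + smul z (word_act (p @ q) v)"
    using l(1) by (simp add: word_act_add word_act_smul x y r_def)
  also have "\<dots> \<in> U"
  proof (intro subspace_add[OF sub_subspace])
    show "smul (super_sign s t) (word_act (p @ [y, x] @ q) v) \<in> U"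
      by (rule subspace_scale[OF sub_subspace yx])
    show "word_act (p @ [(super_bracket a b, \<beta> + \<gamma>, m + n)] @ q) v \<in> U"
      using l ab wt v by (intro IH) (auto simp: x y algebra_simps)
    show "smul z (word_act (p @ q) v) \<in> U"
    proof (cases "\<beta> + \<gamma> = 0")
      case True
      then have "\<gamma> + \<beta> = 0" by (simp add: add.commute)
      then have "word_weight (p @ q) = 0"
        using wt by (simp add: x y add.assoc[symmetric])
      then show ?thesis using l v by (intro subspace_scale[OF sub_subspace] IH) auto
    next
      case False
      then have "z = 0" using form_root_spaces[OF form a b(1)] by (simp add: z_def)
      then show ?thesis by (simp add: subspace_0[OF sub_subspace])
    qed
  qed
  finally show ?thesis .
qed

lemma word_move_front:
  assumes IH: "\<And>w v. w \<in> lists letters \<Longrightarrow> word_weight w = 0 \<Longrightarrow> length w < N \<Longrightarrow>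
      v \<in> U \<Longrightarrow> word_act w v \<in> U"
    and l: "p \<in> lists letters" "r \<in> lists letters" "q \<in> lists letters" "x \<in> letters"
    and wt: "word_weight (p @ [x] @ r @ q) = 0" and len: "N = length p + length r + length q + 1"
    and v: "v \<in> U" and front: "word_act (p @ [x] @ r @ q) v \<in> U"
  shows "word_act (p @ r @ [x] @ q) v \<in> U"
  using l(2,3) wt len front
proof (induction r arbitrary: q rule: rev_induct)
  case Nil
  then show ?case by simp
next
  case (snoc y r)
  have move: "word_act (p @ r @ [x] @ ([y] @ q)) v \<in> U"
    by (rule snoc.IH) (use snoc.prems in auto)
  have "word_weight ((p @ r) @ [x, y] @ q) = 0"
    using snoc.prems(3) by (cases x; cases y) (simp add: algebra_simps)
  then have "word_act ((p @ r) @ [y, x] @ q) v \<in> U"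
    by - (rule word_swap[OF IH, of "p @ r" q y x]; use snoc.prems l v move in force)
  then show ?case by simp
qed

text \<open>If the first letter has positive coordinate at \<open>p\<close>, weight zero forces a
  later letter of root \<gamma> with negative coordinate there. With \<beta> the difference of the
  weights of \<open>p\<close> and \<open>q\<close>, and \<gamma> that of \<open>r\<close> and
  \<open>p\<close>, the sum \<beta> + \<gamma> is the difference for \<open>r\<close> and
  \<open>q\<close>: either zero or again a root.\<close>

lemma word_preserves:
  assumes "w \<in> lists letters" "word_weight w = 0" "v \<in> U"
  shows "word_act w v \<in> U"
  using assms
proof (induction w arbitrary: v rule: length_induct)
  case (1 w)
  have IH: "word_act w' v \<in> U"
    if "w' \<in> lists letters" "word_weight w' = 0" "length w' < length w" "v \<in> U" for w' v
    using 1 that by blast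
  show ?case
  proof (cases w)
    case Nil
    then show ?thesis using 1 by simp
  next
    case (Cons l ws)
    obtain a \<beta> m where l: "l = (a, \<beta>, m)" by (cases l)
    have ws: "ws \<in> lists letters" and al: "(a, \<beta>, m) \<in> letters" using 1(2) by (auto simp: Cons l)
    obtain s where a: "a \<in> root_space \<beta>" "a \<in> osp_part s" using al by (auto simp: letters_def)
    have wt: "\<beta> + word_weight ws = 0" using 1(3) by (simp add: Cons l)
    consider "\<beta> = 0" | "a = 0" | "\<beta> \<noteq> 0" "a \<noteq> 0" by blast
    then show ?thesis
    proof cases
      case 1
      then have "word_act ws v \<in> U" using wt ws \<open>v \<in> U\<close> by (intro IH) (auto simp: Cons)
      moreover have "a \<in> cartan" using a(1) unfolding 1 root_space_0 .
      ultimately show ?thesis using cartan_mode by (simp add: Cons l)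
    next
      case 2
      then show ?thesis by (simp add: Cons l subspace_0[OF sub_subspace] aff_act_zero_left)
    next
      case 3
      obtain p q c where pq: "\<not> isl p" "p \<noteq> q" "\<beta> = index_weight p - index_weight q" "c \<noteq> 0"
        "a = mat_scale c (root_vec p q)"
        using root_space_cases[OF a(1) 3(2,1)] by metis
      \<comment> \<open>Weights have complex coordinates, so signs are taken of real parts, which
        are additive along the word.\<close>
      have "Re (diag_entry \<beta> p) > 0"
        using pq(2) unfolding pq(3) diag_entry_diff diag_entry_weight[OF pq(1)] by simp
      moreover have "diag_entry \<beta> p + diag_entry (word_weight ws) p = 0"
        using wt by (metis diag_entry_add diag_entry_zero)
      then have "Re (diag_entry \<beta> p) + Re (diag_entry (word_weight ws) p) = 0"
        by (metis plus_complex.simps(1) zero_complex.simps(1))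
      ultimately have neg: "Re (diag_entry (word_weight ws) p) < 0" by simp
      have "\<exists>l\<in>set ws. Re (diag_entry (fst (snd l)) p) < 0"
      proof (rule ccontr)
        assume "\<not> ?thesis"
        then have "\<forall>l\<in>set ws. Re (diag_entry (fst (snd l)) p) \<ge> 0" by auto
        then have "Re (diag_entry (word_weight ws) p) \<ge> 0"
          by (induction ws) (auto simp: diag_entry_zero diag_entry_add)
        then show False using neg by simp
      qed
      then obtain b \<gamma> n where b0: "(b, \<gamma>, n) \<in> set ws" "Re (diag_entry \<gamma> p) < 0" by auto
      obtain pre post where split: "ws = pre @ [(b, \<gamma>, n)] @ post"
        using split_list[OF b0(1)] by auto
      have bl: "(b, \<gamma>, n) \<in> letters" and pp: "pre \<in> lists letters" "post \<in> lists letters"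
        using ws by (auto simp: split)
      obtain t where b: "b \<in> root_space \<gamma>" "b \<in> osp_part t" using bl by (auto simp: letters_def)
      have wt': "\<beta> + \<gamma> + word_weight (pre @ post) = 0"
        using wt by (simp add: split algebra_simps)
      define u where "u = word_act (pre @ post) v"
      have main: "mode a m (mode b n u) \<in> U"
      proof (cases "b = 0")
        case True
        then show ?thesis
          by (simp add: aff_act_zero_left mode_zero_right letters_osp[OF al] subspace_0[OF sub_subspace])
      next
        case False
        obtain r d where r: "r \<noteq> p" "\<gamma> = index_weight r - index_weight p" "b = mat_scale d (root_vec r p)"
          using root_space_scaled_vec[OF b(1) False pq(1) b0(2)] by blast
        show ?thesis
        proof (cases "r = q")
          case True
          then have "\<gamma> = - \<beta>" by (simp add: r(2) pq(3))
          then have "word_weight (pre @ post) = 0" using wt' by simp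
          then have "u \<in> U"
            unfolding u_def using pp \<open>v \<in> U\<close> by (intro IH) (auto simp: Cons split)
          then show ?thesis
            using root_pair[OF 3(1) a(1)] b(1) \<open>\<gamma> = - \<beta>\<close> by simp
        next
          case False
          \<comment> \<open>\<open>?f\<close> has root -\<beta> and pairs with \<open>a\<close>.
            \<open>?g\<close> has root \<beta> + \<gamma>, and the two brackets back to a nonzero
            multiple of \<open>root_vec r p\<close>, hence of the direction of
            \<open>b\<close>.\<close>
          let ?f = "root_vec q p :: 'n gl" and ?g = "root_vec r q :: 'n gl"
          have f: "?f \<in> root_space (- \<beta>)" "?f \<in> osp_part (isl q \<noteq> isl p)"
            using root_vec_root_space[of q p] root_vec_part[of q p] by (auto simp: pq(3))
          have g: "?g \<in> root_space (index_weight r - index_weight q)" "?g \<in> osp_part (isl r \<noteq> isl q)"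
            using root_vec_root_space[of r q] root_vec_part[of r q] by auto
          define \<sigma> where "\<sigma> = super_sign (isl r \<noteq> isl q) (isl q \<noteq> isl p)"
          have \<sigma>: "super_sign (isl q \<noteq> isl p) (isl r \<noteq> isl q) = \<sigma>" "\<sigma> \<noteq> 0"
            by (auto simp: \<sigma>_def super_sign_def)
          obtain e where e: "e \<noteq> 0" "super_bracket ?g ?f = mat_scale e (root_vec r p)"
            using root_vec_bracket[OF pq(2) r(1) False] by blast
          have fg: "super_bracket ?f ?g = mat_scale (- \<sigma>) (mat_scale e (root_vec r p))"
            unfolding e(2)[symmetric] \<sigma>_def by (rule super_bracket_swap[OF g(2) f(2)])
          have "- \<beta> + (index_weight r - index_weight q) \<noteq> 0"
            using r(1) index_weight_inj[of r p] by (auto simp: pq(3))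
          then have Bfg: "B ?f ?g = 0"
            by (rule form_root_spaces[OF form f g(1)])
          \<comment> \<open>Any large l will do: only the sum of the two mode numbers matters for the bracket.\<close>
          obtain l where lbig: "mode ?f l u = 0"
            using mode_truncation[OF root_vec_osp] by blast
          \<comment> \<open>One letter of root \<beta> + \<gamma> replaces the two letters of roots
            \<beta> and \<gamma>: the weight is unchanged and the length drops by one.\<close>
          have "word_act ((?g, index_weight r - index_weight q, n - l) # pre @ post) v \<in> U"
          proof (rule IH)
            show "(?g, index_weight r - index_weight q, n - l) # pre @ post \<in> lists letters"
              using root_vec_letter[of 1 r q "n - l"] pp by simp
            show "word_weight ((?g, index_weight r - index_weight q, n - l) # pre @ post) = 0"
              using wt' by (simp add: pq(3) r(2) algebra_simps)
            show "length ((?g, index_weight r - index_weight q, n - l) # pre @ post) < length w"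
              by (simp add: Cons split)
          qed fact
          then have "mode ?g (n - l) u \<in> U" by (simp add: u_def)
          then have "mode a m (mode ?f l (mode ?g (n - l) u)) \<in> U"
            by (rule root_pair[OF 3(1) a(1) f(1)])
          also have "mode ?f l (mode ?g (n - l) u) = smul (- \<sigma> * e) (mode (root_vec r p) n u)"
            unfolding mode_comm[OF f(2) g(2)] fg Bfg
            by (simp add: lbig mode_zero_right root_vec_osp mode_scale osp_scale)
          finally have "smul (- \<sigma> * e) (mode a m (mode (root_vec r p) n u)) \<in> U"
            by (simp only: mode_smul_right letters_osp[OF al])
          then have "smul (d / (- \<sigma> * e)) (smul (- \<sigma> * e) (mode a m (mode (root_vec r p) n u))) \<in> U"
            by (rule subspace_scale[OF sub_subspace])
          then have "smul d (mode a m (mode (root_vec r p) n u)) \<in> U"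
            using \<sigma>(2) e(1) by simp
          then show ?thesis
            by (simp add: r(3) mode_scale root_vec_osp mode_smul_right letters_osp[OF al])
        qed
      qed
      have "word_act ([(a, \<beta>, m)] @ pre @ [(b, \<gamma>, n)] @ post) v \<in> U"
      proof (rule word_move_front[OF IH])
        show "word_weight ([(a, \<beta>, m)] @ [(b, \<gamma>, n)] @ pre @ post) = 0"
          using wt' by (simp add: algebra_simps)
        show "word_act ([(a, \<beta>, m)] @ [(b, \<gamma>, n)] @ pre @ post) v \<in> U"
          using main by (simp add: u_def)
      qed (use al bl pp \<open>v \<in> U\<close> in \<open>auto simp: Cons split\<close>)
      then show ?thesis by (simp add: Cons l split)
    qed
  qed
qed

lemma weight_zero_in: "weight_zero_space \<rho> \<subseteq> U"
proof -
  have "vac \<in> U" using subalgebra by (simp add: vertex_subalgebra_def)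
  then have "zero_words_span \<subseteq> U"
    unfolding zero_words_span_def
    by (intro span_minimal sub_subspace) (auto intro: word_preserves)
  then show ?thesis using weight_zero_subset by blast
qed

end

section \<open>Generation by root vectors\<close>

lemma root_space_homogeneous:
  assumes "X \<in> root_space \<beta>" "\<beta> \<noteq> 0"
  obtains s where "X \<in> osp_part s"
proof (cases "X = 0")
  case True
  then show ?thesis using that osp_part_zero by blast
next
  case False
  then show ?thesis
    using root_space_cases[OF assms(1) False assms(2)] osp_part_scale[OF root_vec_part] that by metis
qed

lemma root_space_parity:
  assumes "\<beta> \<in> roots_of_parity s" "X \<in> root_space \<beta>"
  shows "X \<in> osp_part s"
proof -
  obtain Z where Z: "\<beta> \<noteq> 0" "Z \<in> root_space \<beta>" "Z \<in> osp_part s" "Z \<noteq> 0"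
    using assms(1) by (auto simp: roots_of_parity_def)
  obtain c where "X = mat_scale c Z"
    using root_space_multiple[OF Z(2,4) assms(2) Z(1)] by blast
  then show ?thesis using osp_part_scale[OF Z(3)] by simp
qed

lemma even_self_bracket:
  assumes "X \<in> osp_part False"
  shows "super_bracket X X = 0"
proof (rule gl_eqI)
  fix i j
  have "super_bracket X X $ i $ j = - super_bracket X X $ i $ j"
    using arg_cong[OF super_bracket_swap[OF assms assms], of "\<lambda>Z. Z $ i $ j"]
    by (simp add: super_sign_def)
  then show "super_bracket X X $ i $ j = 0 $ i $ j" by simp
qed

lemma super_bracket_scale_left:
  assumes "X \<in> osp_part s" "Z \<in> osp_part t"
  shows "super_bracket (mat_scale c X) Z = mat_scale c (super_bracket X Z)"
proof -
  have "gl_part s (mat_scale c X) = mat_scale c X" "gl_part s X = X" "gl_part t Z = Z"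
    using assms osp_part_scale[OF assms(1)] by (auto simp: osp_part_iff)
  then show ?thesis
    by (simp add: super_bracket_homogeneous)
       (auto intro!: gl_eqI simp: matrix_mult_nth sum_distrib_left algebra_simps)
qed

text \<open>Pairing the bracket with a Cartan element \<open>H\<close> gives \<beta>(H) times
  \<open>B X Z\<close> by invariance, and \<beta>(H) times \<open>d\<close> by the choice of
  \<open>d\<close>.\<close>

lemma coroot_form:
  assumes "invariant_form B" "X \<in> root_space \<beta>" "Z \<in> root_space (- \<beta>)" "Z \<in> osp_part t" "\<beta> \<noteq> 0"
    and "super_bracket X Z = mat_scale c (t_vec B \<gamma>)" "c *s \<gamma> = d *s \<beta>"
  shows "B X Z = d"
proof -
  obtain H where H: "H \<in> cartan" "weight_eval \<beta> H \<noteq> 0" using weight_nonzeroE[OF assms(5)] by blast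
  have "weight_eval \<beta> H * B X Z = B (t_vec B (c *s \<gamma>)) H"
    using form_coroot[OF assms(1-4) H(1)] assms(6) by (simp add: t_vec_smult[OF assms(1)])
  also have "\<dots> = d * weight_eval \<beta> H"
    using t_vec_form[OF assms(1) H(1)] by (simp add: assms(7) weight_eval_smult)
  finally show ?thesis using H(2) by simp
qed

section \<open>The pairs of sl(2) and osp(1|2)\<close>

context affine_vertex_superalgebra
begin

text \<open>The sl(2) instance of \<open>current_pair\<close>: \<sigma> = 1, \<mu> = 2 and \<tau> =
  0, with \<kappa> the positive integer \<open>K\<close>.\<close>

lemma even_pair_closed:
  assumes sub: "vertex_subalgebra U"
    and E: "E \<in> root_space \<beta>" "E \<in> osp_part False"
    and F: "F \<in> root_space (- \<beta>)" "F \<in> osp_part False" and "\<beta> \<noteq> 0"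
    and H: "super_bracket E F = H" "H \<in> cartan" "current H \<in> U"
    and HE: "super_bracket H E = mat_scale 2 E" and HF: "super_bracket H F = mat_scale (-2) F"
    and K: "k * B E F = of_nat K" "K > 0"
    and gen: "mode F (-2) (current E) \<in> U" and v: "v \<in> U"
  shows "mode E m (mode F p v) \<in> U" "mode F p (mode E m v) \<in> U"
proof -
  have osp: "E \<in> osp" "F \<in> osp" "H \<in> osp" using E F H(2) osp_part_osp cartan_osp by blast+
  have Hp: "H \<in> osp_part False" "H \<in> root_space 0" using H(2) cartan_osp_part root_space_0 by blast+
  have s1: "super_sign False False = 1" by (simp add: super_sign_def)
  have neq: "\<beta> + \<beta> \<noteq> 0" "- \<beta> + - \<beta> \<noteq> 0"
    using \<open>\<beta> \<noteq> 0\<close> by (auto simp: vec_eq_iff)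
  have B0: "B E E = 0" "B F F = 0" "B H E = 0" "B H F = 0"
    using form_root_spaces[OF form E E(1) neq(1)] form_root_spaces[OF form F F(1) neq(2)]
      form_root_spaces[OF form Hp(2,1) E(1)] form_root_spaces[OF form Hp(2,1) F(1)] \<open>\<beta> \<noteq> 0\<close>
    by auto
  note comm = mode_comm[OF E(2) F(2)] mode_comm[OF Hp(1) E(2)] mode_comm[OF Hp(1) F(2)]
    mode_comm[OF E(2) E(2)] mode_comm[OF F(2) F(2)]
  interpret current_pair smul V Y vac U False "current E" "current F" "current H" 0 0 "of_nat K" 2 0 1
  proof unfold_locales
    show "vertex_subalgebra U" by fact
    show "1 = super_sign False False" by (simp add: s1)
    show "current E \<in> V False" "current F \<in> V False" using current_part E F by blast+
    show "current H \<in> U" by fact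
    show "Y (current F) (-2) (current E) \<in> U" using gen by (simp add: current_field osp)
    fix m p w
    show "Y (current E) m (Y (current F) p w) = smul 1 (Y (current F) p (Y (current E) m w))
        + Y (current H) (m + p) w + (if m + p = 0 then smul (of_int m * of_nat K) w else 0)"
      unfolding current_field[OF osp(1)] current_field[OF osp(2)] current_field[OF osp(3)] comm(1) H(1) K(1) s1 ..
    show "Y (current H) m (Y (current E) p w) = Y (current E) p (Y (current H) m w)
        + smul 2 (Y (current E) (m + p) w)"
      unfolding current_field[OF osp(1)] current_field[OF osp(3)] comm(2)
      by (simp add: s1 B0 HE mode_scale osp)
    show "Y (current H) m (Y (current F) p w) = Y (current F) p (Y (current H) m w)
        - smul 2 (Y (current F) (m + p) w)"
      unfolding current_field[OF osp(2)] current_field[OF osp(3)] comm(3)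
      by (simp add: s1 B0 HF mode_scale osp)
    show "Y (current E) m (Y (current E) p w) = smul 1 (Y (current E) p (Y (current E) m w)) + Y 0 (m + p) w"
      unfolding current_field[OF osp(1)]
      by (subst comm(4)) (simp add: s1 B0 even_self_bracket[OF E(2)] aff_act_zero_left)
    show "Y (current F) m (Y (current F) p w) = smul 1 (Y (current F) p (Y (current F) m w)) + Y 0 (m + p) w"
      unfolding current_field[OF osp(2)]
      by (subst comm(5)) (simp add: s1 B0 even_self_bracket[OF F(2)] aff_act_zero_left)
    show "w \<in> U \<Longrightarrow> Y 0 m (Y 0 p w) \<in> U"
      using sub subspace_0 by (auto simp: vertex_subalgebra_def)
  next
    fix a :: nat assume "a \<ge> 1"
    \<comment> \<open>The coefficient is minus a positive natural number, namely (a + 2)(a K + a +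
      1).\<close>
    have eq: "(of_nat a * (of_nat a + 1) + (of_nat a + 1) * (2 + of_nat a * of_nat K) + of_nat a * of_nat K :: complex)
      = of_nat (a * (a + 1) + (a + 1) * (2 + a * K) + a * K)"
      by (simp add: algebra_simps)
    have nz: "of_nat (a * (a + 1) + (a + 1) * (2 + a * K) + a * K) \<noteq> (0 :: complex)"
      unfolding of_nat_eq_0_iff by simp
    have "0 * (of_nat a * (of_nat a - 1) / 2) - 0 * 1 * of_nat a * (-1) ^ a
        - 2 * (of_nat a * (of_nat a + 1) / 2) - (of_nat a + 1) * (2 + of_nat a * of_nat K)
        - of_nat a * of_nat K + 0 * ((-1) ^ a - 1 * of_nat a)
      = - (of_nat a * (of_nat a + 1) + (of_nat a + 1) * (2 + of_nat a * of_nat K) + of_nat a * of_nat K :: complex)"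
      by (simp add: field_simps)
    then show "0 * (of_nat a * (of_nat a - 1) / 2) - 0 * 1 * of_nat a * (-1) ^ a
        - 2 * (of_nat a * (of_nat a + 1) / 2) - (of_nat a + 1) * (2 + of_nat a * of_nat K)
        - of_nat a * of_nat K + 0 * ((-1) ^ a - 1 * of_nat a) \<noteq> (0 :: complex)"
      using nz unfolding eq by (simp only: neg_equal_0_iff_equal) blast
  qed auto
  show "mode E m (mode F p v) \<in> U" "mode F p (mode E m v) \<in> U"
    using U_yx_xy[OF v, where m = p and p = m] by (simp_all add: current_field osp)
qed

text \<open>The osp(1|2) instance of \<open>current_pair\<close>: \<sigma> = -1, \<mu> = 1, \<kappa>
  = 2K. Its \<open>e\<close> and \<open>f\<close> are the currents of 2E and -2F, which gives \<tau>
  = 2. Closure under the pair E, F is needed for the products of three modes.\<close>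

lemma odd_pair_closed:
  assumes sub: "vertex_subalgebra U"
    and X: "X \<in> root_space \<gamma>" "X \<in> osp_part True"
    and Z: "Z \<in> root_space (- \<gamma>)" "Z \<in> osp_part True" and "\<gamma> \<noteq> 0"
    and E: "E \<in> root_space (\<gamma> + \<gamma>)" "E \<in> osp_part False"
    and F: "F \<in> root_space (- (\<gamma> + \<gamma>))" "F \<in> osp_part False"
    and H: "super_bracket X Z = H" "H \<in> cartan" "current H \<in> U"
    and HX: "super_bracket H X = X" and HZ: "super_bracket H Z = - Z"
    and XX: "super_bracket X X = mat_scale 2 E" and ZZ: "super_bracket Z Z = mat_scale (-2) F"
    and EX: "super_bracket E X = 0" and EZ: "super_bracket E Z = - X"
    and FX: "super_bracket F X = - Z" and FZ: "super_bracket F Z = 0"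
    and K: "k * B X Z = of_nat (2 * K)" "K > 0"
    and even: "\<And>m p w. w \<in> U \<Longrightarrow> mode E m (mode F p w) \<in> U" "\<And>m p w. w \<in> U \<Longrightarrow> mode F m (mode E p w) \<in> U"
    and gen: "mode Z (-2) (current X) \<in> U" and v: "v \<in> U"
  shows "mode X m (mode Z p v) \<in> U" "mode Z p (mode X m v) \<in> U"
proof -
  let ?E = "mat_scale 2 E" and ?F = "mat_scale (-2) F"
  have osp: "X \<in> osp" "Z \<in> osp" "H \<in> osp" "E \<in> osp" "F \<in> osp" "?E \<in> osp" "?F \<in> osp"
    using X Z E F H(2) osp_part_osp cartan_osp osp_scale by blast+
  have Hp: "H \<in> osp_part False" "H \<in> root_space 0" using H(2) cartan_osp_part root_space_0 by blast+
  have E2: "?E \<in> root_space (\<gamma> + \<gamma>)" "?E \<in> osp_part False" and F2: "?F \<in> root_space (- (\<gamma> + \<gamma>))" "?F \<in> osp_part False"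
    using E F root_space_scale osp_part_scale by blast+
  have s1: "super_sign False False = 1" "super_sign False True = 1" "super_sign True True = -1"
    by (simp_all add: super_sign_def)
  have mult: "c *s \<gamma> \<noteq> 0" if "c \<noteq> 0" for c using \<open>\<gamma> \<noteq> 0\<close> that by (simp add: vec_eq_iff)
  have m2: "\<gamma> + \<gamma> = 2 *s \<gamma>" "- \<gamma> + - \<gamma> = (-2) *s \<gamma>" "\<gamma> + \<gamma> + \<gamma> = 3 *s \<gamma>" "\<gamma> + \<gamma> + - \<gamma> = 1 *s \<gamma>"
    "- (\<gamma> + \<gamma>) + \<gamma> = (-1) *s \<gamma>" "- (\<gamma> + \<gamma>) + - \<gamma> = (-3) *s \<gamma>"
    by (auto simp: vec_eq_iff)
  have neq: "\<gamma> + \<gamma> \<noteq> 0" "- \<gamma> + - \<gamma> \<noteq> 0" "\<gamma> + \<gamma> + \<gamma> \<noteq> 0" "\<gamma> + \<gamma> + - \<gamma> \<noteq> 0"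
    "- (\<gamma> + \<gamma>) + \<gamma> \<noteq> 0" "- (\<gamma> + \<gamma>) + - \<gamma> \<noteq> 0" "0 + \<gamma> \<noteq> 0" "0 + - \<gamma> \<noteq> 0"
    subgoal by (subst m2(1), rule mult) simp
    subgoal by (subst m2(2), rule mult) simp
    subgoal by (subst m2(3), rule mult) simp
    subgoal by (subst m2(4), rule mult) simp
    subgoal by (subst m2(5), rule mult) simp
    subgoal by (subst m2(6), rule mult) simp
    using \<open>\<gamma> \<noteq> 0\<close> by auto
  have B0: "B X X = 0" "B Z Z = 0" "B ?E X = 0" "B ?E Z = 0" "B ?F X = 0" "B ?F Z = 0" "B H X = 0" "B H Z = 0"
    using form_root_spaces[OF form X X(1) neq(1)] form_root_spaces[OF form Z Z(1) neq(2)]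
      form_root_spaces[OF form E2 X(1) neq(3)] form_root_spaces[OF form E2 Z(1) neq(4)]
      form_root_spaces[OF form F2 X(1) neq(5)] form_root_spaces[OF form F2 Z(1) neq(6)]
      form_root_spaces[OF form Hp(2,1) X(1) neq(7)] form_root_spaces[OF form Hp(2,1) Z(1) neq(8)]
    by auto
  have neg: "- W = mat_scale (-1) W" for W :: "'n gl" by (rule gl_eqI) simp
  have br: "super_bracket ?E X = 0" "super_bracket ?E Z = mat_scale (-2) X"
    "super_bracket ?F X = mat_scale 2 Z" "super_bracket ?F Z = 0"
    using super_bracket_scale_left[OF E(2) X(2)] super_bracket_scale_left[OF E(2) Z(2)]
      super_bracket_scale_left[OF F(2) X(2)] super_bracket_scale_left[OF F(2) Z(2)]
    by (auto simp: EX EZ FX FZ intro!: gl_eqI)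
  note comm = mode_comm[OF X(2) Z(2)] mode_comm[OF Hp(1) X(2)] mode_comm[OF Hp(1) Z(2)]
    mode_comm[OF X(2) X(2)] mode_comm[OF Z(2) Z(2)] mode_comm[OF E2(2) X(2)] mode_comm[OF E2(2) Z(2)]
    mode_comm[OF F2(2) X(2)] mode_comm[OF F2(2) Z(2)]
  interpret current_pair smul V Y vac U True "current X" "current Z" "current H" "current ?E" "current ?F"
    "of_nat (2 * K)" 1 2 "-1"
  proof unfold_locales
    show "vertex_subalgebra U" by fact
    show "- 1 = super_sign True True" by (simp add: s1)
    show "current X \<in> V True" "current Z \<in> V True" using current_part X Z by blast+
    show "current H \<in> U" by fact
    show "Y (current Z) (-2) (current X) \<in> U" using gen by (simp add: current_field osp)
    fix m p w
    show "Y (current X) m (Y (current Z) p w) = smul (- 1) (Y (current Z) p (Y (current X) m w))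
        + Y (current H) (m + p) w + (if m + p = 0 then smul (of_int m * of_nat (2 * K)) w else 0)"
      unfolding current_field[OF osp(1)] current_field[OF osp(2)] current_field[OF osp(3)] comm(1) H(1) K(1) s1 ..
    show "Y (current H) m (Y (current X) p w) = Y (current X) p (Y (current H) m w)
        + smul 1 (Y (current X) (m + p) w)"
      unfolding current_field[OF osp(1)] current_field[OF osp(3)] comm(2)
      by (simp add: s1 B0 HX)
    show "Y (current H) m (Y (current Z) p w) = Y (current Z) p (Y (current H) m w)
        - smul 1 (Y (current Z) (m + p) w)"
      unfolding current_field[OF osp(2)] current_field[OF osp(3)] comm(3) HZ neg
      by (simp add: s1 B0 mode_scale osp)
    show "Y (current X) m (Y (current X) p w) = smul (- 1) (Y (current X) p (Y (current X) m w)) + Y (current ?E) (m + p) w"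
      unfolding current_field[OF osp(1)] current_field[OF osp(6)]
      by (subst comm(4)) (simp add: s1 B0 XX)
    show "Y (current Z) m (Y (current Z) p w) = smul (- 1) (Y (current Z) p (Y (current Z) m w)) + Y (current ?F) (m + p) w"
      unfolding current_field[OF osp(2)] current_field[OF osp(7)]
      by (subst comm(5)) (simp add: s1 B0 ZZ)
    show "Y (current ?E) m (Y (current X) p w) = Y (current X) p (Y (current ?E) m w)"
      unfolding current_field[OF osp(1)] current_field[OF osp(6)] comm(6) br
      by (simp add: s1 B0 aff_act_zero_left)
    show "Y (current ?F) m (Y (current Z) p w) = Y (current Z) p (Y (current ?F) m w)"
      unfolding current_field[OF osp(2)] current_field[OF osp(7)] comm(9) br
      by (simp add: s1 B0 aff_act_zero_left)
    show "Y (current ?E) m (Y (current Z) p w) = Y (current Z) p (Y (current ?E) m w) - smul 2 (Y (current X) (m + p) w)"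
      unfolding current_field[OF osp(1)] current_field[OF osp(2)] current_field[OF osp(6)] comm(7) br
      by (simp add: s1 B0 mode_scale osp)
    show "Y (current ?F) m (Y (current X) p w) = Y (current X) p (Y (current ?F) m w) + smul 2 (Y (current Z) (m + p) w)"
      unfolding current_field[OF osp(1)] current_field[OF osp(2)] current_field[OF osp(7)] comm(8) br
      by (simp add: s1 B0 mode_scale osp)
    have sc: "smul c u \<in> U" if "u \<in> U" for c u
      using sub that subspace_scale by (auto simp: vertex_subalgebra_def)
    show "Y (current ?E) m (Y (current ?F) p w) \<in> U" if "w \<in> U"
      unfolding current_field[OF osp(6)] current_field[OF osp(7)]
      unfolding mode_scale[OF osp(4)] mode_scale[OF osp(5)]
        mode_smul_right[OF osp(4)] by (intro sc even that)
    show "Y (current ?F) m (Y (current ?E) p w) \<in> U" if "w \<in> U"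
      unfolding current_field[OF osp(6)] current_field[OF osp(7)]
      unfolding mode_scale[OF osp(4)] mode_scale[OF osp(5)]
        mode_smul_right[OF osp(5)] by (intro sc even that)
  next
    fix a :: nat assume a: "a \<ge> 1"
    \<comment> \<open>The coefficient is a real number, so nonvanishing can be proved by an
      inequality.\<close>
    define s :: real where "s = (-1) ^ a"
    have s: "s \<le> 1" "(-1 :: complex) ^ a = of_real s"
      by (auto simp: s_def) (metis power_le_one_iff abs_ge_self abs_minus_cancel abs_one power_abs power_one)
    define C :: real where "C = 2 * (real a * (real a - 1) / 2) + 2 * real a * s
        - (real a * (real a + 1) / 2) - (real a + 1) * (1 + real a * (2 * real K))
        - real a * (2 * real K) + 2 * (s + real a)"
    have "2 * (of_nat a * (of_nat a - 1) / 2) - 2 * (-1) * of_nat a * (-1) ^ a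
        - 1 * (of_nat a * (of_nat a + 1) / 2) - (of_nat a + 1) * (1 + of_nat a * of_nat (2 * K))
        - of_nat a * of_nat (2 * K) + 2 * ((-1) ^ a - (-1) * of_nat a) = complex_of_real C"
      unfolding s(2) C_def by simp
    \<comment> \<open>With \<open>s\<close> at most 1 and K, a at least 1, the terms -2 a^2 K - 4 a
      K outweigh a^2 / 2 and 2 (a + 1).\<close>
    moreover have "C < 0"
    proof -
      have K1: "real K \<ge> 1" using K(2) by simp
      have a1: "real a \<ge> 1" using a by simp
      have C_eq: "C = real a * real a / 2 - real a / 2 + 2 * (s * (real a + 1))
          - 2 * (real a * real a * real K) - 4 * (real a * real K) - 1"
        unfolding C_def by (simp add: field_simps)
      have "real a * real a \<le> real a * real a * real K" "real a \<le> real a * real K"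
        using mult_left_mono[OF K1, of "real a * real a"] mult_left_mono[OF K1, of "real a"]
        by (simp_all del: mult_le_cancel_left1)
      moreover have "s * (real a + 1) \<le> real a + 1"
        using mult_right_mono[OF s(1), of "real a + 1"] by simp
      moreover have "real a \<le> real a * real a"
        using mult_left_mono[OF a1, of "real a"] by simp
      ultimately show ?thesis
        unfolding C_eq using a1 by linarith
    qed
    ultimately show "2 * (of_nat a * (of_nat a - 1) / 2) - 2 * (-1) * of_nat a * (-1) ^ a
        - 1 * (of_nat a * (of_nat a + 1) / 2) - (of_nat a + 1) * (1 + of_nat a * of_nat (2 * K))
        - of_nat a * of_nat (2 * K) + 2 * ((-1) ^ a - (-1) * of_nat a) \<noteq> (0 :: complex)"
      by simp
  qed auto
  show "mode X m (mode Z p v) \<in> U" "mode Z p (mode X m v) \<in> U"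
    using U_yx_xy[OF v, where m = p and p = m] by (simp_all add: current_field osp)
qed

end

section \<open>From the given generators to all opposite root pairs\<close>

locale root_vector_subalgebra = affine_vertex_superalgebra smul V Y vac B "of_nat K" \<rho>
  for smul :: "complex \<Rightarrow> 'v::ab_group_add \<Rightarrow> 'v"
    and V :: "bool \<Rightarrow> 'v set" and Y :: "'v \<Rightarrow> int \<Rightarrow> 'v \<Rightarrow> 'v" and vac :: 'v
    and B :: "'n::finite gl \<Rightarrow> 'n gl \<Rightarrow> complex" and K :: nat and \<rho> :: "'n aff \<Rightarrow> 'v \<Rightarrow> 'v" +
  fixes \<alpha> :: "'n \<Rightarrow> complex ^ 'n" and e x :: "complex ^ 'n \<Rightarrow> 'n gl" and U :: "'v set"
  assumes level: "K > 0"
    and simple: "simple_system \<alpha>"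
    and vectors: "root_vectors B \<alpha> e x"
    and subalgebra: "vertex_subalgebra U"
    and simple_in: "current (t_vec B (\<alpha> i)) \<in> U"
    and even_in: "\<beta> \<in> even_roots \<Longrightarrow> \<beta> \<in> nonneg_comb \<alpha> \<Longrightarrow> mode (e (- \<beta>)) (-2) (current (e \<beta>)) \<in> U"
    and odd_in: "\<beta> \<in> pos_long_roots B \<alpha> \<Longrightarrow>
      mode (x (- half \<beta>)) (-2) (current (x (half \<beta>))) \<in> U"
begin

lemma sub_subspace: "subspace U"
  using subalgebra by (simp add: vertex_subalgebra_def)

text \<open>Every root is plus or minus a combination of simple roots. The coordinate vectors are
  roots, the odd ones, so linearity reaches the whole dual of the Cartan subalgebra.\<close>

lemma current_cartan:
  assumes "H \<in> cartan"
  shows "current H \<in> U"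
proof -
  define M where "M = {\<mu>. current (t_vec B \<mu>) \<in> U}"
  have osp: "t_vec B \<mu> \<in> osp" for \<mu> by (rule cartan_osp[OF t_vec_cartan[OF form]])
  have add: "\<mu> + \<nu> \<in> M" if "\<mu> \<in> M" "\<nu> \<in> M" for \<mu> \<nu>
    using that by (simp add: M_def t_vec_add[OF form] mode_add osp subspace_add[OF sub_subspace])
  have smult: "c *s \<mu> \<in> M" if "\<mu> \<in> M" for \<mu> c
    using that by (simp add: M_def t_vec_smult[OF form] mode_scale osp subspace_scale[OF sub_subspace])
  have zero: "0 \<in> M"
    using t_vec_smult[OF form, of 0 0]
    by (simp add: M_def aff_act_zero_left subspace_0[OF sub_subspace])
  have sum: "sum f A \<in> M" if "\<And>i. i \<in> A \<Longrightarrow> f i \<in> M" for f and A :: "'n set"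
    by (rule finite_sum_closed[of "\<lambda>\<mu>. \<mu> \<in> M"]) (auto intro: zero add that)
  have comb: "\<mu> \<in> M" if "\<mu> \<in> nonneg_comb \<alpha>" for \<mu>
  proof -
    obtain c :: "'n \<Rightarrow> nat" where "\<mu> = (\<Sum>i\<in>UNIV. of_nat (c i) *s \<alpha> i)"
      using \<open>\<mu> \<in> nonneg_comb \<alpha>\<close> unfolding nonneg_comb_def by blast
    moreover have "\<alpha> i \<in> M" for i using simple_in by (simp add: M_def)
    ultimately show ?thesis by (simp only:) (intro sum smult)
  qed
  have root: "\<mu> \<in> M" if "\<mu> \<in> roots" for \<mu>
  proof -
    have "\<mu> \<in> nonneg_comb \<alpha> \<or> - \<mu> \<in> nonneg_comb \<alpha>"
      using simple that by (simp add: simple_system_def)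
    then have "\<mu> \<in> M \<or> - \<mu> \<in> M" using comb by blast
    moreover have "(-1) *s (- \<mu>) = \<mu>" by (simp add: vec_eq_iff)
    ultimately show ?thesis using smult[of "- \<mu>" "-1"] by auto
  qed
  have "axis i 1 \<in> M" for i
    using root_vec_in_roots[of "Inr (Inl i)" "Inl ()"]
    by (intro root) (simp add: roots_def)
  then have "(\<Sum>i\<in>UNIV. (\<mu> $ i) *s axis i 1) \<in> M" for \<mu> :: "complex ^ 'n"
    by (intro sum smult)
  then have all: "\<mu> \<in> M" for \<mu> by (simp add: basis_expansion)
  obtain \<mu> where "H = t_vec B \<mu>" using t_vec_surj[OF form assms] by blast
  then show ?thesis using all[of \<mu>] by (simp add: M_def)
qed

lemma even_roots_nonzero: "\<beta> \<in> even_roots \<Longrightarrow> \<beta> \<noteq> 0"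
  by (simp add: roots_of_parity_def)

lemma even_roots_minus:
  assumes "\<beta> \<in> even_roots" shows "- \<beta> \<in> even_roots"
proof -
  obtain p q where "\<not> isl p" "\<not> isl q" "p \<noteq> q" "\<beta> = index_weight p - index_weight q"
    using even_roots_cases[OF assms] by blast
  then show ?thesis using root_vec_in_roots[of q p] by simp
qed

lemma positive_even_pair:
  assumes \<beta>: "\<beta> \<in> even_roots" "\<beta> \<in> nonneg_comb \<alpha>"
  shows "e \<beta> \<in> root_space \<beta> \<and> e (- \<beta>) \<in> root_space (- \<beta>) \<and> e \<beta> \<noteq> 0 \<and> e (- \<beta>) \<noteq> 0 \<and>
    (\<forall>v\<in>U. \<forall>m p. mode (e \<beta>) m (mode (e (- \<beta>)) p v) \<in> U \<and> mode (e (- \<beta>)) p (mode (e \<beta>) m v) \<in> U)"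
proof -
  \<comment> \<open>\<open>c\<close> is 1 for a long and 2 for a short root. The normalization of
    \<open>h\<close> makes it also the value of the form on the pair, so the constant \<kappa> is
    \<open>K * c\<close>.\<close>
  obtain c :: nat where c: "c = 1 \<or> c = 2"
    and sp: "e \<beta> \<in> root_space \<beta>" "e (- \<beta>) \<in> root_space (- \<beta>)"
    and br: "super_bracket (e \<beta>) (e (- \<beta>)) = mat_scale (of_nat c) (t_vec B \<beta>)"
      "super_bracket (mat_scale (of_nat c) (t_vec B \<beta>)) (e \<beta>) = mat_scale 2 (e \<beta>)"
      "super_bracket (mat_scale (of_nat c) (t_vec B \<beta>)) (e (- \<beta>)) = mat_scale (-2) (e (- \<beta>))"
  proof (cases "\<beta> \<in> long_roots B")
    case True
    then have "\<beta> \<in> pos_long_roots B \<alpha>" using \<beta> by (simp add: pos_long_roots_def)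
    then show ?thesis using vectors that[of 1] unfolding root_vectors_def Let_def by simp
  next
    case False
    then have "\<beta> \<in> pos_short_roots B \<alpha>" using \<beta> by (simp add: pos_short_roots_def short_roots_def)
    then show ?thesis using vectors that[of 2] unfolding root_vectors_def Let_def by simp
  qed
  let ?H = "mat_scale (of_nat c) (t_vec B \<beta>)"
  have par: "e \<beta> \<in> osp_part False" "e (- \<beta>) \<in> osp_part False"
    using root_space_parity \<beta>(1) even_roots_minus[OF \<beta>(1)] sp by blast+
  have H: "?H = t_vec B (of_nat c *s \<beta>)" by (simp add: t_vec_smult[OF form])
  have Hc: "?H \<in> cartan" unfolding H by (rule t_vec_cartan[OF form])
  have "?H \<noteq> 0"
  proof
    assume "?H = 0"
    then have "of_nat c *s \<beta> = 0" using t_vec_eq_0[OF form] by (simp only: H)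
    then show False using even_roots_nonzero[OF \<beta>(1)] c by (auto simp: vec_eq_iff)
  qed
  then have nz: "e \<beta> \<noteq> 0" "e (- \<beta>) \<noteq> 0"
    using br(1) super_bracket_zero by metis+
  have "B (e \<beta>) (e (- \<beta>)) = of_nat c"
    by (rule coroot_form[OF form sp par(2) even_roots_nonzero[OF \<beta>(1)] br(1) refl])
  then have KB: "of_nat K * B (e \<beta>) (e (- \<beta>)) = of_nat (K * c)" "K * c > 0"
    using level c by auto
  have gen: "mode (e (- \<beta>)) (-2) (current (e \<beta>)) \<in> U"
    using even_in[OF \<beta>] .
  have "mode (e \<beta>) m (mode (e (- \<beta>)) p v) \<in> U" "mode (e (- \<beta>)) p (mode (e \<beta>) m v) \<in> U" if "v \<in> U" for v m p
    using even_pair_closed[OF subalgebra sp(1) par(1) sp(2) par(2) even_roots_nonzero[OF \<beta>(1)] br(1) Hc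
        current_cartan[OF Hc] br(2,3) KB gen that] by blast+
  then show ?thesis using sp nz by blast
qed

lemma positive_odd_pair:
  assumes \<beta>: "\<beta> \<in> pos_long_roots B \<alpha>"
  shows "x (half \<beta>) \<in> root_space (half \<beta>) \<and> x (- half \<beta>) \<in> root_space (- half \<beta>) \<and>
    x (half \<beta>) \<noteq> 0 \<and> x (- half \<beta>) \<noteq> 0 \<and>
    (\<forall>v\<in>U. \<forall>m p. mode (x (half \<beta>)) m (mode (x (- half \<beta>)) p v) \<in> U \<and>
       mode (x (- half \<beta>)) p (mode (x (half \<beta>)) m v) \<in> U)"
proof -
  let ?g = "half \<beta>" and ?H = "t_vec B \<beta>"
  have ev: "\<beta> \<in> even_roots" "\<beta> \<in> nonneg_comb \<alpha>"
    using \<beta> by (auto simp: pos_long_roots_def long_roots_def)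
  have sp: "x ?g \<in> root_space ?g" "x (- ?g) \<in> root_space (- ?g)"
    and H: "super_bracket (x ?g) (x (- ?g)) = ?H"
      "super_bracket ?H (x ?g) = x ?g" "super_bracket ?H (x (- ?g)) = - x (- ?g)"
    and xx: "super_bracket (x ?g) (x ?g) = mat_scale 2 (e \<beta>)"
      "super_bracket (x (- ?g)) (x (- ?g)) = mat_scale (-2) (e (- \<beta>))"
    and ex: "super_bracket (e \<beta>) (x ?g) = 0" "super_bracket (e \<beta>) (x (- ?g)) = - x ?g"
      "super_bracket (e (- \<beta>)) (x ?g) = - x (- ?g)" "super_bracket (e (- \<beta>)) (x (- ?g)) = 0"
    using vectors \<beta> unfolding root_vectors_def Let_def by blast+
  have E: "e \<beta> \<in> root_space \<beta>" "e (- \<beta>) \<in> root_space (- \<beta>)" "e \<beta> \<noteq> 0" "e (- \<beta>) \<noteq> 0"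
    and closed: "\<And>v m p. v \<in> U \<Longrightarrow> mode (e \<beta>) m (mode (e (- \<beta>)) p v) \<in> U"
      "\<And>v m p. v \<in> U \<Longrightarrow> mode (e (- \<beta>)) m (mode (e \<beta>) p v) \<in> U"
    using positive_even_pair[OF ev] by blast+
  have Epar: "e \<beta> \<in> osp_part False" "e (- \<beta>) \<in> osp_part False"
    using root_space_parity ev(1) even_roots_minus[OF ev(1)] E by blast+
  have g: "?g \<noteq> 0" "- ?g \<noteq> 0" "?g + ?g = \<beta>" "- (?g + ?g) = - \<beta>"
    using even_roots_nonzero[OF ev(1)] by (auto simp: vec_eq_iff)
  \<comment> \<open>Parity is recovered from the relations: an even vector has zero bracket with
    itself.\<close>
  have odd: "W \<in> osp_part True"
    if "W \<in> root_space \<nu>" "\<nu> \<noteq> 0" "super_bracket W W \<noteq> 0" for W :: "'n gl" and \<nu>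
    using root_space_homogeneous[OF that(1,2)] even_self_bracket[of W] that(3) by (metis (full_types))
  have sq: "mat_scale 2 (e \<beta>) \<noteq> 0" "mat_scale (-2) (e (- \<beta>)) \<noteq> 0"
    using E(3,4) by (auto simp: vec_eq_iff)
  have par: "x ?g \<in> osp_part True" "x (- ?g) \<in> osp_part True"
    using odd[OF sp(1) g(1)] odd[OF sp(2) g(2)] xx sq by auto
  have nz: "x ?g \<noteq> 0" "x (- ?g) \<noteq> 0"
    using xx sq super_bracket_zero by metis+
  have Hc: "?H \<in> cartan" by (rule t_vec_cartan[OF form])
  \<comment> \<open>The bracket is the image of \<beta>, which is twice the root of
    \<open>x (half \<beta>)\<close>; hence the value 2.\<close>
  have "B (x ?g) (x (- ?g)) = 2"
    by (rule coroot_form[OF form sp par(2) g(1), of 1 \<beta>]) (simp_all add: H(1) vec_eq_iff)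
  then have KB: "of_nat K * B (x ?g) (x (- ?g)) = of_nat (2 * K)" by simp
  have "mode (x ?g) m (mode (x (- ?g)) p v) \<in> U" "mode (x (- ?g)) p (mode (x ?g) m v) \<in> U" if "v \<in> U" for v m p
    using odd_pair_closed[OF subalgebra sp(1) par(1) sp(2) par(2) g(1) _ Epar(1) _ Epar(2) H(1) Hc
        current_cartan[OF Hc] H(2,3) xx ex(1,2,3,4) KB level closed odd_in[OF \<beta>] that]
      E(1,2) unfolding g(3) by blast+
  then show ?thesis using sp nz by blast
qed

text \<open>Root spaces are lines, so the fixed root vectors suffice. For a negative root the roles
  of the two vectors are exchanged, for which the positive pairs are closed in both orders.\<close>

lemma root_pair_closed:
  assumes "\<beta> \<noteq> 0" and a: "a \<in> root_space \<beta>" and b: "b \<in> root_space (- \<beta>)" and v: "v \<in> U"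
  shows "mode a m (mode b p v) \<in> U"
proof -
  have mult: "mode a m (mode b p v) \<in> U"
    if E: "E \<in> root_space \<beta>" "E \<noteq> 0" and F: "F \<in> root_space (- \<beta>)" "F \<noteq> 0"
      and EF: "mode E m (mode F p v) \<in> U" for E F
  proof -
    obtain c where c: "a = mat_scale c E" using root_space_multiple[OF E a assms(1)] by blast
    obtain d where d: "b = mat_scale d F" using root_space_multiple[OF F b] assms(1) by auto
    have "mode a m (mode b p v) = smul c (smul d (mode E m (mode F p v)))"
      using E F by (simp add: c d mode_scale mode_smul_right root_space_osp)
    then show ?thesis using EF by (simp add: subspace_scale[OF sub_subspace] del: scale_scale)
  qed
  show ?thesis
  proof (cases "a = 0")
    case True
    then show ?thesis by (simp add: aff_act_zero_left subspace_0[OF sub_subspace])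
  next
    case False
    obtain r q where rq: "\<not> isl r" "r \<noteq> q" "\<beta> = index_weight r - index_weight q"
      using root_space_cases[OF a False assms(1)] by metis
    show ?thesis
    proof (cases "isl q")
      case False
      then have even: "\<beta> \<in> even_roots" using root_vec_in_roots[OF rq(2)] rq by simp
      then have "\<beta> \<in> nonneg_comb \<alpha> \<or> - \<beta> \<in> nonneg_comb \<alpha>"
        using simple by (auto simp: simple_system_def roots_def)
      then show ?thesis
      proof
        assume "\<beta> \<in> nonneg_comb \<alpha>"
        then show ?thesis using positive_even_pair[OF even] mult v by blast
      next
        assume "- \<beta> \<in> nonneg_comb \<alpha>"
        then show ?thesis
          using positive_even_pair[OF even_roots_minus[OF even]] mult v by (simp only: minus_minus) blast
      qed
    next
      case True
      then have "index_weight q = (0 :: complex ^ 'n)" by (cases q) auto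
      then have \<beta>: "\<beta> = index_weight r" using rq(3) by simp
      \<comment> \<open>An odd root is the weight of a symplectic index, hence half of a long root;
        either this long root or its negative is positive.\<close>
      have long: "2 *s \<beta> \<in> long_roots B" "2 *s (- \<beta>) \<in> long_roots B"
        using long_root[OF form rq(1)] long_root[OF form, of "dual_index r"] rq(1) by (auto simp: \<beta>)
      have neg: "2 *s (- \<beta>) = - (2 *s \<beta>)" by (simp add: vec_eq_iff)
      have half2: "half (2 *s \<mu>) = \<mu>" for \<mu> :: "complex ^ 'n" by (simp add: vec_eq_iff)
      have "2 *s \<beta> \<in> roots" using long(1) by (auto simp: long_roots_def roots_def)
      then have "2 *s \<beta> \<in> nonneg_comb \<alpha> \<or> 2 *s (- \<beta>) \<in> nonneg_comb \<alpha>"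
        using simple unfolding neg by (auto simp: simple_system_def)
      then show ?thesis
      proof
        assume "2 *s \<beta> \<in> nonneg_comb \<alpha>"
        then have "2 *s \<beta> \<in> pos_long_roots B \<alpha>" using long by (simp add: pos_long_roots_def)
        from positive_odd_pair[OF this] show ?thesis
          unfolding half2 using mult v by blast
      next
        assume "2 *s (- \<beta>) \<in> nonneg_comb \<alpha>"
        then have "2 *s (- \<beta>) \<in> pos_long_roots B \<alpha>" using long by (simp add: pos_long_roots_def)
        from positive_odd_pair[OF this] show ?thesis
          unfolding half2 minus_minus using mult v by blast
      qed
    qed
  qed
qed

sublocale pair_closed_subalgebra smul V Y vac B "of_nat K" \<rho> U
  by unfold_locales (fact subalgebra current_cartan root_pair_closed)+

end

lemma (in affine_vertex_superalgebra) pair_in_weight_zero: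
  assumes "a \<in> root_space (- \<beta>)" "a \<in> osp_part s" "b \<in> root_space \<beta>" "b \<in> osp_part t"
  shows "mode a m (mode b p vac) \<in> weight_zero_space \<rho>"
proof -
  have "[(a, - \<beta>, m), (b, \<beta>, p)] \<in> lists letters"
    using assms by (auto simp: letters_def)
  from cartan_word[OF _ this] show ?thesis by (simp add: weight_zero_space_def)
qed

theorem theorem2p1:
  fixes k :: nat
    and B :: "'n::finite gl \<Rightarrow> 'n gl \<Rightarrow> complex"
    and \<alpha> :: "'n \<Rightarrow> complex ^ 'n"
    and e x :: "complex ^ 'n \<Rightarrow> 'n gl"
    and smul :: "complex \<Rightarrow> 'v::ab_group_add \<Rightarrow> 'v"
    and \<rho> :: "'n aff \<Rightarrow> 'v \<Rightarrow> 'v"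
    and V :: "bool \<Rightarrow> 'v set"
    and Y :: "'v \<Rightarrow> int \<Rightarrow> 'v \<Rightarrow> 'v"
    and vac \<omega> :: 'v
  assumes "k > 0"
    and "normalized_form B"
    and "simple_system \<alpha>"
    and "root_vectors B \<alpha> e x"
    and "universal_affine_vosa B (of_nat k) smul \<rho> V Y vac \<omega>"
  shows "vertex_superalgebra.generated_subalgebra smul Y vac
      ({\<rho> (loop (t_vec B (\<alpha> i)) (-1)) vac | i. True} \<union>
       {\<rho> (loop (e (- \<beta>)) (-2)) (\<rho> (loop (e \<beta>) (-1)) vac) | \<beta>. \<beta> \<in> pos_long_roots B \<alpha>} \<union>
       {\<rho> (loop (x (- half \<beta>)) (-2)) (\<rho> (loop (x (half \<beta>)) (-1)) vac) | \<beta>. \<beta> \<in> pos_long_roots B \<alpha>} \<union>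
       {\<rho> (loop (e (- \<beta>)) (-2)) (\<rho> (loop (e \<beta>) (-1)) vac) | \<beta>. \<beta> \<in> pos_short_roots B \<alpha>})
    = weight_zero_space \<rho>"
    (is "vertex_superalgebra.generated_subalgebra smul Y vac ?S = _")
proof -
  have form: "invariant_form B" using assms(2) by (simp add: normalized_form_def)
  note vosa = assms(5)[unfolded universal_affine_vosa_def]
  interpret vertex_operator_superalgebra smul V Y vac \<omega> using vosa by blast
  interpret affine_vertex_superalgebra smul V Y vac B "of_nat k" \<rho>
    by unfold_locales (use vosa form in blast)+
  have in_U: "weight_zero_space \<rho> \<subseteq> U" if U: "vertex_subalgebra U" "?S \<subseteq> U" for U
  proof -
    interpret root_vector_subalgebra smul V Y vac B k \<rho> \<alpha> e x U
    proof unfold_locales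
      fix \<beta> assume "\<beta> \<in> even_roots" "\<beta> \<in> nonneg_comb \<alpha>"
      then have "\<beta> \<in> pos_long_roots B \<alpha> \<or> \<beta> \<in> pos_short_roots B \<alpha>"
        by (auto simp: pos_long_roots_def pos_short_roots_def short_roots_def)
      then show "mode (e (- \<beta>)) (-2) (current (e \<beta>)) \<in> U" using U(2) by blast
    qed (use assms U in blast)+
    show ?thesis by (rule weight_zero_in)
  qed
  have even_in: "mode (e (- \<beta>)) (-2) (current (e \<beta>)) \<in> weight_zero_space \<rho>"
    if "\<beta> \<in> pos_long_roots B \<alpha> \<or> \<beta> \<in> pos_short_roots B \<alpha>" for \<beta>
  proof -
    have "\<beta> \<in> even_roots" using that
      by (auto simp: pos_long_roots_def pos_short_roots_def short_roots_def long_roots_def)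
    then have "\<beta> \<noteq> 0" by (simp add: roots_of_parity_def)
    moreover have "e \<beta> \<in> root_space \<beta>" "e (- \<beta>) \<in> root_space (- \<beta>)"
      using assms(4) that unfolding root_vectors_def Let_def by blast+
    ultimately show ?thesis
      using root_space_homogeneous pair_in_weight_zero by (metis neg_equal_0_iff_equal)
  qed
  have odd_in: "mode (x (- half \<beta>)) (-2) (current (x (half \<beta>))) \<in> weight_zero_space \<rho>"
    if "\<beta> \<in> pos_long_roots B \<alpha>" for \<beta>
  proof -
    have "\<beta> \<in> even_roots" using that by (auto simp: pos_long_roots_def long_roots_def)
    then have "half \<beta> \<noteq> 0" by (auto simp: roots_of_parity_def vec_eq_iff)
    moreover have "x (half \<beta>) \<in> root_space (half \<beta>)" "x (- half \<beta>) \<in> root_space (- half \<beta>)"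
      using assms(4) that unfolding root_vectors_def Let_def by blast+
    ultimately show ?thesis
      using root_space_homogeneous pair_in_weight_zero by (metis neg_equal_0_iff_equal)
  qed
  have "current (t_vec B \<mu>) \<in> weight_zero_space \<rho>" for \<mu>
  proof -
    have t: "t_vec B \<mu> \<in> cartan" by (rule t_vec_cartan[OF form])
    then have "[(t_vec B \<mu>, 0, -1)] \<in> lists letters"
      using cartan_osp_part root_space_0 by (auto simp: letters_def)
    from cartan_word[OF _ this] show ?thesis by (simp add: weight_zero_space_def)
  qed
  then have "?S \<subseteq> weight_zero_space \<rho>"
    using even_in odd_in by blast
  then show ?thesis
    unfolding generated_subalgebra_def using weight_zero_subalgebra in_U by blast
qed

end
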